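(* Let $n\ge 2$, let $\lambda=(\lambda_1,\ldots,\lambda_n)\in(\mathbb{D}^* )^n$, and let $W_{d_\lambda}=(\mathbb{C}^n\setminus\{0\})/\langle d_\lambda\rangle$ be the associated $n$-dimensional diagonal Hopf manifold. Let $\psi_\lambda\colon\mathbb{Z}^n\to\mathbb{C}^*$ be the group homomorphism $m=(m_1,\ldots,m_n)\mapsto\lambda^m:=\lambda_1^{m_1}\cdots\lambda_n^{m_n}$. Then the algebraic dimension of $W_{d_\lambda}$ is $$a(W_{d_\lambda})=\mathrm{rank}(\ker\psi_\lambda).$$
   Context: $\mathbb{D}^*=\{w\in\mathbb{C}:0<|w|<1\}$. For $\lambda\in(\mathbb{D}^* )^n$, $d_\lambda\colon\mathbb{C}^n\to\mathbb{C}^n$ is the map $z\mapsto(\lambda_1z_1,\ldots,\lambda_nz_n)$, and $W_{d_\lambda}$ is the quotient of $\mathbb{C}^n\setminus\{0\}$ by the $\mathbb{Z}$-action generated by $d_\lambda$; it is a compact complex manifold. The algebraic dimension $a(X)$ of a compact connected complex manifold $X$ is the transcendence degree over $\mathbb{C}$ of its field of meromorphic functions $\mathbb{C}(X)$. The rank is that of a free abelian group (a subgroup of $\mathbb{Z}^n$). *)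

theory Defs
  imports
    "HOL-Analysis.Analysis"
    "HOL-Algebra.Ring"
    "HOL-Algebra.Free_Abelian_Groups"
begin

section \<open>Complex manifolds and their meromorphic functions\<close>

definition holo_on :: "(complex^'n \<Rightarrow> complex) \<Rightarrow> (complex^'n) set \<Rightarrow> bool" where
  "holo_on f S \<longleftrightarrow> open S \<and>
     (\<forall>z\<in>S. \<exists>D. (f has_derivative D) (at z) \<and> (\<forall>c v. D (c *s v) = c * D v))"

text \<open>A manifold is given by its topology together with an atlas, that is, a set of pairs
  \<open>(D, \<phi>)\<close> where \<open>\<phi>\<close> is a homeomorphism from the open set \<open>D\<close> onto an open subset of
  \<open>\<complex>\<^sup>n\<close>.  The values of \<open>\<phi>\<close> outside \<open>D\<close> are irrelevant.\<close>

type_synonym ('a, 'n) atlas = "('a set \<times> ('a \<Rightarrow> complex^'n)) set"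

definition holomorphic_fun ::
    "'a topology \<Rightarrow> ('a, 'n::finite) atlas \<Rightarrow> 'a set \<Rightarrow> ('a \<Rightarrow> complex) \<Rightarrow> bool" where
  "holomorphic_fun X A U f \<longleftrightarrow> openin X U \<and>
     (\<forall>(D, \<phi>)\<in>A. holo_on (f \<circ> inv_into D \<phi>) (\<phi> ` (U \<inter> D)))"

text \<open>A meromorphic function is represented by a holomorphic function on a dense open subset
  which is locally a quotient \<open>g / h\<close> of holomorphic functions, where \<open>h\<close> vanishes identically
  on no nonempty open subset of its domain.  Two representatives define the same meromorphic
  function if they agree on the intersection of their domains.\<close>

definition mero_rep ::
    "'a topology \<Rightarrow> ('a, 'n::finite) atlas \<Rightarrow> ('a set \<times> ('a \<Rightarrow> complex)) set" where
  "mero_rep X A = {(U, f).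
     holomorphic_fun X A U f \<and> X closure_of U = topspace X \<and>
     (\<forall>p\<in>topspace X. \<exists>V g h. p \<in> V \<and> holomorphic_fun X A V g \<and> holomorphic_fun X A V h \<and>
        V \<subseteq> X closure_of {x \<in> V. h x \<noteq> 0} \<and> (\<forall>x\<in>U \<inter> V. f x * h x = g x))}"

definition mero_rel ::
    "'a topology \<Rightarrow> ('a, 'n::finite) atlas \<Rightarrow>
     (('a set \<times> ('a \<Rightarrow> complex)) \<times> ('a set \<times> ('a \<Rightarrow> complex))) set" where
  "mero_rel X A = {((U, f), (V, g)).
     (U, f) \<in> mero_rep X A \<and> (V, g) \<in> mero_rep X A \<and> (\<forall>x\<in>U \<inter> V. f x = g x)}"

definition mero_const ::
    "'a topology \<Rightarrow> ('a, 'n::finite) atlas \<Rightarrow> complex \<Rightarrow> ('a set \<times> ('a \<Rightarrow> complex)) set" where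
  "mero_const X A c = mero_rel X A `` {(topspace X, \<lambda>_. c)}"

definition mero_field ::
    "'a topology \<Rightarrow> ('a, 'n::finite) atlas \<Rightarrow> ('a set \<times> ('a \<Rightarrow> complex)) set ring" where
  "mero_field X A =
     \<lparr>carrier = mero_rep X A // mero_rel X A,
      mult = (\<lambda>P Q. \<Union>(U, f)\<in>P. \<Union>(V, g)\<in>Q. mero_rel X A `` {(U \<inter> V, \<lambda>x. f x * g x)}),
      one = mero_const X A 1,
      ring.zero = mero_const X A 0,
      add = (\<lambda>P Q. \<Union>(U, f)\<in>P. \<Union>(V, g)\<in>Q. mero_rel X A `` {(U \<inter> V, \<lambda>x. f x + g x)})\<rparr>"


section \<open>Transcendence degree\<close>

text \<open>A multiset \<open>m\<close> over \<open>S\<close> encodes the monomial in which each \<open>x \<in> S\<close> has exponent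
  \<open>count m x\<close>; thus \<open>M\<close> and \<open>c\<close> below describe an arbitrary polynomial with coefficients
  in \<open>K\<close> and with variables indexed by \<open>S\<close>.\<close>

definition alg_indep :: "('r, 'b) ring_scheme \<Rightarrow> 'r set \<Rightarrow> 'r set \<Rightarrow> bool" where
  "alg_indep R K S \<longleftrightarrow> S \<subseteq> carrier R \<and>
     (\<forall>M c. finite M \<longrightarrow> (\<forall>m\<in>M. set_mset m \<subseteq> S) \<longrightarrow> c \<in> M \<rightarrow> K \<longrightarrow>
        (\<Oplus>\<^bsub>R\<^esub>m\<in>M. c m \<otimes>\<^bsub>R\<^esub> (\<Otimes>\<^bsub>R\<^esub>x\<in>set_mset m. x [^]\<^bsub>R\<^esub> count m x)) = \<zero>\<^bsub>R\<^esub> \<longrightarrow>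
        (\<forall>m\<in>M. c m = \<zero>\<^bsub>R\<^esub>))"

text \<open>The largest cardinality of an algebraically independent subset, and \<open>\<infinity>\<close> if there is no
  finite bound.\<close>

definition trdeg :: "('r, 'b) ring_scheme \<Rightarrow> 'r set \<Rightarrow> enat" where
  "trdeg R K = (SUP S \<in> {S. finite S \<and> alg_indep R K S}. enat (card S))"

definition algebraic_dimension :: "'a topology \<Rightarrow> ('a, 'n::finite) atlas \<Rightarrow> enat" where
  "algebraic_dimension X A = trdeg (mero_field X A) (range (mero_const X A))"


section \<open>Diagonal Hopf manifolds\<close>

definition diag_map :: "complex^'n \<Rightarrow> complex^'n \<Rightarrow> complex^'n" where
  "diag_map lam z = (\<chi> i. lam $ i * z $ i)"

text \<open>The orbit of \<open>z\<close> under the group generated by \<^term>\<open>diag_map lam\<close> (which is bijective if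
  no component of \<open>lam\<close> vanishes): the points \<open>w\<close> with \<open>w = d\<^sup>k z\<close> or \<open>w = d\<^sup>-\<^sup>k z\<close> for
  some \<open>k \<ge> 0\<close>.\<close>

definition hopf_proj :: "complex^'n \<Rightarrow> complex^'n \<Rightarrow> (complex^'n) set" where
  "hopf_proj lam z =
     {w. \<exists>k::nat. w = (diag_map lam ^^ k) z \<or> z = (diag_map lam ^^ k) w}"

definition hopf_topology :: "complex^'n \<Rightarrow> (complex^'n) set topology" where
  "hopf_topology lam = topology (\<lambda>U. U \<subseteq> hopf_proj lam ` (UNIV - {0}) \<and>
     openin (top_of_set (UNIV - {0})) {z \<in> UNIV - {0}. hopf_proj lam z \<in> U})"

lemma openin_hopf_topology:
  "openin (hopf_topology lam) U \<longleftrightarrow> U \<subseteq> hopf_proj lam ` (UNIV - {0}) \<and>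
     openin (top_of_set (UNIV - {0})) {z \<in> UNIV - {0}. hopf_proj lam z \<in> U}"
proof -
  let ?P = "hopf_proj lam" and ?E = "UNIV - {0::complex^'n}"
  let ?L = "\<lambda>U. U \<subseteq> ?P ` ?E \<and> openin (top_of_set ?E) {z \<in> ?E. ?P z \<in> U}"
  have "istopology ?L"
    unfolding istopology_def
  proof (intro conjI allI impI)
    fix S T assume *: "?L S" "?L T"
    then show "S \<inter> T \<subseteq> ?P ` ?E" by blast
    have "{z \<in> ?E. ?P z \<in> S \<inter> T} = {z \<in> ?E. ?P z \<in> S} \<inter> {z \<in> ?E. ?P z \<in> T}" by blast
    with * show "openin (top_of_set ?E) {z \<in> ?E. ?P z \<in> S \<inter> T}"
      by (metis (no_types, lifting) openin_Int)
  next
    fix \<K> assume *: "\<forall>K\<in>\<K>. ?L K"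
    then show "\<Union>\<K> \<subseteq> ?P ` ?E" by blast
    have "{z \<in> ?E. ?P z \<in> \<Union>\<K>} = (\<Union>K\<in>\<K>. {z \<in> ?E. ?P z \<in> K})" by blast
    moreover have "openin (top_of_set ?E) (\<Union>K\<in>\<K>. {z \<in> ?E. ?P z \<in> K})"
      using * by (intro openin_Union) blast
    ultimately show "openin (top_of_set ?E) {z \<in> ?E. ?P z \<in> \<Union>\<K>}" by metis
  qed
  then show ?thesis
    unfolding hopf_topology_def by (simp add: topology_inverse')
qed

text \<open>The charts are the local inverses of the covering map \<^term>\<open>hopf_proj lam\<close>.\<close>

definition hopf_atlas :: "complex^'n \<Rightarrow> ((complex^'n) set, 'n) atlas" where
  "hopf_atlas lam = {(hopf_proj lam ` V, inv_into V (hopf_proj lam)) | V.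
     open V \<and> V \<subseteq> UNIV - {0} \<and> inj_on (hopf_proj lam) V}"


section \<open>Multiplicative relations\<close>

definition int_vec_group :: "(int^'n) monoid" where
  "int_vec_group = \<lparr>carrier = UNIV, mult = (+), one = 0\<rparr>"

definition complex_units :: "complex monoid" where
  "complex_units = \<lparr>carrier = UNIV - {0}, mult = (*), one = 1\<rparr>"

definition psi :: "complex^'n \<Rightarrow> int^'n \<Rightarrow> complex" where
  "psi lam m = (\<Prod>i\<in>UNIV. lam $ i powi (m $ i))"

lemma psi_hom:
  assumes "\<And>i. lam $ i \<noteq> 0"
  shows "psi lam \<in> hom int_vec_group complex_units"
  using assms
  by (auto simp: hom_def int_vec_group_def complex_units_def psi_def power_int_add prod.distrib)

definition free_rank :: "('g, 'b) monoid_scheme \<Rightarrow> nat" where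
  "free_rank G = (THE r. G \<cong> free_Abelian_group {..<r})"

end

theory Submission
  imports Defs "HOL-Complex_Analysis.Complex_Analysis"
begin

text \<open>Pulled back to \<open>\<complex>\<^sup>n - {0}\<close>, a meromorphic function on the Hopf manifold is a meromorphic function \<open>F\<close>
with \<open>F (\<lambda> z) = F z\<close>, where \<open>\<lambda> z\<close> is the componentwise product.  For \<open>m\<close> in the kernel
of \<open>\<psi>\<close> the Laurent monomial \<open>z\<^sup>m\<close> is such a function.  Distinct Laurent monomials are linearly
independent, so a basis of the kernel gives algebraically independent functions, as many as
the rank \<open>r\<close> (\<open>independent_monomials\<close>).

That there are no more than \<open>r\<close> has three reasons.

First, \<open>F\<close> has no essential singularity at the origin: near \<open>0\<close> it is a quotient \<open>G / Q\<close> of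
holomorphic functions (\<open>meromorphic_quotient_at_0\<close>).  This is where \<open>n \<ge> 2\<close> enters; for \<open>n = 1\<close>
elliptic functions are counterexamples.  On almost every disc in a fixed direction \<open>v\<close> the
restriction of \<open>F\<close> is meromorphic with finitely many poles, so the moments
\<open>c\<^sub>j(w) = \<integral> F(w + \<zeta> v) \<zeta>\<^sup>j d\<zeta>\<close> over the unit circle satisfy a linear recurrence.  Since \<open>n \<ge> 2\<close>,
the disc centred at the origin has arbitrarily close translates that avoid the origin, while \<open>F\<close> stays
holomorphic near its boundary circle; so the moments are holomorphic near \<open>w = 0\<close>.  The Baire
category theorem bounds the length of the recurrence, and elimination makes its coefficients holomorphic in \<open>w\<close>; they are the coefficients of a
denominator for \<open>F\<close>.

Secondly, invariance makes \<open>F\<close> rational (\<open>invariant_eigen_quotient\<close>).  Expand \<open>G\<close> and \<open>Q\<close> into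
monomials and collect those with the same eigenvalue \<open>\<lambda>\<^sup>m = c\<close> into polynomials \<open>G\<^sub>c\<close> and \<open>Q\<^sub>c\<close>.
From \<open>F(z) Q(\<lambda>\<^sup>k z) = G(\<lambda>\<^sup>k z)\<close> for all \<open>k\<close> it follows that the power sums
\<open>\<Sum> c\<^sup>k (F(z) Q\<^sub>c(z) - G\<^sub>c(z))\<close> vanish for all \<open>k\<close>, whence \<open>F Q\<^sub>c = G\<^sub>c\<close> for every \<open>c\<close>;
and \<open>Q\<^sub>c \<noteq> 0\<close> for some \<open>c\<close>, as \<open>Q \<noteq> 0\<close>.

Thirdly, one counts (\<open>eigen_quotients_dependent\<close>).  Given \<open>s\<close> invariant functions, the
\<open>(N + 1)\<^sup>s\<close> monomials of degree at most \<open>N\<close> in each of them become, after multiplication by a common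
denominator, polynomials with one common eigenvalue \<open>\<omega>\<^sup>N\<close>.  The exponents \<open>m \<ge> 0\<close>
with \<open>\<lambda>\<^sup>m = \<omega>\<^sup>N\<close> have size \<open>O(N)\<close>, because all \<open>|\<lambda>\<^sub>i| < 1\<close>, and they differ by elements of
the kernel, so there are only \<open>O(N\<^sup>r)\<close> of them.  If \<open>s > r\<close>, there is a linear relation.\<close>

(* z $ i is always the i-th component of the vector z *)
no_notation fps_nth (infixl "$" 75)

section \<open>Holomorphic functions along complex lines\<close>

text \<open>By Osgood's lemma this is just holomorphy when \<open>S\<close> is open.  In this form the notion is closed under
integration over a parameter, and one-variable theory suffices to work with it.\<close>

definition line_holo :: "(complex^'n \<Rightarrow> complex) \<Rightarrow> (complex^'n) set \<Rightarrow> bool" where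
  "line_holo f S \<longleftrightarrow> continuous_on S f \<and>
     (\<forall>a v. (\<lambda>t. f (a + t *s v)) holomorphic_on {t. a + t *s v \<in> S})"

lemma continuous_on_vsmult [continuous_intros]:
  fixes g :: "'a::topological_space \<Rightarrow> complex^'n"
  assumes "continuous_on S f" "continuous_on S g"
  shows "continuous_on S (\<lambda>x. f x *s g x)"
  unfolding vector_scalar_mult_def using assms by (intro continuous_intros)

lemma norm_vsmult: "norm (c *s (v :: complex^'n)) = norm c * norm v"
  by (simp add: norm_vec_def vector_scalar_mult_def norm_mult L2_set_right_distrib)

lemma open_line_preimage:
  fixes S :: "(complex^'n) set"
  assumes "open S"
  shows "open {t. a + t *s v \<in> S}"
proof -
  have "open ((\<lambda>t. a + t *s v) -` S)"
    by (rule open_vimage[OF assms]) (intro continuous_intros)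
  then show ?thesis by (simp add: vimage_def)
qed

lemma line_holo_continuous: "line_holo f S \<Longrightarrow> continuous_on S f"
  by (simp add: line_holo_def)

lemma line_holo_line:
  "line_holo f S \<Longrightarrow> (\<And>t. t \<in> T \<Longrightarrow> a + t *s v \<in> S) \<Longrightarrow> (\<lambda>t. f (a + t *s v)) holomorphic_on T"
  unfolding line_holo_def by (metis (mono_tags, lifting) holomorphic_on_subset mem_Collect_eq subsetI)

lemma line_holo_subset: "line_holo f S \<Longrightarrow> T \<subseteq> S \<Longrightarrow> line_holo f T"
  unfolding line_holo_def
  by (meson Collect_mono continuous_on_subset holomorphic_on_subset in_mono)

lemma line_holo_cong: "(\<And>z. z \<in> S \<Longrightarrow> f z = g z) \<Longrightarrow> line_holo f S \<longleftrightarrow> line_holo g S"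
  unfolding line_holo_def
  by (intro conj_cong continuous_on_cong all_cong1 holomorphic_cong) auto

lemma line_holo_const [intro, simp]: "line_holo (\<lambda>_. c) S"
  by (simp add: line_holo_def)

lemma line_holo_add: "line_holo f S \<Longrightarrow> line_holo g S \<Longrightarrow> line_holo (\<lambda>z. f z + g z) S"
  by (auto simp: line_holo_def intro!: continuous_intros holomorphic_intros)

lemma line_holo_diff: "line_holo f S \<Longrightarrow> line_holo g S \<Longrightarrow> line_holo (\<lambda>z. f z - g z) S"
  by (auto simp: line_holo_def intro!: continuous_intros holomorphic_intros)

lemma line_holo_mult: "line_holo f S \<Longrightarrow> line_holo g S \<Longrightarrow> line_holo (\<lambda>z. f z * g z) S"
  by (auto simp: line_holo_def intro!: continuous_intros holomorphic_intros)

lemma line_holo_divide: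
  "line_holo f S \<Longrightarrow> line_holo g S \<Longrightarrow> (\<And>z. z \<in> S \<Longrightarrow> g z \<noteq> 0) \<Longrightarrow> line_holo (\<lambda>z. f z / g z) S"
  by (auto simp: line_holo_def intro!: continuous_intros holomorphic_intros)

lemma line_holo_power: "line_holo f S \<Longrightarrow> line_holo (\<lambda>z. f z ^ k) S"
  by (auto simp: line_holo_def intro!: continuous_intros holomorphic_intros)

lemma line_holo_sum: "(\<And>i. i \<in> I \<Longrightarrow> line_holo (f i) S) \<Longrightarrow> line_holo (\<lambda>z. \<Sum>i\<in>I. f i z) S"
  by (induction I rule: infinite_finite_induct) (auto intro!: line_holo_add)

lemma line_holo_prod: "(\<And>i. i \<in> I \<Longrightarrow> line_holo (f i) S) \<Longrightarrow> line_holo (\<lambda>z. \<Prod>i\<in>I. f i z) S"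
  by (induction I rule: infinite_finite_induct) (auto intro!: line_holo_mult)

lemma line_holo_component: "line_holo (\<lambda>z. z $ i) S"
  by (auto simp: line_holo_def vector_scalar_mult_def intro!: continuous_intros holomorphic_intros)

text \<open>The line through \<open>a\<close> in direction \<open>v\<close> is mapped to the line through \<open>\<phi> a\<close> in direction \<open>\<psi> v\<close>.\<close>

lemma line_holo_compose_affine:
  assumes "line_holo f S" and "continuous_on T \<phi>" and "\<And>z. z \<in> T \<Longrightarrow> \<phi> z \<in> S"
    and aff: "\<And>a v t. \<phi> (a + t *s v) = \<phi> a + t *s \<psi> v"
  shows "line_holo (\<lambda>z. f (\<phi> z)) T"
  unfolding line_holo_def
proof (intro conjI allI)
  show "continuous_on T (\<lambda>z. f (\<phi> z))"
    by (rule continuous_on_compose2[OF line_holo_continuous[OF assms(1)] assms(2)]) (use assms(3) in auto)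
  show "(\<lambda>t. f (\<phi> (a + t *s v))) holomorphic_on {t. a + t *s v \<in> T}" for a v
    unfolding aff by (rule line_holo_line[OF assms(1)]) (metis aff assms(3) mem_Collect_eq)
qed

lemma line_holo_translate:
  assumes "line_holo f S" "\<And>z. z \<in> T \<Longrightarrow> z + b \<in> S"
  shows "line_holo (\<lambda>z. f (z + b)) T"
  by (rule line_holo_compose_affine[OF assms(1), where \<psi> = "\<lambda>v. v"])
     (use assms in \<open>auto intro!: continuous_intros\<close>)

lemma line_holo_locally:
  assumes "\<And>z. z \<in> S \<Longrightarrow> \<exists>T. open T \<and> z \<in> T \<and> line_holo f T"
  shows "line_holo f S"
  unfolding line_holo_def
proof (intro conjI allI)
  show "continuous_on S f"
  proof (rule continuous_at_imp_continuous_on, rule ballI)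
    fix z assume "z \<in> S"
    then obtain T where T: "open T" "z \<in> T" "line_holo f T"
      using assms by blast
    then show "isCont f z"
      using line_holo_continuous[OF T(3)] T(1,2) by (simp add: continuous_on_eq_continuous_at)
  qed
  show "(\<lambda>t. f (a + t *s v)) holomorphic_on {t. a + t *s v \<in> S}" for a v
    unfolding holomorphic_on_def
  proof clarify
    fix t assume "a + t *s v \<in> S"
    then obtain T where T: "open T" "a + t *s v \<in> T" "line_holo f T"
      using assms by blast
    have "(\<lambda>t. f (a + t *s v)) holomorphic_on {t. a + t *s v \<in> T}"
      using T(3) by (simp add: line_holo_def)
    then have "(\<lambda>t. f (a + t *s v)) field_differentiable at t"
      using open_line_preimage[OF T(1)] T(2) holomorphic_on_imp_differentiable_at by blast
    then show "(\<lambda>t. f (a + t *s v)) field_differentiable at t within {t. a + t *s v \<in> S}"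
      using field_differentiable_at_within by blast
  qed
qed

lemma holo_on_imp_line_holo:
  assumes "holo_on f S"
  shows "line_holo f S"
  unfolding line_holo_def
proof (intro conjI allI)
  have D: "\<exists>D. (f has_derivative D) (at z) \<and> (\<forall>c v. D (c *s v) = c * D v)" if "z \<in> S" for z
    using assms that by (auto simp: holo_on_def)
  show "continuous_on S f"
  proof (rule continuous_at_imp_continuous_on, rule ballI)
    fix z assume "z \<in> S"
    from D[OF this] show "isCont f z" by (auto intro: has_derivative_continuous)
  qed
  show "(\<lambda>t. f (a + t *s v)) holomorphic_on {t. a + t *s v \<in> S}" for a v
    unfolding holomorphic_on_def
  proof clarify
    fix t assume "a + t *s v \<in> S"
    then obtain D where D: "(f has_derivative D) (at (a + t *s v))" "\<And>c v. D (c *s v) = c * D v"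
      using D by blast
    have "bounded_linear (\<lambda>t::complex. t *s v)"
    proof (rule bounded_linear_intro)
      show "norm (x *s v) \<le> norm x * norm v" for x by (simp add: norm_vsmult)
    qed (auto simp: vec_eq_iff algebra_simps)
    then have "((\<lambda>t. a + t *s v) has_derivative (\<lambda>t. t *s v)) (at t)"
      by (auto intro!: derivative_eq_intros bounded_linear_imp_has_derivative)
    then have "((\<lambda>t. f (a + t *s v)) has_derivative (\<lambda>t. D (t *s v))) (at t)"
      using D(1) by (rule has_derivative_compose)
    then have "((\<lambda>t. f (a + t *s v)) has_field_derivative D v) (at t)"
      by (simp add: D(2) has_field_derivative_def mult.commute[of _ "D v"])
    then show "(\<lambda>t. f (a + t *s v)) field_differentiable at t within {t. a + t *s v \<in> S}"
      using field_differentiable_at_within field_differentiable_def by blast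
  qed
qed

text \<open>The segment from a point of \<open>T\<close> to \<open>z\<close> spans a complex line that meets \<open>S\<close> in a convex, hence connected,
set; the one-variable identity theorem applies there.\<close>

lemma line_holo_identity:
  fixes f :: "complex^'n \<Rightarrow> complex"
  assumes f: "line_holo f S" and S: "open S" "convex S"
    and T: "open T" "T \<noteq> {}" "T \<subseteq> S" "\<And>z. z \<in> T \<Longrightarrow> f z = 0" and z: "z \<in> S"
  shows "f z = 0"
proof -
  obtain p where p: "p \<in> T" using T by blast
  let ?X = "\<lambda>A. {t. p + t *s (z - p) \<in> A}"
  have cv: "convex (?X S)"
    unfolding convex_alt
  proof clarify
    fix s t u assume *: "p + s *s (z - p) \<in> S" "p + t *s (z - p) \<in> S" and "0 \<le> (u::real)" "u \<le> 1"
    have "p + ((1 - u) *\<^sub>R s + u *\<^sub>R t) *s (z - p) =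
        (1 - u) *\<^sub>R (p + s *s (z - p)) + u *\<^sub>R (p + t *s (z - p))"
      by (vector scaleR_conv_of_real algebra_simps)
    also have "\<dots> \<in> S" using S(2) * \<open>0 \<le> u\<close> \<open>u \<le> 1\<close> by (simp add: convex_alt)
    finally show "p + ((1 - u) *\<^sub>R s + u *\<^sub>R t) *s (z - p) \<in> S" .
  qed
  have "f (p + 1 *s (z - p)) = 0"
  proof (rule analytic_continuation_open[of "?X T" "?X S" "\<lambda>t. f (p + t *s (z - p))" "\<lambda>_. 0" 1])
    show "open (?X T)" "open (?X S)" by (intro open_line_preimage T S)+
    have "0 \<in> ?X T" using p by simp
    then show "?X T \<noteq> {}" by blast
    show "connected (?X S)" using cv convex_connected by blast
    show "?X T \<subseteq> ?X S" using T by auto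
    show "(\<lambda>t. f (p + t *s (z - p))) holomorphic_on ?X S" by (rule line_holo_line[OF f]) auto
    show "1 \<in> ?X S" using z by simp
  qed (use T in auto)
  then show ?thesis by simp
qed

lemma line_holo_nonzero_dense:
  assumes "line_holo f S" "open S" "convex S" "z \<in> S" "f z \<noteq> 0"
  shows "S \<subseteq> closure {z \<in> S. f z \<noteq> 0}"
proof
  fix x assume x: "x \<in> S"
  show "x \<in> closure {z \<in> S. f z \<noteq> 0}"
  proof (rule ccontr)
    assume "x \<notin> closure {z \<in> S. f z \<noteq> 0}"
    then have x': "x \<in> S \<inter> - closure {z \<in> S. f z \<noteq> 0}" using x by blast
    have "f z = 0"
      by (rule line_holo_identity[OF assms(1-3), of "S \<inter> - closure {z \<in> S. f z \<noteq> 0}"])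
         (use assms x' closure_subset[of "{z \<in> S. f z \<noteq> 0}"] in auto)
    with assms show False by simp
  qed
qed

lemma open_nonzero: "continuous_on S f \<Longrightarrow> open S \<Longrightarrow> open {z \<in> S. f z \<noteq> (0::complex)}"
proof -
  assume "continuous_on S f" "open S"
  then have "open (S \<inter> f -` (- {0}))" by (intro continuous_open_preimage) auto
  moreover have "S \<inter> f -` (- {0}) = {z \<in> S. f z \<noteq> 0}" by blast
  ultimately show ?thesis by simp
qed

lemma line_holo_mult_nonzero:
  assumes "line_holo f S" "line_holo g S" "open S" "convex S"
    and "a \<in> S" "f a \<noteq> 0" "b \<in> S" "g b \<noteq> 0"
  shows "\<exists>z\<in>S. f z * g z \<noteq> 0"
proof (rule ccontr)
  assume "\<not> ?thesis"
  then have *: "\<And>z. z \<in> {z \<in> S. f z \<noteq> 0} \<Longrightarrow> g z = 0" by auto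
  have "g b = 0"
    by (rule line_holo_identity[OF assms(2-4), of "{z \<in> S. f z \<noteq> 0}"])
       (use assms open_nonzero[OF line_holo_continuous[OF assms(1)] assms(3)] * in auto)
  with assms show False by simp
qed

text \<open>On each line, Cauchy's formula for \<open>K t\<close> can be integrated over \<open>t\<close> by Fubini's theorem.  So the integral
again satisfies Cauchy's formula, and this makes it differentiable.\<close>

lemma line_holo_circle_integral:
  fixes K :: "complex \<Rightarrow> complex^'n \<Rightarrow> complex"
  assumes S: "open S" and r: "0 < r"
    and cont: "continuous_on (sphere 0 r \<times> S) (\<lambda>(t, w). K t w)"
    and hol: "\<And>t. t \<in> sphere 0 r \<Longrightarrow> line_holo (K t) S"
  shows "line_holo (\<lambda>w. contour_integral (circlepath 0 r) (\<lambda>t. K t w)) S"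
  unfolding line_holo_def
proof (intro conjI allI)
  let ?J = "\<lambda>w. contour_integral (circlepath 0 r) (\<lambda>t. K t w)"
  have circ: "circlepath 0 r x \<in> sphere 0 r" for x
    using r by (simp add: circlepath norm_mult)
  have vd: "continuous_on T (\<lambda>x. vector_derivative (circlepath z r) (at x))" for z and T :: "real set"
    unfolding vector_derivative_circlepath by (intro continuous_intros)
  have "continuous_on (S \<times> cbox 0 (1::real)) (\<lambda>(w, x). K (circlepath 0 r x) w * vector_derivative (circlepath 0 r) (at x))"
    unfolding split_def
  proof (intro continuous_on_mult)
    have "continuous_on (S \<times> cbox 0 (1::real)) (\<lambda>y. (circlepath 0 r (snd y), fst y))"
      unfolding circlepath by (intro continuous_intros)
    then have "continuous_on (S \<times> cbox 0 1) ((\<lambda>(t, w). K t w) \<circ> (\<lambda>y. (circlepath 0 r (snd y), fst y)))"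
      by (rule continuous_on_compose) (rule continuous_on_subset[OF cont], use circ in auto)
    then show "continuous_on (S \<times> cbox 0 1) (\<lambda>p. K (circlepath 0 r (snd p)) (fst p))"
      by (simp add: o_def)
    show "continuous_on (S \<times> cbox 0 1) (\<lambda>p. vector_derivative (circlepath 0 r) (at (snd p)))"
      unfolding vector_derivative_circlepath by (intro continuous_intros)
  qed
  then have "continuous_on S (\<lambda>w. integral (cbox 0 1) (\<lambda>x. K (circlepath 0 r x) w * vector_derivative (circlepath 0 r) (at x)))"
    by (rule integral_continuous_on_param)
  then show cJ: "continuous_on S ?J"
    by (simp add: contour_integral_integral)
  have Kint: "(\<lambda>t. K t w) contour_integrable_on circlepath 0 r" if "w \<in> S" for w
  proof (rule contour_integrable_continuous_circlepath)
    have "continuous_on (sphere 0 r) ((\<lambda>(t, w). K t w) \<circ> (\<lambda>t. (t, w)))"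
      by (rule continuous_on_compose, intro continuous_intros, rule continuous_on_subset[OF cont])
         (use that in auto)
    then show "continuous_on (path_image (circlepath 0 r)) (\<lambda>t. K t w)"
      using r by (simp add: o_def)
  qed
  fix a v
  let ?T = "{t. a + t *s v \<in> S}"
  show "(\<lambda>s. ?J (a + s *s v)) holomorphic_on ?T"
    unfolding holomorphic_on_def
  proof
    fix s0 assume s0: "s0 \<in> ?T"
    have "open ?T" by (rule open_line_preimage[OF S])
    then obtain d where d: "d > 0" "cball s0 d \<subseteq> ?T"
      using s0 open_contains_cball by blast
    let ?j = "\<lambda>s. ?J (a + s *s v)"
    have cj: "continuous_on (cball s0 d) ?j"
      by (rule continuous_on_compose2[OF cJ]) (use d in \<open>auto intro!: continuous_intros\<close>)
    have rep: "((\<lambda>u. ?j u / (u - s)^1) has_contour_integral 2 * of_real pi * \<i> * ?j s) (circlepath s0 d)"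
      if s: "s \<in> ball s0 d" for s
    proof -
      have CI: "((\<lambda>u. K t (a + u *s v) / (u - s)) has_contour_integral
             (2 * of_real pi * \<i> * K t (a + s *s v))) (circlepath s0 d)" if t: "t \<in> sphere 0 r" for t
      proof (rule Cauchy_integral_circlepath)
        have h: "(\<lambda>u. K t (a + u *s v)) holomorphic_on cball s0 d"
          using hol[OF t] by (rule line_holo_line) (use d in auto)
        then show "continuous_on (cball s0 d) (\<lambda>u. K t (a + u *s v))"
          by (rule holomorphic_on_imp_continuous_on)
        show "(\<lambda>u. K t (a + u *s v)) holomorphic_on ball s0 d"
          using h ball_subset_cball holomorphic_on_subset by blast
        show "norm (s - s0) < d" using s by (simp add: dist_norm norm_minus_commute)
      qed
      have swap: "contour_integral (circlepath 0 r) (\<lambda>t. contour_integral (circlepath s0 d) (\<lambda>u. K t (a + u *s v) / (u - s))) =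
          contour_integral (circlepath s0 d) (\<lambda>u. contour_integral (circlepath 0 r) (\<lambda>t. K t (a + u *s v) / (u - s)))"
      proof (rule contour_integral_swap)
        have "continuous_on (sphere 0 r \<times> sphere s0 d) (\<lambda>y. (fst y, a + snd y *s v))"
          by (intro continuous_intros)
        then have "continuous_on (sphere 0 r \<times> sphere s0 d) ((\<lambda>(t, w). K t w) \<circ> (\<lambda>y. (fst y, a + snd y *s v)))"
          by (rule continuous_on_compose) (rule continuous_on_subset[OF cont], use d in \<open>auto simp: subset_eq\<close>)
        then have "continuous_on (sphere 0 r \<times> sphere s0 d) (\<lambda>y. K (fst y) (a + snd y *s v) / (snd y - s))"
          by (intro continuous_on_divide) (use s in \<open>auto intro!: continuous_intros simp: o_def\<close>)
        then show "continuous_on (path_image (circlepath 0 r) \<times> path_image (circlepath s0 d))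
            (\<lambda>(y1, y2). K y1 (a + y2 *s v) / (y2 - s))"
          using r d by (simp add: split_def)
        show "continuous_on {0..1} (\<lambda>t. vector_derivative (circlepath s0 d) (at t))"
          unfolding vector_derivative_circlepath by (intro continuous_intros)
      qed (auto intro: vd)
      have "contour_integral (circlepath s0 d) (\<lambda>u. ?j u / (u - s)) =
        contour_integral (circlepath s0 d) (\<lambda>u. contour_integral (circlepath 0 r) (\<lambda>t. K t (a + u *s v) / (u - s)))"
      proof (rule contour_integral_eq)
        fix u assume "u \<in> path_image (circlepath s0 d)"
        then have "a + u *s v \<in> S" using d by (auto simp: subset_eq)
        from contour_integral_rmul[OF Kint[OF this], of "inverse (u - s)"]
        show "?j u / (u - s) = contour_integral (circlepath 0 r) (\<lambda>t. K t (a + u *s v) / (u - s))"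
          by (simp add: divide_inverse)
      qed
      also have "\<dots> = contour_integral (circlepath 0 r) (\<lambda>t. 2 * of_real pi * \<i> * K t (a + s *s v))"
        unfolding swap[symmetric]
        by (rule contour_integral_eq) (use CI r in \<open>auto simp: contour_integral_unique\<close>)
      also have "\<dots> = 2 * of_real pi * \<i> * ?j s"
        by (rule contour_integral_lmul[OF Kint]) (use s d in \<open>auto simp: subset_eq\<close>)
      finally have "contour_integral (circlepath s0 d) (\<lambda>u. ?j u / (u - s)) = 2 * of_real pi * \<i> * ?j s" .
      moreover have "(\<lambda>u. ?j u / (u - s)) contour_integrable_on circlepath s0 d"
        by (rule contour_integrable_continuous_circlepath, intro continuous_intros)
           (use d s in \<open>auto intro: continuous_on_subset[OF cj] simp: less_imp_le\<close>)
      ultimately show ?thesis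
        using has_contour_integral_integral by fastforce
    qed
    have "((\<lambda>s. 2 * of_real pi * \<i> * ?j s) has_field_derivative
        (of_nat 1 * contour_integral (circlepath s0 d) (\<lambda>u. ?j u / (u - s0) ^ Suc 1))) (at s0)"
      by (rule Cauchy_next_derivative_circlepath[OF _ rep])
         (use d in \<open>auto intro: continuous_on_subset[OF cj] simp: less_imp_le\<close>)
    then have "((\<lambda>s. (2 * of_real pi * \<i> * ?j s) / (2 * of_real pi * \<i>)) has_field_derivative
        (of_nat 1 * contour_integral (circlepath s0 d) (\<lambda>u. ?j u / (u - s0) ^ Suc 1)) / (2 * of_real pi * \<i>)) (at s0)"
      by (rule DERIV_cdivide)
    then have "?j field_differentiable (at s0)"
      unfolding field_differentiable_def by (simp) blast
    then show "?j field_differentiable (at s0 within ?T)"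
      using field_differentiable_at_within by blast
  qed
qed

section \<open>Power series expansions\<close>

definition polydisc :: "real \<Rightarrow> (complex^'n) set" where
  "polydisc R = {z. \<forall>i. norm (z $ i) < R}"

lemma open_polydisc: "open (polydisc R :: (complex^'n) set)"
proof -
  have "polydisc R = (\<Inter>i. {z::complex^'n. norm (z $ i) < R})"
    by (auto simp: polydisc_def)
  moreover have "open {z::complex^'n. norm (z $ i) < R}" for i
    by (intro open_Collect_less continuous_intros)
  ultimately show ?thesis by (simp add: open_INT)
qed

lemma norm_le_sum_components:
  fixes z :: "complex^'n"
  shows "norm z \<le> (\<Sum>i\<in>UNIV. norm (z $ i))"
  by (simp add: norm_vec_def L2_set_le_sum)

lemma polydisc_subset_ball:
  assumes "e > 0"
  shows "\<exists>R>0. polydisc R \<subseteq> ball (0::complex^'n) e"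
proof (intro exI conjI subsetI)
  let ?R = "e / (real CARD('n))"
  show "?R > 0" using assms by simp
  fix z :: "complex^'n" assume "z \<in> polydisc ?R"
  then have "(\<Sum>i\<in>UNIV. norm (z $ i)) < (\<Sum>i\<in>(UNIV::'n set). ?R)"
    by (intro sum_strict_mono) (auto simp: polydisc_def)
  then show "z \<in> ball 0 e" using norm_le_sum_components[of z] by simp
qed

text \<open>The coefficients are Cauchy integrals in the \<open>i\<close>-th coordinate.  They no longer depend on that coordinate,
and they stay independent of every coordinate on which \<open>G\<close> does not depend.  This makes the expansion
in one coordinate after another end in constants.\<close>

lemma one_variable_coefficients:
  fixes G :: "complex^'n \<Rightarrow> complex"
  assumes G: "line_holo G (polydisc R)" and bound: "\<And>z. z \<in> polydisc R \<Longrightarrow> norm (G z) \<le> B"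
    and r: "0 < r" "r < R"
    and indep: "\<And>z z'. (\<And>k. k \<notin> S \<Longrightarrow> z $ k = z' $ k) \<Longrightarrow> G z = G z'"
  shows "\<exists>c. \<forall>j. line_holo (c j) (polydisc R) \<and>
      (\<forall>z\<in>polydisc R. norm (c j z) \<le> B * (1 / r) ^ j) \<and>
      (\<forall>z z'. (\<forall>k. k \<notin> insert i S \<longrightarrow> z $ k = z' $ k) \<longrightarrow> c j z = c j z') \<and>
      (\<forall>z\<in>polydisc R. norm (z $ i) < r \<longrightarrow> (\<lambda>j. c j z * (z $ i) ^ j) sums G z)"
proof -
  define upd where "upd = (\<lambda>(z::complex^'n) t. (\<chi> k. if k = i then t else z $ k))"
  have upd_in: "upd z t \<in> polydisc R" if "z \<in> polydisc R" "norm t < R" for z t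
    using that by (auto simp: upd_def polydisc_def)
  define c where "c = (\<lambda>j z. 1 / (2 * of_real pi * \<i>) *
      contour_integral (circlepath 0 r) (\<lambda>t. G (upd z t) / t ^ Suc j))"
  have line: "upd z t = upd z 0 + t *s axis i 1" for z t
    by (simp add: upd_def vec_eq_iff axis_def)
  have upd_aff: "upd (a + s *s v) t = upd a t + s *s upd v 0" for a v s t
    by (simp add: upd_def vec_eq_iff)
  have H: "(\<lambda>t. G (upd z t)) holomorphic_on ball 0 R" if z: "z \<in> polydisc R" for z
  proof -
    have "(\<lambda>t. G (upd z 0 + t *s axis i 1)) holomorphic_on ball 0 R"
      by (rule line_holo_line[OF G]) (metis line mem_ball_0 upd_in[OF z])
    then show ?thesis by (simp flip: line)
  qed
  have Hc: "continuous_on (cball 0 r) (\<lambda>t. G (upd z t))" if "z \<in> polydisc R" for z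
    by (rule continuous_on_subset[OF holomorphic_on_imp_continuous_on[OF H[OF that]]]) (use r in auto)
  have Hh: "(\<lambda>t. G (upd z t)) holomorphic_on ball 0 r" if "z \<in> polydisc R" for z
    by (rule holomorphic_on_subset[OF H[OF that]]) (use r in auto)
  have c_eq: "c j z = (deriv ^^ j) (\<lambda>t. G (upd z t)) 0 / fact j" if z: "z \<in> polydisc R" for j z
    using Cauchy_has_contour_integral_higher_derivative_circlepath[OF Hc[OF z] Hh[OF z], of 0 j] r
    by (simp add: c_def contour_integral_unique)
  have "line_holo (c j) (polydisc R)" for j
    unfolding c_def
  proof (intro line_holo_mult line_holo_const line_holo_circle_integral open_polydisc r)
    have "continuous_on (sphere 0 r \<times> polydisc R) (\<lambda>y. upd (snd y) (fst y))"
      unfolding upd_def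
    proof (intro continuous_on_vec_lambda)
      show "continuous_on (sphere 0 r \<times> polydisc R) (\<lambda>y. if k = i then fst y else snd y $ k)" for k
        by (cases "k = i") (auto intro!: continuous_intros)
    qed
    then have "continuous_on (sphere 0 r \<times> polydisc R) (\<lambda>y. G (upd (snd y) (fst y)))"
      by (rule continuous_on_compose2[OF line_holo_continuous[OF G]]) (use r in \<open>auto intro!: upd_in\<close>)
    then show "continuous_on (sphere 0 r \<times> polydisc R) (\<lambda>(t, z). G (upd z t) / t ^ Suc j)"
      unfolding split_def by (intro continuous_intros) (use r in auto)
    show "line_holo (\<lambda>z. G (upd z t) / t ^ Suc j) (polydisc R)" if t: "t \<in> sphere 0 r" for t
    proof (intro line_holo_divide line_holo_const)
      show "line_holo (\<lambda>z. G (upd z t)) (polydisc R)"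
      proof (rule line_holo_compose_affine[OF G])
        show "continuous_on (polydisc R) (\<lambda>z. upd z t)"
          unfolding upd_def
        proof (intro continuous_on_vec_lambda)
          show "continuous_on (polydisc R) (\<lambda>y. if k = i then t else y $ k)" for k
            by (cases "k = i") (auto intro!: continuous_intros)
        qed
      qed (use t r in \<open>auto intro!: upd_in simp: upd_aff\<close>)
    qed (use t r in auto)
  qed
  moreover have "norm (c j z) \<le> B * (1 / r) ^ j" if z: "z \<in> polydisc R" for j z
  proof -
    have "norm ((deriv ^^ j) (\<lambda>t. G (upd z t)) 0) \<le> fact j * B / r ^ j"
      by (rule Cauchy_inequality[OF Hh[OF z] Hc[OF z] r(1)])
         (use r in \<open>auto intro!: bound upd_in z\<close>)
    then show ?thesis
      using r by (simp add: c_eq[OF z] norm_divide field_simps)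
  qed
  moreover have "c j z = c j z'" if "\<forall>k. k \<notin> insert i S \<longrightarrow> z $ k = z' $ k" for j z z'
  proof -
    have "G (upd z t) = G (upd z' t)" for t
      by (rule indep) (use that in \<open>auto simp: upd_def\<close>)
    then show ?thesis by (simp add: c_def)
  qed
  moreover have "(\<lambda>j. c j z * (z $ i) ^ j) sums G z" if z: "z \<in> polydisc R" and zi: "norm (z $ i) < r" for z
  proof -
    have "upd z (z $ i) = z" by (simp add: upd_def vec_eq_iff)
    then show ?thesis
      using holomorphic_power_series[OF Hh[OF z], of "z $ i"] zi
      by (simp add: c_eq[OF z])
  qed
  ultimately show ?thesis by blast
qed

definition exponents_on :: "'n set \<Rightarrow> ('n \<Rightarrow> nat) set" where
  "exponents_on S = {m. \<forall>i. i \<notin> S \<longrightarrow> m i = 0}"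

lemma exponents_on_insert:
  assumes "i \<notin> S"
  shows "bij_betw (\<lambda>(m, j). m(i := j)) (exponents_on S \<times> UNIV) (exponents_on (insert i S))"
  by (rule bij_betw_byWitness[where f' = "\<lambda>m. (m(i := 0), m i)"])
     (use assms in \<open>auto simp: exponents_on_def fun_eq_iff\<close>)

lemma prod_fun_upd:
  assumes "finite S" "i \<notin> S"
  shows "(\<Prod>k\<in>insert i S. f k ((m(i := j)) k)) = f i j * (\<Prod>k\<in>S. f k (m k))"
proof -
  have "(\<Prod>k\<in>S. f k ((m(i := j)) k)) = (\<Prod>k\<in>S. f k (m k))"
    using assms by (intro prod.cong) auto
  then show ?thesis using assms by simp
qed

lemma geometric_product_summable:
  fixes q :: "'n::finite \<Rightarrow> real"
  assumes "finite S" and q: "\<And>i. 0 \<le> q i" "\<And>i. q i < 1"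
  shows "(\<lambda>m. \<Prod>i\<in>S. q i ^ m i) summable_on exponents_on S"
  using assms(1)
proof (induction S)
  case empty
  have "exponents_on {} = {\<lambda>_::'n. 0::nat}" by (auto simp: exponents_on_def)
  then show ?case by (simp add: summable_on_finite)
next
  case (insert i S)
  let ?f = "\<lambda>m. \<Prod>k\<in>insert i S. q k ^ m k"
  have "(\<lambda>y. ?f ((case y of (m, j) \<Rightarrow> m(i := j)))) summable_on exponents_on S \<times> UNIV"
  proof (rule summable_on_SigmaI)
    fix m :: "'n \<Rightarrow> nat" assume "m \<in> exponents_on S"
    have "((\<lambda>j. q i ^ j) has_sum 1 / (1 - q i)) UNIV"
      using q[of i] geometric_sums[of "q i"] by (intro sums_nonneg_imp_has_sum) auto
    then have "((\<lambda>j. (\<Prod>k\<in>S. q k ^ m k) * q i ^ j) has_sum (\<Prod>k\<in>S. q k ^ m k) * (1 / (1 - q i))) UNIV"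
      by (rule has_sum_cmult_right)
    then show "((\<lambda>y. ?f (case (m, y) of (m, j) \<Rightarrow> m(i := j))) has_sum (\<Prod>k\<in>S. q k ^ m k) * (1 / (1 - q i))) UNIV"
      using prod_fun_upd[OF insert.hyps, of "\<lambda>k j. q k ^ j"] by (simp add: mult.commute)
  next
    show "(\<lambda>m. (\<Prod>k\<in>S. q k ^ m k) * (1 / (1 - q i))) summable_on exponents_on S"
      by (rule summable_on_cmult_left[OF insert.IH])
  qed (use q in \<open>auto intro!: prod_nonneg\<close>)
  then show ?case
    using summable_on_reindex_bij_betw[OF exponents_on_insert[OF insert.hyps(2)], of ?f] by simp
qed

text \<open>Induction over the set of coordinates in which \<open>G\<close> has been expanded.  The coefficients obey
Cauchy's estimates, and comparison with a product of geometric series lets the iterated sum be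
rearranged into a single sum over multi-indices.\<close>

lemma partial_power_series:
  fixes G :: "complex^'n \<Rightarrow> complex"
  assumes G: "line_holo G (polydisc R)" and bound: "\<And>z. z \<in> polydisc R \<Longrightarrow> norm (G z) \<le> B"
    and r: "0 < r" "r < R" and S: "finite S"
  shows "\<exists>c. (\<forall>m\<in>exponents_on S. line_holo (c m) (polydisc R) \<and>
        (\<forall>z\<in>polydisc R. norm (c m z) \<le> B * (\<Prod>i\<in>S. (1 / r) ^ m i)) \<and>
        (\<forall>z z'. (\<forall>k. k \<notin> S \<longrightarrow> z $ k = z' $ k) \<longrightarrow> c m z = c m z')) \<and>
      (\<forall>z\<in>polydisc r. ((\<lambda>m. c m z * (\<Prod>i\<in>S. z $ i ^ m i)) has_sum G z) (exponents_on S))"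
  using S
proof (induction S)
  case empty
  have "exponents_on {} = {\<lambda>_::'n. 0::nat}" by (auto simp: exponents_on_def)
  moreover have "z \<in> polydisc R" if "z \<in> polydisc r" for z
    using that r by (force simp: polydisc_def intro: less_trans)
  ultimately show ?case
    using G bound by (intro exI[of _ "\<lambda>m. G"]) (auto simp: vec_eq_iff[symmetric] has_sum_finite_iff)
next
  case (insert i S)
  have rR: "z \<in> polydisc R" if "z \<in> polydisc r" for z :: "complex^'n"
    using that r by (force simp: polydisc_def intro: less_trans)
  obtain c where c: "\<And>m. m \<in> exponents_on S \<Longrightarrow> line_holo (c m) (polydisc R)"
      "\<And>m z. m \<in> exponents_on S \<Longrightarrow> z \<in> polydisc R \<Longrightarrow> norm (c m z) \<le> B * (\<Prod>i\<in>S. (1 / r) ^ m i)"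
      "\<And>m z z'. m \<in> exponents_on S \<Longrightarrow> (\<And>k. k \<notin> S \<Longrightarrow> z $ k = z' $ k) \<Longrightarrow> c m z = c m z'"
    and csum: "\<And>z. z \<in> polydisc r \<Longrightarrow> ((\<lambda>m. c m z * (\<Prod>i\<in>S. z $ i ^ m i)) has_sum G z) (exponents_on S)"
    using insert.IH by blast
  have "\<forall>m\<in>exponents_on S. \<exists>d. \<forall>j. line_holo (d j) (polydisc R) \<and>
      (\<forall>z\<in>polydisc R. norm (d j z) \<le> B * (\<Prod>i\<in>S. (1 / r) ^ m i) * (1 / r) ^ j) \<and>
      (\<forall>z z'. (\<forall>k. k \<notin> insert i S \<longrightarrow> z $ k = z' $ k) \<longrightarrow> d j z = d j z') \<and>
      (\<forall>z\<in>polydisc R. norm (z $ i) < r \<longrightarrow> (\<lambda>j. d j z * (z $ i) ^ j) sums c m z)"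
    by (intro ballI one_variable_coefficients c r)
  then obtain d where d: "\<And>m j. m \<in> exponents_on S \<Longrightarrow> line_holo (d m j) (polydisc R)"
      "\<And>m j z. m \<in> exponents_on S \<Longrightarrow> z \<in> polydisc R \<Longrightarrow>
          norm (d m j z) \<le> B * (\<Prod>i\<in>S. (1 / r) ^ m i) * (1 / r) ^ j"
      "\<And>m j z z'. m \<in> exponents_on S \<Longrightarrow> (\<And>k. k \<notin> insert i S \<Longrightarrow> z $ k = z' $ k) \<Longrightarrow> d m j z = d m j z'"
      "\<And>m z. m \<in> exponents_on S \<Longrightarrow> z \<in> polydisc R \<Longrightarrow> norm (z $ i) < r \<Longrightarrow>
          (\<lambda>j. d m j z * (z $ i) ^ j) sums c m z"
    unfolding bchoice_iff by blast
  define e where "e = (\<lambda>m. d (m(i := 0)) (m i))"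
  have res: "m(i := 0) \<in> exponents_on S" if "m \<in> exponents_on (insert i S)" for m :: "'n \<Rightarrow> nat"
    using that by (auto simp: exponents_on_def)
  have prod_res: "(\<Prod>k\<in>S. f k ((m(i := 0)) k)) * f i (m i) = (\<Prod>k\<in>insert i S. f k (m k))"
    for f :: "'n \<Rightarrow> nat \<Rightarrow> 'b::comm_monoid_mult" and m
    using prod_fun_upd[OF insert.hyps, of f "m(i := 0)" "m i"] by (simp add: mult.commute)
  have B: "0 \<le> B" if "z \<in> polydisc R" for z :: "complex^'n"
    using bound[OF that] norm_ge_zero[of "G z"] by linarith
  have e_bound: "norm (e m z) \<le> B * (\<Prod>k\<in>insert i S. (1 / r) ^ m k)"
    if "m \<in> exponents_on (insert i S)" "z \<in> polydisc R" for m z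
    using d(2)[OF res[OF that(1)] that(2), of "m i"] prod_res[of "\<lambda>k j. (1 / r) ^ j" m]
    by (simp add: e_def mult.assoc)
  have "((\<lambda>m. e m z * (\<Prod>k\<in>insert i S. z $ k ^ m k)) has_sum G z) (exponents_on (insert i S))"
    if z: "z \<in> polydisc r" for z
  proof -
    let ?g = "\<lambda>m. e m z * (\<Prod>k\<in>insert i S. z $ k ^ m k)"
    define q where "q = (\<lambda>k. norm (z $ k) / r)"
    have q: "0 \<le> q k" "q k < 1" for k
      using z r by (auto simp: q_def polydisc_def)
    have "(\<lambda>m. B * (\<Prod>k\<in>insert i S. q k ^ m k)) summable_on exponents_on (insert i S)"
      using insert.hyps q by (intro summable_on_cmult_right geometric_product_summable) auto
    moreover have g_le: "norm (?g m) \<le> B * (\<Prod>k\<in>insert i S. q k ^ m k)" if "m \<in> exponents_on (insert i S)" for m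
    proof -
      have "norm (?g m) \<le> (B * (\<Prod>k\<in>insert i S. (1 / r) ^ m k)) * (\<Prod>k\<in>insert i S. norm (z $ k) ^ m k)"
        unfolding norm_mult
        by (intro mult_mono e_bound that rR z)
           (use r B[OF rR[OF z]] in
             \<open>auto simp: prod_norm norm_power simp flip: norm_power intro!: mult_nonneg_nonneg prod_nonneg\<close>)
      also have "\<dots> = B * (\<Prod>k\<in>insert i S. q k ^ m k)"
        by (simp add: q_def power_divide prod_dividef field_simps prod.distrib)
      finally show ?thesis .
    qed
    ultimately have "(\<lambda>m. norm (?g m)) summable_on exponents_on (insert i S)"
      using Infinite_Sum.abs_summable_on_comparison_test'[of "\<lambda>m. B * (\<Prod>k\<in>insert i S. q k ^ m k)" _ ?g] by simp
    then have gsum: "?g summable_on exponents_on (insert i S)"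
      by (rule abs_summable_summable)
    have "((\<lambda>y. ?g (case y of (m, j) \<Rightarrow> m(i := j))) has_sum G z) (exponents_on S \<times> UNIV)"
    proof (rule has_sum_SigmaI[OF _ csum[OF z]])
      fix m :: "'n \<Rightarrow> nat" assume m: "m \<in> exponents_on S"
      have mi: "m(i := 0) = m" using m insert.hyps by (auto simp: exponents_on_def fun_eq_iff)
      have g_eq: "?g (m(i := j)) = d m j z * z $ i ^ j * (\<Prod>k\<in>S. z $ k ^ m k)" for j
        using prod_fun_upd[OF insert.hyps, of "\<lambda>k j. z $ k ^ j" m j] by (simp add: e_def mi mult.assoc)
      have "(\<lambda>y. ?g (case y of (m, j) \<Rightarrow> m(i := j))) summable_on exponents_on S \<times> UNIV"
        using gsum summable_on_reindex_bij_betw[OF exponents_on_insert[OF insert.hyps(2)], of ?g] by simp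
      then have "(\<lambda>j. ?g (m(i := j))) summable_on UNIV"
        using summable_on_SigmaD1[of "\<lambda>m j. ?g (m(i := j))" "exponents_on S" "\<lambda>_. UNIV" m] m
        by (simp add: split_def)
      then obtain s where s: "((\<lambda>j. ?g (m(i := j))) has_sum s) UNIV"
        by (auto simp: summable_on_def)
      moreover have "(\<lambda>j. ?g (m(i := j))) sums (c m z * (\<Prod>k\<in>S. z $ k ^ m k))"
        unfolding g_eq using d(4)[OF m rR[OF z]] z by (intro sums_mult2) (auto simp: polydisc_def)
      ultimately have "s = c m z * (\<Prod>k\<in>S. z $ k ^ m k)"
        using sums_unique2[OF has_sum_imp_sums[OF s]] by simp
      with s show "((\<lambda>j. ?g (case (m, j) of (m, j) \<Rightarrow> m(i := j))) has_sum c m z * (\<Prod>k\<in>S. z $ k ^ m k)) UNIV"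
        by simp
    next
      show "(\<lambda>y. ?g (case y of (m, j) \<Rightarrow> m(i := j))) summable_on exponents_on S \<times> UNIV"
        using gsum summable_on_reindex_bij_betw[OF exponents_on_insert[OF insert.hyps(2)], of ?g] by simp
    qed
    then show ?thesis
      using has_sum_reindex_bij_betw[OF exponents_on_insert[OF insert.hyps(2)], of ?g] by simp
  qed
  moreover have "line_holo (e m) (polydisc R)" if "m \<in> exponents_on (insert i S)" for m
    unfolding e_def by (rule d(1)[OF res[OF that]])
  moreover have "e m z = e m z'"
    if "m \<in> exponents_on (insert i S)" "\<And>k. k \<notin> insert i S \<Longrightarrow> z $ k = z' $ k" for m z z'
    unfolding e_def by (rule d(3)[OF res[OF that(1)] that(2)])
  ultimately show ?case using e_bound by (intro exI[of _ e]) blast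
qed

theorem power_series_at_0:
  fixes G :: "complex^'n \<Rightarrow> complex"
  assumes "line_holo G (ball 0 e)" "e > 0"
  shows "\<exists>a r. 0 < r \<and> polydisc r \<subseteq> ball (0::complex^'n) e \<and>
      (\<forall>z\<in>polydisc r. ((\<lambda>m. a m * (\<Prod>i\<in>UNIV. z $ i ^ m i)) has_sum G z) UNIV)"
proof -
  have "isCont G 0"
    using line_holo_continuous[OF assms(1)] assms(2) by (simp add: continuous_on_eq_continuous_at)
  then obtain d where d: "d > 0" "\<And>z. dist z 0 < d \<Longrightarrow> dist (G z) (G 0) < 1"
    unfolding continuous_at_eps_delta by (metis zero_less_one)
  obtain R where R: "R > 0" "polydisc R \<subseteq> ball (0::complex^'n) (min d e)"
    using polydisc_subset_ball[of "min d e"] d(1) assms(2) by auto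
  have bound: "norm (G z) \<le> norm (G 0) + 1" if "z \<in> polydisc R" for z
  proof -
    have "dist z 0 < d" using R(2) that by (auto simp: dist_commute)
    from d(2)[OF this] have "dist (G z) (G 0) < 1" .
    then show ?thesis using norm_triangle_ineq2[of "G z" "G 0"] by (simp add: dist_norm)
  qed
  have hol: "line_holo G (polydisc R)" by (rule line_holo_subset[OF assms(1)]) (use R(2) in auto)
  have R2: "0 < R / 2" "R / 2 < R" using R(1) by auto
  have E: "exponents_on UNIV = (UNIV :: ('n \<Rightarrow> nat) set)" by (auto simp: exponents_on_def)
  have "\<exists>c. (\<forall>m\<in>exponents_on UNIV. line_holo (c m) (polydisc R) \<and>
        (\<forall>z\<in>polydisc R. norm (c m z) \<le> (norm (G 0) + 1) * (\<Prod>i\<in>UNIV. (1 / (R / 2)) ^ m i)) \<and>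
        (\<forall>z z'. (\<forall>k. k \<notin> UNIV \<longrightarrow> z $ k = z' $ k) \<longrightarrow> c m z = c m z')) \<and>
      (\<forall>z\<in>polydisc (R / 2). ((\<lambda>m. c m z * (\<Prod>i\<in>UNIV. z $ i ^ m i)) has_sum G z) (exponents_on UNIV))"
    by (rule partial_power_series[OF hol _ R2]) (auto intro: bound)
  then obtain c where c': "\<forall>m\<in>exponents_on UNIV. line_holo (c m) (polydisc R) \<and>
        (\<forall>z\<in>polydisc R. norm (c m z) \<le> (norm (G 0) + 1) * (\<Prod>i\<in>UNIV. (1 / (R / 2)) ^ m i)) \<and>
        (\<forall>z z'. (\<forall>k. k \<notin> UNIV \<longrightarrow> z $ k = z' $ k) \<longrightarrow> c m z = c m z')"
      and csum': "\<forall>z\<in>polydisc (R / 2). ((\<lambda>m. c m z * (\<Prod>i\<in>UNIV. z $ i ^ m i)) has_sum G z) (exponents_on UNIV)"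
    by (elim exE conjE)
  have c: "c m z = c m z'" for m z z' using c' by (simp add: E)
  note csum = csum'[unfolded E, rule_format]
  have "polydisc (R / 2) \<subseteq> (polydisc R :: (complex^'n) set)"
    unfolding polydisc_def using less_trans[OF _ R2(2)] by blast
  with R(2) have "polydisc (R / 2) \<subseteq> ball (0::complex^'n) e" by auto
  moreover have "((\<lambda>m. c m 0 * (\<Prod>i\<in>UNIV. z $ i ^ m i)) has_sum G z) UNIV" if "z \<in> polydisc (R / 2)" for z
    using csum[OF that] by (simp add: c[of _ z 0])
  ultimately show ?thesis
    using R(1) by (intro exI[of _ "\<lambda>m. c m 0"] exI[of _ "R / 2"]) auto
qed

section \<open>Generic slices\<close>

text \<open>A Baire category argument.  The curves \<open>\<zeta> \<mapsto> a(\<zeta>) x + b(\<zeta>)\<close> depend on a parameter \<open>x\<close>; a curve is bad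
when it runs for a while inside the zero set of one of the countably many \<open>h i\<close>.  For fixed \<open>\<zeta>\<close> the point on the
curve depends on \<open>x\<close> by a homeomorphism, as \<open>a(\<zeta>) \<noteq> 0\<close>.  Hence for each disc of a countable basis the
parameters that are good on this disc contain a dense open set.  Further dense open conditions
\<open>\<G>\<close> can be imposed at the same time.\<close>

lemma generic_parameter:
  fixes B :: "'i \<Rightarrow> (complex^'n) set" and h :: "'i \<Rightarrow> complex^'n \<Rightarrow> complex"
    and a :: "complex \<Rightarrow> complex" and b :: "complex \<Rightarrow> complex^'n"
  assumes I: "countable I"
    and B: "\<And>i. i \<in> I \<Longrightarrow> open (B i)" "\<And>i. i \<in> I \<Longrightarrow> continuous_on (B i) (h i)"
      "\<And>i. i \<in> I \<Longrightarrow> B i \<subseteq> closure {z \<in> B i. h i z \<noteq> 0}"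
    and a: "\<And>\<zeta>. \<zeta> \<in> Z \<Longrightarrow> a \<zeta> \<noteq> 0"
    and G: "countable \<G>" "\<And>T. T \<in> \<G> \<Longrightarrow> open T" "\<And>T. T \<in> \<G> \<Longrightarrow> \<Lambda> \<subseteq> closure T"
    and \<Lambda>: "open \<Lambda>" "\<Lambda> \<noteq> {}"
  shows "\<exists>x\<in>\<Lambda>. (\<forall>T\<in>\<G>. x \<in> T) \<and> (\<forall>i\<in>I. \<forall>\<zeta>\<in>Z. a \<zeta> *s x + b \<zeta> \<in> B i \<longrightarrow>
      (\<forall>e>0. \<exists>\<zeta>'\<in>Z. dist \<zeta>' \<zeta> < e \<and> a \<zeta>' *s x + b \<zeta>' \<in> B i \<and> h i (a \<zeta>' *s x + b \<zeta>') \<noteq> 0))"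
proof -
  define \<gamma> where "\<gamma> = (\<lambda>x \<zeta>. a \<zeta> *s x + b \<zeta>)"
  obtain \<B> :: "complex set set" where \<B>: "countable \<B>" "topological_basis \<B>"
    using ex_countable_basis by blast
  define D where "D = (\<lambda>(i, N). {x. \<exists>\<zeta>\<in>N \<inter> Z. \<gamma> x \<zeta> \<in> B i \<and> h i (\<gamma> x \<zeta>) \<noteq> 0} \<union>
      interior {x. \<forall>\<zeta>\<in>N \<inter> Z. \<gamma> x \<zeta> \<notin> B i})"
  have openD: "open (D (i, N))" if i: "i \<in> I" for i N
  proof -
    have "{x. \<exists>\<zeta>\<in>N \<inter> Z. \<gamma> x \<zeta> \<in> B i \<and> h i (\<gamma> x \<zeta>) \<noteq> 0} =
        (\<Union>\<zeta>\<in>N \<inter> Z. (\<lambda>x. \<gamma> x \<zeta>) -` {z \<in> B i. h i z \<noteq> 0})" by auto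
    moreover have "open \<dots>"
      by (intro open_UN ballI open_vimage open_nonzero B i) (auto simp: \<gamma>_def intro!: continuous_intros)
    ultimately show ?thesis by (auto simp: D_def)
  qed
  have denseD: "closure (D (i, N)) = UNIV" if i: "i \<in> I" for i N
  proof (rule ccontr)
    define O' where "O' = - closure (D (i, N))"
    assume "closure (D (i, N)) \<noteq> UNIV"
    then have O': "open O'" "O' \<noteq> {}" by (auto simp: O'_def)
    have disj: "O' \<inter> D (i, N) = {}" using closure_subset by (auto simp: O'_def)
    have "\<not> O' \<subseteq> {x. \<forall>\<zeta>\<in>N \<inter> Z. \<gamma> x \<zeta> \<notin> B i}"
    proof
      assume "O' \<subseteq> {x. \<forall>\<zeta>\<in>N \<inter> Z. \<gamma> x \<zeta> \<notin> B i}"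
      then have "O' \<subseteq> interior {x. \<forall>\<zeta>\<in>N \<inter> Z. \<gamma> x \<zeta> \<notin> B i}" using O'(1) by (rule interior_maximal)
      then show False using disj O'(2) by (auto simp: D_def)
    qed
    then obtain x \<zeta> where x: "x \<in> O'" "\<zeta> \<in> N \<inter> Z" "\<gamma> x \<zeta> \<in> B i" by blast
    have a0: "a \<zeta> \<noteq> 0" using x a by auto
    let ?inv = "\<lambda>z. inverse (a \<zeta>) *s (z - b \<zeta>)"
    have "open (?inv -` O')" by (intro open_vimage O') (intro continuous_intros)
    moreover have "?inv (\<gamma> x \<zeta>) = x" using a0 by (simp add: \<gamma>_def vec_eq_iff field_simps)
    then have "\<gamma> x \<zeta> \<in> ?inv -` O'" using x by simp
    moreover have "\<gamma> x \<zeta> \<in> closure {z \<in> B i. h i z \<noteq> 0}" using B(3)[OF i] x by blast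
    ultimately obtain z where z: "z \<in> B i" "h i z \<noteq> 0" "?inv z \<in> O'"
      unfolding closure_iff_nhds_not_empty by blast
    have "\<gamma> (?inv z) \<zeta> = z" using a0 by (simp add: \<gamma>_def vec_eq_iff field_simps)
    then have "\<exists>\<zeta>'\<in>N \<inter> Z. \<gamma> (?inv z) \<zeta>' \<in> B i \<and> h i (\<gamma> (?inv z) \<zeta>') \<noteq> 0"
      using z x by metis
    then have "?inv z \<in> D (i, N)" unfolding D_def by blast
    with z disj show False by blast
  qed
  define \<T> where "\<T> = D ` (I \<times> \<B>) \<union> (\<lambda>T. T \<union> - closure \<Lambda>) ` \<G>"
  have "UNIV \<subseteq> closure (\<Inter>\<T>)"
  proof (rule Baire)
    show "countable \<T>" unfolding \<T>_def using I \<B> G by auto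
    fix T assume T: "T \<in> \<T>"
    have "open T" using T G openD by (auto simp: \<T>_def)
    moreover have "closure T = UNIV"
    proof -
      have "closure (T \<union> - closure \<Lambda>) = UNIV" if "T \<in> \<G>" for T
      proof -
        have "closure \<Lambda> \<subseteq> closure T" using G(3)[OF that] closure_minimal by blast
        then show ?thesis using closure_subset[of "- closure \<Lambda>"] by (auto simp: closure_Un)
      qed
      then show ?thesis using T denseD by (auto simp: \<T>_def)
    qed
    ultimately show "openin (top_of_set UNIV) T \<and> UNIV \<subseteq> closure T" by simp
  qed simp
  then obtain x where x: "x \<in> \<Lambda>" "x \<in> \<Inter>\<T>"
    using \<Lambda> open_Int_closure_eq_empty[of \<Lambda> "\<Inter>\<T>"] by blast
  have "x \<in> T" if "T \<in> \<G>" for T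
  proof -
    have "x \<in> T \<union> - closure \<Lambda>" using x(2) that unfolding \<T>_def by blast
    then show ?thesis using x(1) closure_subset[of \<Lambda>] by blast
  qed
  moreover have "\<exists>\<zeta>'\<in>Z. dist \<zeta>' \<zeta> < e \<and> \<gamma> x \<zeta>' \<in> B i \<and> h i (\<gamma> x \<zeta>') \<noteq> 0"
    if i: "i \<in> I" and \<zeta>: "\<zeta> \<in> Z" "\<gamma> x \<zeta> \<in> B i" and e: "e > 0" for i \<zeta> e
  proof -
    obtain N where N: "N \<in> \<B>" "\<zeta> \<in> N" "N \<subseteq> ball \<zeta> e"
      using topological_basisE[OF \<B>(2) open_ball, of \<zeta> \<zeta> e] e by auto
    have "x \<in> D (i, N)" using x(2) i N by (auto simp: \<T>_def)
    moreover have "x \<notin> interior {x. \<forall>\<zeta>\<in>N \<inter> Z. \<gamma> x \<zeta> \<notin> B i}"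
      using interior_subset N \<zeta> by blast
    ultimately obtain \<zeta>' where "\<zeta>' \<in> N \<inter> Z" "\<gamma> x \<zeta>' \<in> B i" "h i (\<gamma> x \<zeta>') \<noteq> 0"
      unfolding D_def by auto
    moreover from this have "dist \<zeta>' \<zeta> < e" using N by (auto simp: dist_commute)
    ultimately show ?thesis by blast
  qed
  ultimately show ?thesis using x(1) unfolding \<gamma>_def by blast
qed

section \<open>Elimination\<close>

text \<open>Gaussian elimination without division over the integral domain of holomorphic functions on \<open>S\<close>.  Either the
infinitely many vectors \<open>x j\<close> of length \<open>k\<close> satisfy a common linear equation with holomorphic
coefficients \<open>q\<close>, or the elimination produces a minor \<open>D\<close>; where \<open>D \<noteq> 0\<close>, the vectors span the whole space
and no nonzero \<open>p\<close> annihilates them.\<close>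

lemma line_holo_elimination:
  fixes x :: "'j \<Rightarrow> nat \<Rightarrow> complex^'n \<Rightarrow> complex"
  assumes S: "open S" "convex S" "S \<noteq> {}"
    and "\<forall>j. \<forall>i<k. line_holo (x j i) S"
  shows "(\<exists>q. (\<forall>i<k. line_holo (q i) S) \<and> (\<exists>i<k. \<exists>w\<in>S. q i w \<noteq> 0) \<and>
            (\<forall>j. \<forall>w\<in>S. (\<Sum>i<k. q i w * x j i w) = 0)) \<or>
         (\<exists>D. line_holo D S \<and> (\<exists>w\<in>S. D w \<noteq> 0) \<and>
            (\<forall>w\<in>S. D w \<noteq> 0 \<longrightarrow> (\<forall>p. (\<forall>j. (\<Sum>i<k. p i * x j i w) = 0) \<longrightarrow> (\<forall>i<k. p i = 0))))"
  using assms(4)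
proof (induction k arbitrary: x)
  case 0
  then show ?case using S by (intro disjI2 exI[of _ "\<lambda>_. 1"]) auto
next
  case (Suc k)
  show ?case
  proof (cases "\<forall>j. \<forall>w\<in>S. x j 0 w = 0")
    case True
    then show ?thesis
      using S by (intro disjI1 exI[of _ "\<lambda>i w. if i = 0 then 1 else 0"])
                 (auto simp: sum.lessThan_Suc_shift simp del: sum.lessThan_Suc)
  next
    case False
    then obtain a wa where a: "wa \<in> S" "x a 0 wa \<noteq> 0" by blast
    define y where "y = (\<lambda>j i w. x a 0 w * x j (Suc i) w - x j 0 w * x a (Suc i) w)"
    note hol = Suc.prems[rule_format]
    have "\<forall>j. \<forall>i<k. line_holo (y j i) S"
      unfolding y_def by (intro allI impI line_holo_diff line_holo_mult hol) auto
    from Suc.IH[OF this] show ?thesis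
    proof (elim disjE, goal_cases)
      case 1
      then obtain q where q: "\<forall>i<k. line_holo (q i) S" "\<exists>i<k. \<exists>w\<in>S. q i w \<noteq> 0"
        "\<forall>j. \<forall>w\<in>S. (\<Sum>i<k. q i w * y j i w) = 0"
        by (elim exE conjE) blast
      define q' where "q' = (\<lambda>i w. case i of 0 \<Rightarrow> - (\<Sum>i<k. q i w * x a (Suc i) w) | Suc i \<Rightarrow> x a 0 w * q i w)"
      have "line_holo (q' i) S" if "i < Suc k" for i
      proof (cases i)
        case 0
        have "line_holo (\<lambda>w. 0 - (\<Sum>i<k. q i w * x a (Suc i) w)) S"
          by (intro line_holo_diff line_holo_const line_holo_sum line_holo_mult hol) (use q in auto)
        then show ?thesis using 0 by (simp add: q'_def)
      next
        case (Suc i')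
        then show ?thesis using that q hol by (auto simp: q'_def intro!: line_holo_mult)
      qed
      moreover obtain i w where iw: "i < k" "w \<in> S" "q i w \<noteq> 0" using q(2) by blast
      have "\<exists>w\<in>S. x a 0 w * q i w \<noteq> 0"
        by (rule line_holo_mult_nonzero[of "x a 0" S "q i", OF _ _ S(1,2) a iw(2,3)]) (use hol q iw in auto)
      then have "\<exists>i<Suc k. \<exists>w\<in>S. q' i w \<noteq> 0"
        using iw by (intro exI[of _ "Suc i"]) (auto simp: q'_def)
      moreover have "(\<Sum>i<Suc k. q' i w * x j i w) = 0" if "w \<in> S" for j w
      proof -
        have "(\<Sum>i<Suc k. q' i w * x j i w) = (\<Sum>i<k. q i w * y j i w)"
          unfolding sum.lessThan_Suc_shift
          by (simp add: q'_def y_def algebra_simps sum_subtractf sum_distrib_left)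
        then show ?thesis using q(3) that by simp
      qed
      ultimately show ?thesis by (intro disjI1 exI[of _ q']) blast
    next
      case 2
      then obtain D where D: "line_holo D S" "\<exists>w\<in>S. D w \<noteq> 0"
        "\<forall>w\<in>S. D w \<noteq> 0 \<longrightarrow> (\<forall>p. (\<forall>j. (\<Sum>i<k. p i * y j i w) = 0) \<longrightarrow> (\<forall>i<k. p i = 0))"
        by (elim exE conjE)
      have "line_holo (\<lambda>w. x a 0 w * D w) S"
        by (intro line_holo_mult hol D) auto
      moreover obtain w where "w \<in> S" "D w \<noteq> 0" using D by blast
      then have "\<exists>w\<in>S. x a 0 w * D w \<noteq> 0"
        by (intro line_holo_mult_nonzero[of "x a 0" S D, OF _ D(1) S(1,2) a]) (use hol in auto)
      moreover have "p i = 0"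
        if w: "w \<in> S" "x a 0 w * D w \<noteq> 0" and p: "\<forall>j. (\<Sum>i<Suc k. p i * x j i w) = 0" and i: "i < Suc k" for w p i
      proof -
        have eq: "p 0 * x j 0 w = - (\<Sum>i<k. p (Suc i) * x j (Suc i) w)" for j
          using p[rule_format, of j] unfolding sum.lessThan_Suc_shift by (simp add: eq_neg_iff_add_eq_0)
        have "(\<Sum>i<k. p (Suc i) * y j i w) = 0" for j
        proof -
          have "(\<Sum>i<k. p (Suc i) * y j i w) =
              x a 0 w * (\<Sum>i<k. p (Suc i) * x j (Suc i) w) - x j 0 w * (\<Sum>i<k. p (Suc i) * x a (Suc i) w)"
            by (simp add: y_def algebra_simps sum_subtractf sum_distrib_left)
          also have "\<dots> = - x a 0 w * (p 0 * x j 0 w) + x j 0 w * (p 0 * x a 0 w)"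
            by (simp add: eq)
          finally show ?thesis by simp
        qed
        then have S0: "\<forall>i<k. p (Suc i) = 0" using D(3) w by (metis mult_zero_right)
        then have "p 0 * x a 0 w = 0" using eq[of a] by simp
        then have "p 0 = 0" using w by simp
        then show ?thesis using S0 i by (cases i) auto
      qed
      ultimately show ?thesis by (intro disjI2 exI[of _ "\<lambda>w. x a 0 w * D w"]) blast
    qed
  qed
qed

section \<open>One-variable denominators\<close>

text \<open>Restricted to a line on which it is not locally zero, the denominator \<open>h\<close> is a power of \<open>\<zeta> - \<zeta>0\<close> times a unit.\<close>

lemma slice_denominator:
  fixes F g h :: "complex^'n \<Rightarrow> complex"
  assumes B: "open B" and g: "line_holo g B" and h: "line_holo h B"
    and p: "b + \<zeta>0 *s v \<in> B" and R: "{z \<in> B. h z \<noteq> 0} \<subseteq> R" "\<And>z. z \<in> R \<inter> B \<Longrightarrow> F z * h z = g z"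
    and nondeg: "\<And>e. e > 0 \<Longrightarrow> \<exists>\<zeta>. dist \<zeta> \<zeta>0 < e \<and> b + \<zeta> *s v \<in> B \<and> h (b + \<zeta> *s v) \<noteq> 0"
  shows "\<exists>d>0. \<exists>n \<psi>. \<psi> holomorphic_on ball \<zeta>0 d \<and> (\<forall>\<zeta>\<in>ball \<zeta>0 d - {\<zeta>0}. b + \<zeta> *s v \<in> R) \<and>
      (\<forall>\<zeta>\<in>ball \<zeta>0 d. b + \<zeta> *s v \<in> R \<longrightarrow> F (b + \<zeta> *s v) * (\<zeta> - \<zeta>0) ^ n = \<psi> \<zeta>)"
proof -
  obtain e where e: "e > 0" "ball \<zeta>0 e \<subseteq> {\<zeta>. b + \<zeta> *s v \<in> B}"
    using open_line_preimage[OF B] p open_contains_ball by blast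
  let ?k = "\<lambda>\<zeta>. h (b + \<zeta> *s v)" and ?g = "\<lambda>\<zeta>. g (b + \<zeta> *s v)"
  have k: "?k holomorphic_on ball \<zeta>0 e" by (rule line_holo_line[OF h]) (use e in auto)
  obtain n r u where r: "0 < r" "ball \<zeta>0 r \<subseteq> ball \<zeta>0 e" and u: "u holomorphic_on ball \<zeta>0 r"
    "\<And>w. w \<in> ball \<zeta>0 r \<Longrightarrow> ?k w = (w - \<zeta>0) ^ n * u w" "\<And>w. w \<in> ball \<zeta>0 r \<Longrightarrow> u w \<noteq> 0"
  proof (cases "?k \<zeta>0 = 0")
    case True
    obtain \<zeta> where "dist \<zeta> \<zeta>0 < e" "?k \<zeta> \<noteq> 0" using nondeg[OF e(1)] by blast
    then have "\<not> ?k constant_on ball \<zeta>0 e"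
      using True e(1) unfolding constant_on_def by (metis centre_in_ball dist_commute mem_ball)
    then show thesis
      using holomorphic_factor_zero_nonconstant[OF k open_ball connected_ball _ True] e(1) that
      by (metis centre_in_ball)
  next
    case False
    have "open {\<zeta> \<in> ball \<zeta>0 e. ?k \<zeta> \<noteq> 0}"
    proof -
      have "open (ball \<zeta>0 e \<inter> ?k -` (- {0}))"
        by (rule continuous_open_preimage[OF holomorphic_on_imp_continuous_on[OF k] open_ball]) auto
      then show ?thesis by (simp add: vimage_def Int_def)
    qed
    moreover have "\<zeta>0 \<in> {\<zeta> \<in> ball \<zeta>0 e. ?k \<zeta> \<noteq> 0}" using False e(1) by simp
    ultimately obtain r where "r > 0" "ball \<zeta>0 r \<subseteq> {\<zeta> \<in> ball \<zeta>0 e. ?k \<zeta> \<noteq> 0}"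
      using open_contains_ball by blast
    then have r: "r > 0" "ball \<zeta>0 r \<subseteq> ball \<zeta>0 e" "\<And>w. w \<in> ball \<zeta>0 r \<Longrightarrow> ?k w \<noteq> 0" by auto
    show thesis
      by (rule that[of r ?k 0]) (use r holomorphic_on_subset[OF k r(2)] in auto)
  qed
  have "(\<lambda>\<zeta>. ?g \<zeta> / u \<zeta>) holomorphic_on ball \<zeta>0 r"
    by (intro holomorphic_on_divide u line_holo_line[OF g]) (use e r u in auto)
  moreover have "b + \<zeta> *s v \<in> R" if "\<zeta> \<in> ball \<zeta>0 r - {\<zeta>0}" for \<zeta>
  proof -
    have "h (b + \<zeta> *s v) \<noteq> 0" "b + \<zeta> *s v \<in> B" using that u(2,3)[of \<zeta>] r e by auto
    then show ?thesis using R(1) by blast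
  qed
  moreover have "F (b + \<zeta> *s v) * (\<zeta> - \<zeta>0) ^ n = ?g \<zeta> / u \<zeta>"
    if "\<zeta> \<in> ball \<zeta>0 r" "b + \<zeta> *s v \<in> R" for \<zeta>
  proof -
    have "F (b + \<zeta> *s v) * ?k \<zeta> = ?g \<zeta>" using R(2) that r e by blast
    then show ?thesis using u(2,3)[OF that(1)] by (simp add: field_simps)
  qed
  ultimately show ?thesis using r(1) by blast
qed

text \<open>A function with finitely many poles in the closed disc becomes holomorphic after multiplication by a
polynomial that has its zeros at the poles.  The set \<open>W\<close> is the domain of \<open>\<phi>\<close>, its complement contains the poles.\<close>

lemma disc_denominator:
  fixes \<phi> :: "complex \<Rightarrow> complex"
  assumes \<phi>: "\<phi> holomorphic_on W"
    and loc: "\<And>\<zeta>0. \<zeta>0 \<in> cball 0 1 \<Longrightarrow> \<exists>d>0. \<exists>n \<psi>. \<psi> holomorphic_on ball \<zeta>0 d \<and>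
      (\<forall>\<zeta>\<in>ball \<zeta>0 d - {\<zeta>0}. \<zeta> \<in> W) \<and> (\<forall>\<zeta>\<in>ball \<zeta>0 d. \<zeta> \<in> W \<longrightarrow> \<phi> \<zeta> * (\<zeta> - \<zeta>0) ^ n = \<psi> \<zeta>)"
  shows "\<exists>P \<Psi>. (\<forall>\<zeta>\<in>W. poly P \<zeta> \<noteq> 0) \<and> P \<noteq> 0 \<and> \<Psi> holomorphic_on cball 0 1 \<and>
      (\<forall>\<zeta>\<in>cball 0 1 \<inter> W. \<Psi> \<zeta> = \<phi> \<zeta> * poly P \<zeta>)"
proof -
  have "\<forall>c\<in>cball 0 1. \<exists>d n \<psi>. d > 0 \<and> \<psi> holomorphic_on ball c d \<and>
      (\<forall>\<zeta>\<in>ball c d - {c}. \<zeta> \<in> W) \<and> (\<forall>\<zeta>\<in>ball c d. \<zeta> \<in> W \<longrightarrow> \<phi> \<zeta> * (\<zeta> - c) ^ n = \<psi> \<zeta>)"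
    using loc by blast
  then obtain d n \<psi> where *: "\<forall>c\<in>cball 0 1. d c > 0 \<and> \<psi> c holomorphic_on ball c (d c) \<and>
      (\<forall>\<zeta>\<in>ball c (d c) - {c}. \<zeta> \<in> W) \<and> (\<forall>\<zeta>\<in>ball c (d c). \<zeta> \<in> W \<longrightarrow> \<phi> \<zeta> * (\<zeta> - c) ^ n c = \<psi> c \<zeta>)"
    unfolding bchoice_iff by blast
  then have d: "\<And>c. c \<in> cball 0 1 \<Longrightarrow> d c > 0"
      and \<psi>: "\<And>c. c \<in> cball 0 1 \<Longrightarrow> \<psi> c holomorphic_on ball c (d c)"
      and W: "\<And>c \<zeta>. c \<in> cball 0 1 \<Longrightarrow> \<zeta> \<in> ball c (d c) \<Longrightarrow> \<zeta> \<noteq> c \<Longrightarrow> \<zeta> \<in> W"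
      and eq: "\<And>c \<zeta>. c \<in> cball 0 1 \<Longrightarrow> \<zeta> \<in> ball c (d c) \<Longrightarrow> \<zeta> \<in> W \<Longrightarrow> \<phi> \<zeta> * (\<zeta> - c) ^ n c = \<psi> c \<zeta>"
    by blast+
  obtain C where C: "C \<subseteq> cball 0 1" "finite C" "cball 0 1 \<subseteq> (\<Union>c\<in>C. ball c (d c))"
  proof (rule compactE_image[OF compact_cball, of "cball 0 1" "\<lambda>c. ball c (d c)" 0 1])
    show "cball 0 1 \<subseteq> (\<Union>c\<in>cball 0 1. ball c (d c))"
      using d centre_in_ball by blast
  qed auto
  (* one factor more than the pole order: the product then vanishes at the centres outside W,
     where \<phi> itself has no meaning *)
  define P where "P = (\<Prod>c\<in>C - W. [:- c, 1:] ^ Suc (n c))"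
  define \<Psi> where "\<Psi> = (\<lambda>\<zeta>. if \<zeta> \<in> W then \<phi> \<zeta> * poly P \<zeta> else 0)"
  have "\<Psi> holomorphic_on ball c (d c)" if c: "c \<in> C" for c
  proof (cases "c \<in> W")
    case True
    have c1: "c \<in> cball 0 1" using c C by auto
    have sub: "ball c (d c) \<subseteq> W" using W[OF c1] True by blast
    then have "(\<lambda>\<zeta>. \<phi> \<zeta> * poly P \<zeta>) holomorphic_on ball c (d c)"
      by (intro holomorphic_intros holomorphic_on_subset[OF \<phi>])
    then show ?thesis
      by (rule holomorphic_transform) (use sub in \<open>auto simp: \<Psi>_def\<close>)
  next
    case False
    define Q where "Q = (\<Prod>c\<in>C - W - {c}. [:- c, 1:] ^ Suc (n c))"
    let ?f = "\<lambda>\<zeta>. \<psi> c \<zeta> * (\<zeta> - c) * poly Q \<zeta>"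
    have c1: "c \<in> cball 0 1" using c C by auto
    have "?f holomorphic_on ball c (d c)"
      by (intro holomorphic_intros \<psi>[OF c1])
    moreover have "?f \<zeta> = \<Psi> \<zeta>" if \<zeta>: "\<zeta> \<in> ball c (d c)" for \<zeta>
    proof (cases "\<zeta> \<in> W")
      case True
      have "poly P \<zeta> = (\<zeta> - c) ^ Suc (n c) * poly Q \<zeta>"
        unfolding P_def Q_def using C(2) c False
        by (subst prod.remove[of _ c]) (auto simp add: poly_power simp del: power_Suc)
      then show ?thesis
        using True by (simp add: \<Psi>_def flip: eq[OF c1 \<zeta> True])
    next
      case False
      then have "\<zeta> = c" using W[OF c1 \<zeta>] by blast
      then show ?thesis using False by (simp add: \<Psi>_def)
    qed
    ultimately show ?thesis using holomorphic_transform by blast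
  qed
  then have "\<Psi> holomorphic_on (\<Union>c\<in>C. ball c (d c))"
    by (intro holomorphic_on_UN_open) auto
  then have "\<Psi> holomorphic_on cball 0 1" using C(3) holomorphic_on_subset by blast
  moreover have "P \<noteq> 0" using C(2) by (auto simp: P_def simp del: power_Suc)
  moreover have "poly P \<zeta> \<noteq> 0" if "\<zeta> \<in> W" for \<zeta>
    using C(2) that by (auto simp: P_def poly_prod poly_power simp del: power_Suc)
  ultimately show ?thesis by (intro exI[of _ P] exI[of _ \<Psi>]) (auto simp: \<Psi>_def)
qed

lemma circle_integral_poly:
  assumes "continuous_on (sphere 0 1) \<phi>"
  shows "contour_integral (circlepath 0 1) (\<lambda>\<zeta>. \<phi> \<zeta> * poly Q \<zeta>) =
      (\<Sum>i\<le>degree Q. coeff Q i * contour_integral (circlepath 0 1) (\<lambda>\<zeta>. \<phi> \<zeta> * \<zeta> ^ i))"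
proof -
  have int: "(\<lambda>\<zeta>. \<phi> \<zeta> * \<zeta> ^ i) contour_integrable_on circlepath 0 1" for i
    by (intro contour_integrable_continuous_circlepath continuous_intros) (use assms in simp)
  have "contour_integral (circlepath 0 1) (\<lambda>\<zeta>. \<phi> \<zeta> * poly Q \<zeta>) =
      contour_integral (circlepath 0 1) (\<lambda>\<zeta>. \<Sum>i\<le>degree Q. coeff Q i * (\<phi> \<zeta> * \<zeta> ^ i))"
    by (simp add: poly_altdef sum_distrib_left mult_ac)
  also have "\<dots> = (\<Sum>i\<le>degree Q. contour_integral (circlepath 0 1) (\<lambda>\<zeta>. coeff Q i * (\<phi> \<zeta> * \<zeta> ^ i)))"
    by (intro contour_integral_sum contour_integrable_lmul int) auto
  also have "\<dots> = (\<Sum>i\<le>degree Q. coeff Q i * contour_integral (circlepath 0 1) (\<lambda>\<zeta>. \<phi> \<zeta> * \<zeta> ^ i))"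
    by (simp add: contour_integral_lmul int)
  finally show ?thesis .
qed

text \<open>The sum is the integral of the holomorphic function \<open>\<Psi>(\<zeta>) \<zeta>\<^sup>j\<close>, which vanishes by Cauchy's theorem.\<close>

lemma moment_recurrence:
  assumes \<phi>: "continuous_on (sphere 0 1) \<phi>" "sphere 0 1 \<subseteq> W"
    and \<Psi>: "\<Psi> holomorphic_on cball 0 1" "\<And>\<zeta>. \<zeta> \<in> cball 0 1 \<inter> W \<Longrightarrow> \<Psi> \<zeta> = \<phi> \<zeta> * poly P \<zeta>"
  shows "(\<Sum>i\<le>degree P. coeff P i * contour_integral (circlepath 0 1) (\<lambda>\<zeta>. \<phi> \<zeta> * \<zeta> ^ (i + j))) = 0"
proof -
  have "(\<Sum>i\<le>degree P. coeff P i * contour_integral (circlepath 0 1) (\<lambda>\<zeta>. \<phi> \<zeta> * \<zeta> ^ (i + j))) =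
      contour_integral (circlepath 0 1) (\<lambda>\<zeta>. (\<phi> \<zeta> * \<zeta> ^ j) * poly P \<zeta>)"
    by (subst circle_integral_poly) (auto intro!: continuous_intros \<phi> simp: power_add mult_ac)
  also have "\<dots> = contour_integral (circlepath 0 1) (\<lambda>\<zeta>. (\<Psi> \<zeta> * \<zeta> ^ j * \<zeta>) / (\<zeta> - 0))"
  proof (rule contour_integral_eq)
    fix \<zeta> assume "\<zeta> \<in> path_image (circlepath 0 1)"
    then have "\<zeta> \<in> cball 0 1 \<inter> W" "\<zeta> \<noteq> 0" using \<phi>(2) by auto
    then show "(\<phi> \<zeta> * \<zeta> ^ j) * poly P \<zeta> = (\<Psi> \<zeta> * \<zeta> ^ j * \<zeta>) / (\<zeta> - 0)"
      by (simp add: \<Psi>(2))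
  qed
  also have "\<dots> = 2 * of_real pi * \<i> * (\<Psi> 0 * 0 ^ j * 0)"
    by (intro contour_integral_unique Cauchy_integral_circlepath)
       (auto intro!: continuous_intros holomorphic_intros holomorphic_on_imp_continuous_on[OF \<Psi>(1)]
          holomorphic_on_subset[OF \<Psi>(1)])
  finally show ?thesis by simp
qed

text \<open>The polynomial \<open>P\<close> belongs to a single function \<open>\<phi>\<close>, whereas \<open>Q\<close> will be chosen for a whole family.
The vanishing of the moments alone shows that \<open>Q\<close> is also a denominator: write
\<open>P(\<zeta>) = P(z) + (\<zeta> - z) T(\<zeta>)\<close>.  In \<open>\<integral> \<phi> Q P / (\<zeta> - z)\<close> the polynomial \<open>T\<close> contributes nothing, and \<open>P(z)\<close> can be
cancelled against Cauchy's formula for \<open>\<phi> P Q\<close>.\<close>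

lemma cauchy_formula_from_moments:
  assumes \<phi>: "continuous_on (sphere 0 1) \<phi>" "sphere 0 1 \<subseteq> W"
    and \<Psi>: "\<Psi> holomorphic_on cball 0 1" "\<And>\<zeta>. \<zeta> \<in> cball 0 1 \<inter> W \<Longrightarrow> \<Psi> \<zeta> = \<phi> \<zeta> * poly P \<zeta>"
    and Q: "\<And>j. contour_integral (circlepath 0 1) (\<lambda>\<zeta>. \<phi> \<zeta> * poly Q \<zeta> * \<zeta> ^ j) = 0"
    and z: "norm z < 1" "z \<in> W" "poly P z \<noteq> 0"
  shows "contour_integral (circlepath 0 1) (\<lambda>\<zeta>. \<phi> \<zeta> * poly Q \<zeta> / (\<zeta> - z)) =
      2 * of_real pi * \<i> * (\<phi> z * poly Q z)"
proof -
  let ?I = "contour_integral (circlepath 0 1)"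
  have "poly (P - [:poly P z:]) z = 0" by simp
  then obtain T where T: "P - [:poly P z:] = [:- z, 1:] * T"
    unfolding poly_eq_0_iff_dvd by (rule dvdE)
  have P_eq: "poly P \<zeta> = poly P z + (\<zeta> - z) * poly T \<zeta>" for \<zeta>
    using arg_cong[OF T, of "\<lambda>p. poly p \<zeta>"] by (simp add: algebra_simps)
  have "?I (\<lambda>\<zeta>. (\<phi> \<zeta> * poly Q \<zeta>) * poly T \<zeta>) = 0"
    by (subst circle_integral_poly) (auto intro!: continuous_intros \<phi> simp: Q)
  moreover have "(\<lambda>\<zeta>. (\<phi> \<zeta> * poly Q \<zeta>) * poly T \<zeta>) contour_integrable_on circlepath 0 1"
    by (intro contour_integrable_continuous_circlepath continuous_intros) (use \<phi> in simp)
  ultimately have T0: "((\<lambda>\<zeta>. (\<phi> \<zeta> * poly Q \<zeta>) * poly T \<zeta>) has_contour_integral 0) (circlepath 0 1)"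
    using has_contour_integral_integral by metis
  have "(\<lambda>\<zeta>. \<phi> \<zeta> * poly Q \<zeta> / (\<zeta> - z)) contour_integrable_on circlepath 0 1"
    by (intro contour_integrable_continuous_circlepath continuous_intros) (use \<phi> z in auto)
  then have "((\<lambda>\<zeta>. poly P z * (\<phi> \<zeta> * poly Q \<zeta> / (\<zeta> - z)) + (\<phi> \<zeta> * poly Q \<zeta>) * poly T \<zeta>) has_contour_integral
      poly P z * ?I (\<lambda>\<zeta>. \<phi> \<zeta> * poly Q \<zeta> / (\<zeta> - z)) + 0) (circlepath 0 1)"
    by (intro has_contour_integral_add has_contour_integral_lmul T0 has_contour_integral_integral)
  moreover have "((\<lambda>\<zeta>. \<Psi> \<zeta> * poly Q \<zeta> / (\<zeta> - z)) has_contour_integral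
      (2 * of_real pi * \<i> * (\<Psi> z * poly Q z))) (circlepath 0 1)"
    by (intro Cauchy_integral_circlepath)
       (use z in \<open>auto intro!: continuous_intros holomorphic_intros holomorphic_on_imp_continuous_on[OF \<Psi>(1)]
          holomorphic_on_subset[OF \<Psi>(1)]\<close>)
  then have "((\<lambda>\<zeta>. poly P z * (\<phi> \<zeta> * poly Q \<zeta> / (\<zeta> - z)) + (\<phi> \<zeta> * poly Q \<zeta>) * poly T \<zeta>) has_contour_integral
      (2 * of_real pi * \<i> * (\<Psi> z * poly Q z))) (circlepath 0 1)"
  proof (rule has_contour_integral_eq)
    fix \<zeta> assume "\<zeta> \<in> path_image (circlepath 0 1)"
    then have \<zeta>: "\<zeta> \<in> cball 0 1 \<inter> W" "\<zeta> \<noteq> z" using \<phi>(2) z by auto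
    have "\<Psi> \<zeta> = \<phi> \<zeta> * poly P z + \<phi> \<zeta> * (\<zeta> - z) * poly T \<zeta>"
      unfolding \<Psi>(2)[OF \<zeta>(1)] P_eq[of \<zeta>] by (simp add: algebra_simps)
    then show "\<Psi> \<zeta> * poly Q \<zeta> / (\<zeta> - z) =
        poly P z * (\<phi> \<zeta> * poly Q \<zeta> / (\<zeta> - z)) + (\<phi> \<zeta> * poly Q \<zeta>) * poly T \<zeta>"
      using \<zeta>(2) by (simp add: divide_simps) (simp add: algebra_simps)
  qed
  ultimately have "poly P z * ?I (\<lambda>\<zeta>. \<phi> \<zeta> * poly Q \<zeta> / (\<zeta> - z)) + 0 = 2 * of_real pi * \<i> * (\<Psi> z * poly Q z)"
    by (rule has_contour_integral_unique)
  also have "\<dots> = poly P z * (2 * of_real pi * \<i> * (\<phi> z * poly Q z))"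
    using z \<Psi>(2)[of z] by simp
  finally show ?thesis using z(3) by simp
qed

section \<open>Meromorphic functions extend across the origin\<close>

text \<open>Here \<open>R\<close> is so large that \<open>F\<close> is defined wherever one of the local denominators does not vanish; so \<open>F\<close> is
undefined only on a thin set.\<close>

definition meromorphic_off_0 :: "(complex^'n \<Rightarrow> complex) \<Rightarrow> (complex^'n) set \<Rightarrow> bool" where
  "meromorphic_off_0 F R \<longleftrightarrow> open R \<and> line_holo F R \<and>
     (\<forall>p. p \<noteq> 0 \<longrightarrow> (\<exists>e>0. \<exists>g h. line_holo g (ball p e) \<and> line_holo h (ball p e) \<and>
        ball p e \<subseteq> closure {z \<in> ball p e. h z \<noteq> 0} \<and> {z \<in> ball p e. h z \<noteq> 0} \<subseteq> R \<and>
        (\<forall>z\<in>R \<inter> ball p e. F z * h z = g z)))"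

lemma line_complement_dense:
  fixes v :: "complex^'n"
  assumes "CARD('n) \<ge> 2"
  shows "closure (- ((\<lambda>\<zeta>. - (\<zeta> *s v)) ` T)) = UNIV"
proof (rule ccontr)
  assume "\<not> ?thesis"
  then obtain x where "x \<notin> closure (- ((\<lambda>\<zeta>. - (\<zeta> *s v)) ` T))" by blast
  moreover have "open (- closure (- ((\<lambda>\<zeta>. - (\<zeta> *s v)) ` T)))" by auto
  ultimately obtain d where d: "d > 0" "ball x d \<subseteq> - closure (- ((\<lambda>\<zeta>. - (\<zeta> *s v)) ` T))"
    using open_contains_ball by (metis ComplI)
  then have sub: "ball x d \<subseteq> (\<lambda>\<zeta>. - (\<zeta> *s v)) ` T"
    using closure_subset[of "- ((\<lambda>\<zeta>. - (\<zeta> *s v)) ` T)"] by blast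
  have step: "x + of_real (d / 2) *s axis j 1 \<in> ball x d" for j
  proof -
    have "axis j (1::complex) \<in> Basis" by (simp add: axis_in_Basis_iff)
    then have "norm (of_real (d / 2) *s axis j 1 :: complex^'n) = d / 2"
      using d by (simp add: norm_vsmult norm_divide)
    then show ?thesis using d by (simp add: dist_norm)
  qed
  obtain s where s: "x = - (s *s v)" using sub centre_in_ball[of x d] d(1) by blast
  have step': "\<exists>t. of_real (d / 2) *s axis j 1 = t *s v" for j
  proof -
    obtain t where "x + of_real (d / 2) *s axis j 1 = - (t *s v)" using sub step[of j] by blast
    then have "of_real (d / 2) *s axis j 1 = (s - t) *s v"
      using s by (simp add: algebra_simps)
    then show ?thesis by blast
  qed
  obtain i j :: 'n where ij: "i \<noteq> j"
    using assms by (metis One_nat_def Suc_1 card_2_iff' card_le_Suc0_iff_eq finite_class.finite_UNIV not_less_eq_eq UNIV_I)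
  obtain t1 where t1: "of_real (d / 2) *s axis i 1 = t1 *s v" using step' by blast
  obtain t2 where t2: "of_real (d / 2) *s axis j 1 = t2 *s v" using step' by blast
  have "t1 * v $ i = of_real (d / 2)" "t1 * v $ j = 0" "t2 * v $ j = of_real (d / 2)"
    using arg_cong[OF t1, of "\<lambda>z. z $ i"] arg_cong[OF t1, of "\<lambda>z. z $ j"] arg_cong[OF t2, of "\<lambda>z. z $ j"] ij
    by (auto simp: axis_def)
  then show False using d(1) by auto
qed

lemma countable_local_quotients:
  fixes F :: "complex^'n \<Rightarrow> complex"
  assumes "meromorphic_off_0 F R"
  shows "\<exists>(I :: (complex^'n) set) B g h. countable I \<and> (\<Union>p\<in>I. B p) \<supseteq> - {0} \<and>
    (\<forall>p\<in>I. open (B p) \<and> line_holo (g p) (B p) \<and> line_holo (h p) (B p) \<and>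
      B p \<subseteq> closure {z \<in> B p. h p z \<noteq> 0} \<and> {z \<in> B p. h p z \<noteq> 0} \<subseteq> R \<and>
      (\<forall>z\<in>R \<inter> B p. F z * h p z = g p z))"
proof -
  have "\<forall>p\<in>-{0}. \<exists>e g h. e > 0 \<and> line_holo g (ball p e) \<and> line_holo h (ball p e) \<and>
        ball p e \<subseteq> closure {z \<in> ball p e. h z \<noteq> 0} \<and> {z \<in> ball p e. h z \<noteq> 0} \<subseteq> R \<and>
        (\<forall>z\<in>R \<inter> ball p e. F z * h z = g z)"
    using assms unfolding meromorphic_off_0_def by blast
  then obtain e g h where *: "\<forall>p\<in>-{0}. e p > 0 \<and> line_holo (g p) (ball p (e p)) \<and> line_holo (h p) (ball p (e p)) \<and>
        ball p (e p) \<subseteq> closure {z \<in> ball p (e p). h p z \<noteq> 0} \<and> {z \<in> ball p (e p). h p z \<noteq> 0} \<subseteq> R \<and>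
        (\<forall>z\<in>R \<inter> ball p (e p). F z * h p z = g p z)"
    unfolding bchoice_iff by blast
  let ?B = "\<lambda>p. ball p (e p)"
  have "\<And>S. S \<in> ?B ` (- {0}) \<Longrightarrow> open S" by auto
  then obtain \<F>' where F': "\<F>' \<subseteq> ?B ` (- {0})" "countable \<F>'" "\<Union>\<F>' = \<Union>(?B ` (- {0}))"
    by (rule Lindelof)
  obtain I where I: "I \<subseteq> - {0}" "countable I" "\<F>' = ?B ` I"
    using countable_subset_image[of \<F>' ?B "- {0}"] F' by auto
  have "p \<in> ?B p" if "p \<in> - {0}" for p using * that by auto
  then have "- {0} \<subseteq> (\<Union>p\<in>I. ?B p)" using F'(3) I(3) by blast
  moreover have "\<forall>p\<in>I. open (?B p) \<and> line_holo (g p) (?B p) \<and> line_holo (h p) (?B p) \<and>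
      ?B p \<subseteq> closure {z \<in> ?B p. h p z \<noteq> 0} \<and> {z \<in> ?B p. h p z \<noteq> 0} \<subseteq> R \<and>
      (\<forall>z\<in>R \<inter> ?B p. F z * h p z = g p z)"
  proof
    fix p assume "p \<in> I"
    then have "p \<in> - {0}" using I(1) by blast
    from bspec[OF * this] show "open (?B p) \<and> line_holo (g p) (?B p) \<and> line_holo (h p) (?B p) \<and>
      ?B p \<subseteq> closure {z \<in> ?B p. h p z \<noteq> 0} \<and> {z \<in> ?B p. h p z \<noteq> 0} \<subseteq> R \<and>
      (\<forall>z\<in>R \<inter> ?B p. F z * h p z = g p z)" by (intro conjI open_ball) (elim conjE, assumption)+
  qed
  ultimately show ?thesis
    using I(2) by (intro exI[of _ I] exI[of _ ?B] exI[of _ g] exI[of _ h] conjI)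
qed

text \<open>The discs \<open>{w + \<zeta> v | |\<zeta>| \<le> 1}\<close> sweep out a neighbourhood of the origin.  Most of them avoid the origin,
and \<open>F\<close> is meromorphic on each of these.  The parameter \<open>w\<close> ranges over a full
ball rather than over a complement of \<open>v\<close>, which avoids a change of coordinates.\<close>

theorem meromorphic_quotient_at_0:
  fixes F :: "complex^'n \<Rightarrow> complex"
  assumes F: "meromorphic_off_0 F R" and n: "CARD('n) \<ge> 2"
  shows "\<exists>e>0. \<exists>G Q. line_holo G (ball 0 e) \<and> line_holo Q (ball 0 e) \<and> (\<exists>w\<in>ball 0 e. Q w \<noteq> 0) \<and>
      (\<forall>u\<in>R \<inter> ball 0 e. F u * Q u = G u)"
proof -
  have R: "open R" and FR: "line_holo F R" using F by (auto simp: meromorphic_off_0_def)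
  obtain I :: "(complex^'n) set" and B g h where I: "countable I" "- {0} \<subseteq> (\<Union>p\<in>I. B p)"
    and data: "\<forall>p\<in>I. open (B p) \<and> line_holo (g p) (B p) \<and> line_holo (h p) (B p) \<and>
      B p \<subseteq> closure {z \<in> B p. h p z \<noteq> 0} \<and> {z \<in> B p. h p z \<noteq> 0} \<subseteq> R \<and>
      (\<forall>z\<in>R \<inter> B p. F z * h p z = g p z)"
    using countable_local_quotients[OF F] by (elim exE conjE)
  have B: "\<And>p. p \<in> I \<Longrightarrow> open (B p)" "\<And>p. p \<in> I \<Longrightarrow> line_holo (g p) (B p)" "\<And>p. p \<in> I \<Longrightarrow> line_holo (h p) (B p)"
    "\<And>p. p \<in> I \<Longrightarrow> B p \<subseteq> closure {z \<in> B p. h p z \<noteq> 0}" "\<And>p. p \<in> I \<Longrightarrow> {z \<in> B p. h p z \<noteq> 0} \<subseteq> R"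
    "\<And>p z. p \<in> I \<Longrightarrow> z \<in> R \<inter> B p \<Longrightarrow> F z * h p z = g p z"
    using data by blast+
  note Bc = line_holo_continuous[OF B(3)]

  (* a line through 0 along which every local denominator is non-degenerate *)
  obtain v where v: "v \<noteq> 0" and vgen: "\<And>p \<zeta> e. p \<in> I \<Longrightarrow> \<zeta> \<noteq> 0 \<Longrightarrow> \<zeta> *s v \<in> B p \<Longrightarrow> e > 0 \<Longrightarrow>
      \<exists>\<zeta>'. dist \<zeta>' \<zeta> < e \<and> \<zeta>' *s v \<in> B p \<and> h p (\<zeta>' *s v) \<noteq> 0"
  proof -
    have "open (- {0::complex^'n})" "- {0::complex^'n} \<noteq> {}"
      using UNIV_not_singleton[of "0::complex^'n"] by auto
    then have "\<exists>x\<in>- {0}. (\<forall>T\<in>{}. x \<in> T) \<and> (\<forall>p\<in>I. \<forall>\<zeta>\<in>- {0}. \<zeta> *s x + 0 \<in> B p \<longrightarrow>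
        (\<forall>e>0. \<exists>\<zeta>'\<in>- {0}. dist \<zeta>' \<zeta> < e \<and> \<zeta>' *s x + 0 \<in> B p \<and> h p (\<zeta>' *s x + 0) \<noteq> 0))"
      by (intro generic_parameter[where a = "\<lambda>\<zeta>. \<zeta>" and b = "\<lambda>_. 0"] I(1) B(1) Bc B(4)) auto
    then obtain x where "x \<noteq> 0" and x: "\<forall>p\<in>I. \<forall>\<zeta>\<in>- {0}. \<zeta> *s x + 0 \<in> B p \<longrightarrow>
        (\<forall>e>0. \<exists>\<zeta>'\<in>- {0}. dist \<zeta>' \<zeta> < e \<and> \<zeta>' *s x + 0 \<in> B p \<and> h p (\<zeta>' *s x + 0) \<noteq> 0)"
      by blast
    show thesis
      by (rule that[OF \<open>x \<noteq> 0\<close>]) (use x in \<open>simp, blast\<close>)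
  qed
  (* the poles on this line are countable, so some circle around 0 avoids them all *)
  define bad where "bad = {\<zeta>. \<zeta> \<noteq> 0 \<and> \<zeta> *s v \<notin> R}"
  have "\<not> \<zeta>0 islimpt bad" if "\<zeta>0 \<noteq> 0" for \<zeta>0
  proof -
    have "\<zeta>0 *s v \<noteq> 0" using that v by (simp add: vec_eq_iff)
    then obtain p where p: "p \<in> I" "\<zeta>0 *s v \<in> B p" using I(2) by blast
    then have p0: "0 + \<zeta>0 *s v \<in> B p" by simp
    have "\<exists>d>0. \<exists>n \<psi>. \<psi> holomorphic_on ball \<zeta>0 d \<and> (\<forall>\<zeta>\<in>ball \<zeta>0 d - {\<zeta>0}. 0 + \<zeta> *s v \<in> R) \<and>
        (\<forall>\<zeta>\<in>ball \<zeta>0 d. 0 + \<zeta> *s v \<in> R \<longrightarrow> F (0 + \<zeta> *s v) * (\<zeta> - \<zeta>0) ^ n = \<psi> \<zeta>)"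
      by (rule slice_denominator[OF B(1)[OF p(1)] B(2)[OF p(1)] B(3)[OF p(1)] p0 B(5)[OF p(1)] B(6)[OF p(1)]])
         (use vgen[OF p(1) that p(2)] in auto)
    then obtain d where d: "d > 0" "\<And>\<zeta>. \<zeta> \<in> ball \<zeta>0 d - {\<zeta>0} \<Longrightarrow> \<zeta> *s v \<in> R"
      by auto
    show ?thesis
    proof
      assume "\<zeta>0 islimpt bad"
      then obtain \<zeta> where "\<zeta> \<in> bad" "\<zeta> \<noteq> \<zeta>0" "dist \<zeta> \<zeta>0 < d"
        using d(1) unfolding islimpt_approachable by blast
      then show False using d(2)[of \<zeta>] by (auto simp: bad_def dist_commute)
    qed
  qed
  then have "bad sparse_in (- {0})" by (subst sparse_in_open) auto
  then have "countable (- {0} \<inter> bad)" by (intro sparse_imp_countable) auto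
  moreover have "- {0} \<inter> bad = bad" by (auto simp: bad_def)
  ultimately have "countable (norm ` bad)" by simp
  moreover have "uncountable {0<..<1::real}" by (simp add: uncountable_open_interval)
  ultimately have "\<not> {0<..<1} \<subseteq> norm ` bad" using countable_subset by blast
  then obtain \<rho> where "\<rho> \<in> {0<..<1}" "\<rho> \<notin> norm ` bad" by blast
  then have \<rho>: "\<rho> > 0" "\<rho> \<notin> norm ` bad" by auto
  define v1 where "v1 = of_real \<rho> *s v"
  have v1R: "\<zeta> *s v1 \<in> R" if "\<zeta> \<in> sphere 0 1" for \<zeta>
  proof (rule ccontr)
    assume "\<zeta> *s v1 \<notin> R"
    then have "\<zeta> * of_real \<rho> \<in> bad" using that \<rho>(1) by (auto simp: bad_def v1_def)
    moreover have "norm (\<zeta> * of_real \<rho>) = \<rho>" using that \<rho>(1) by (simp add: norm_mult)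
    ultimately show False using \<rho>(2) by (metis imageI)
  qed
  have "compact ((\<lambda>\<zeta>. \<zeta> *s v1) ` sphere 0 1)"
    by (intro compact_continuous_image continuous_intros compact_sphere)
  then obtain \<epsilon> where \<epsilon>: "\<epsilon> > 0" "(\<Union>x\<in>(\<lambda>\<zeta>. \<zeta> *s v1) ` sphere 0 1. ball x \<epsilon>) \<subseteq> R"
    using compact_subset_open_imp_ball_epsilon_subset[OF _ R] v1R by (metis image_subsetI)
  define S where "S = ball (0::complex^'n) \<epsilon>"
  have S: "open S" "convex S" "S \<noteq> {}" using \<epsilon>(1) by (auto simp: S_def)
  have SR: "w + \<zeta> *s v1 \<in> R" if "w \<in> S" "\<zeta> \<in> sphere 0 1" for w \<zeta>
  proof -
    have "w + \<zeta> *s v1 \<in> ball (\<zeta> *s v1) \<epsilon>" using that by (simp add: S_def dist_norm)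
    then show ?thesis using \<epsilon>(2) that(2) by blast
  qed
  define \<phi> where "\<phi> = (\<lambda>w \<zeta>. F (w + \<zeta> *s v1))"
  have \<phi>_joint: "continuous_on (sphere 0 1 \<times> S) (\<lambda>(\<zeta>, w). \<phi> w \<zeta>)"
    unfolding split_def \<phi>_def
    by (rule continuous_on_compose2[OF line_holo_continuous[OF FR]]) (auto intro!: continuous_intros SR)
  have \<phi>_line: "line_holo (\<lambda>w. \<phi> w \<zeta>) S" if "\<zeta> \<in> sphere 0 1" for \<zeta>
    unfolding \<phi>_def by (rule line_holo_translate[OF FR]) (use SR that in auto)
  have \<phi>_cont: "continuous_on (sphere 0 1) (\<phi> w)" if "w \<in> S" for w
    unfolding \<phi>_def
    by (rule continuous_on_compose2[OF line_holo_continuous[OF FR]]) (use that in \<open>auto intro!: continuous_intros SR\<close>)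
  define c where "c = (\<lambda>j w. contour_integral (circlepath 0 1) (\<lambda>\<zeta>. \<phi> w \<zeta> * \<zeta> ^ j))"
  have c_line: "line_holo (c j) S" for j
    unfolding c_def
  proof (rule line_holo_circle_integral[OF S(1)])
    show "continuous_on (sphere 0 1 \<times> S) (\<lambda>(\<zeta>, w). \<phi> w \<zeta> * \<zeta> ^ j)"
      using \<phi>_joint unfolding split_def by (intro continuous_intros)
  qed (auto intro!: line_holo_mult \<phi>_line)
  (* w is good when F has only finitely many poles on the disc through w *)
  define W where "W = (\<lambda>w. {\<zeta>. w + \<zeta> *s v1 \<in> R})"
  define good where "good = (\<lambda>w. \<exists>P \<Psi>. (\<forall>\<zeta>\<in>W w. poly P \<zeta> \<noteq> 0) \<and> P \<noteq> 0 \<and> \<Psi> holomorphic_on cball 0 1 \<and>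
      (\<forall>\<zeta>\<in>cball 0 1 \<inter> W w. \<Psi> \<zeta> = \<phi> w \<zeta> * poly P \<zeta>))"
  have good_dense: "\<exists>w\<in>\<Lambda>. good w \<and> (\<forall>T\<in>\<G>. w \<in> T)"
    if \<Lambda>: "open \<Lambda>" "\<Lambda> \<noteq> {}" and \<G>: "countable \<G>" "\<And>T. T \<in> \<G> \<Longrightarrow> open T" "\<And>T. T \<in> \<G> \<Longrightarrow> \<Lambda> \<subseteq> closure T" for \<Lambda> \<G>
  proof -
    (* n >= 2 enters here: most translates of a disc miss the origin *)
    define T0 where "T0 = - ((\<lambda>\<zeta>. - (\<zeta> *s v1)) ` cball 0 1)"
    have "compact ((\<lambda>\<zeta>. - (\<zeta> *s v1)) ` cball 0 1)"
      by (intro compact_continuous_image continuous_intros compact_cball)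
    then have T0: "open T0" "closure T0 = UNIV"
      using line_complement_dense[OF n, of v1 "cball 0 1"] by (auto simp: T0_def compact_imp_closed)
    have "countable (insert T0 \<G>)" "\<And>T. T \<in> insert T0 \<G> \<Longrightarrow> open T" "\<And>T. T \<in> insert T0 \<G> \<Longrightarrow> \<Lambda> \<subseteq> closure T"
      using \<G> T0 by auto
    then have "\<exists>w\<in>\<Lambda>. (\<forall>T\<in>insert T0 \<G>. w \<in> T) \<and> (\<forall>p\<in>I. \<forall>\<zeta>\<in>UNIV. 1 *s w + \<zeta> *s v1 \<in> B p \<longrightarrow>
        (\<forall>e>0. \<exists>\<zeta>'\<in>UNIV. dist \<zeta>' \<zeta> < e \<and> 1 *s w + \<zeta>' *s v1 \<in> B p \<and> h p (1 *s w + \<zeta>' *s v1) \<noteq> 0))"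
      by (intro generic_parameter[where a = "\<lambda>\<zeta>. 1" and b = "\<lambda>\<zeta>. \<zeta> *s v1"] I(1) B(1) Bc B(4) \<Lambda>) auto
    then obtain w where w: "w \<in> \<Lambda>" "\<forall>T\<in>insert T0 \<G>. w \<in> T" and wgen: "\<forall>p\<in>I. \<forall>\<zeta>\<in>UNIV. w + \<zeta> *s v1 \<in> B p \<longrightarrow>
        (\<forall>e>0. \<exists>\<zeta>'\<in>UNIV. dist \<zeta>' \<zeta> < e \<and> w + \<zeta>' *s v1 \<in> B p \<and> h p (w + \<zeta>' *s v1) \<noteq> 0)"
      unfolding vector_smult_lid by (elim bexE conjE)
    have "good w"
      unfolding good_def
    proof (rule disc_denominator)
      show "\<phi> w holomorphic_on W w"
        unfolding \<phi>_def W_def by (rule line_holo_line[OF FR]) auto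
      fix \<zeta>0 :: complex assume "\<zeta>0 \<in> cball 0 1"
      have "w \<in> T0" using w(2) by auto
      have "w + \<zeta>0 *s v1 \<noteq> 0"
      proof
        assume "w + \<zeta>0 *s v1 = 0"
        then have "w = - (\<zeta>0 *s v1)" by (simp add: eq_neg_iff_add_eq_0)
        then show False using \<open>w \<in> T0\<close> \<open>\<zeta>0 \<in> cball 0 1\<close> unfolding T0_def by blast
      qed
      then obtain p where p: "p \<in> I" "w + \<zeta>0 *s v1 \<in> B p" using I(2) by blast
      show "\<exists>d>0. \<exists>n \<psi>. \<psi> holomorphic_on ball \<zeta>0 d \<and> (\<forall>\<zeta>\<in>ball \<zeta>0 d - {\<zeta>0}. \<zeta> \<in> W w) \<and>
          (\<forall>\<zeta>\<in>ball \<zeta>0 d. \<zeta> \<in> W w \<longrightarrow> \<phi> w \<zeta> * (\<zeta> - \<zeta>0) ^ n = \<psi> \<zeta>)"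
        unfolding W_def \<phi>_def mem_Collect_eq
        by (rule slice_denominator[OF B(1)[OF p(1)] B(2)[OF p(1)] B(3)[OF p(1)] p(2) B(5)[OF p(1)] B(6)[OF p(1)]])
           (use wgen p in auto)
    qed
    then show ?thesis using w by blast
  qed

  (* the moments satisfy a linear recurrence with holomorphic coefficients *)
  obtain k q where q: "\<And>i. i < k \<Longrightarrow> line_holo (q i) S" "\<exists>i<k. \<exists>w\<in>S. q i w \<noteq> 0"
    "\<And>j w. w \<in> S \<Longrightarrow> (\<Sum>i<k. q i w * c (i + j) w) = 0"
  proof (rule ccontr)
    assume "\<not> thesis"
    have "\<forall>k. \<exists>D. line_holo D S \<and> (\<exists>w\<in>S. D w \<noteq> 0) \<and>
        (\<forall>w\<in>S. D w \<noteq> 0 \<longrightarrow> (\<forall>p. (\<forall>j. (\<Sum>i<k. p i * c (i + j) w) = 0) \<longrightarrow> (\<forall>i<k. p i = 0)))"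
    proof
      fix k
      have "\<forall>j. \<forall>i<k. line_holo ((\<lambda>j i. c (i + j)) j i) S" using c_line by auto
      from line_holo_elimination[OF S this]
      show "\<exists>D. line_holo D S \<and> (\<exists>w\<in>S. D w \<noteq> 0) \<and>
        (\<forall>w\<in>S. D w \<noteq> 0 \<longrightarrow> (\<forall>p. (\<forall>j. (\<Sum>i<k. p i * c (i + j) w) = 0) \<longrightarrow> (\<forall>i<k. p i = 0)))"
        using that \<open>\<not> thesis\<close> by (elim disjE) (blast, assumption)
    qed
    from choice[OF this] obtain D where D0: "\<forall>k. line_holo (D k) S \<and> (\<exists>w\<in>S. D k w \<noteq> 0) \<and>
        (\<forall>w\<in>S. D k w \<noteq> 0 \<longrightarrow> (\<forall>p. (\<forall>j. (\<Sum>i<k. p i * c (i + j) w) = 0) \<longrightarrow> (\<forall>i<k. p i = 0)))"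
      by (elim exE)
    then have D: "\<And>k. line_holo (D k) S" "\<And>k. \<exists>w\<in>S. D k w \<noteq> 0"
      "\<And>k w p i. w \<in> S \<Longrightarrow> D k w \<noteq> 0 \<Longrightarrow> (\<forall>j. (\<Sum>i<k. p i * c (i + j) w) = 0) \<Longrightarrow> i < k \<Longrightarrow> p i = 0"
      by blast+
    let ?\<G> = "range (\<lambda>k. {w \<in> S. D k w \<noteq> 0})"
    have "\<exists>w\<in>S. good w \<and> (\<forall>T\<in>?\<G>. w \<in> T)"
    proof (rule good_dense[OF S(1,3)])
      show "open T" if "T \<in> ?\<G>" for T
        using that open_nonzero[OF line_holo_continuous[OF D(1)] S(1)] by auto
      show "S \<subseteq> closure T" if "T \<in> ?\<G>" for T
        using that line_holo_nonzero_dense[OF D(1) S(1,2)] D(2) by blast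
    qed auto
    then obtain w where w: "w \<in> S" "good w" "\<And>k. D k w \<noteq> 0" by auto
    obtain P \<Psi> where P: "P \<noteq> 0" "\<Psi> holomorphic_on cball 0 1" "\<forall>\<zeta>\<in>cball 0 1 \<inter> W w. \<Psi> \<zeta> = \<phi> w \<zeta> * poly P \<zeta>"
      using w(2) unfolding good_def by blast
    have "sphere 0 1 \<subseteq> W w" using SR[OF w(1)] by (auto simp: W_def)
    from moment_recurrence[OF \<phi>_cont[OF w(1)] this P(2)] P(3)
    have "(\<Sum>i<Suc (degree P). coeff P i * c (i + j) w) = 0" for j
      unfolding c_def lessThan_Suc_atMost by blast
    then have "coeff P (degree P) = 0" using D(3)[OF w(1) w(3)] by blast
    with P(1) show False by simp
  qed
  define Qp where "Qp = (\<lambda>w. \<Sum>i<k. monom (q i w) i)"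
  have Qp: "poly (Qp w) \<zeta> = (\<Sum>i<k. q i w * \<zeta> ^ i)" for w \<zeta>
    by (simp add: Qp_def poly_sum poly_monom)
  have Qp_mom: "contour_integral (circlepath 0 1) (\<lambda>\<zeta>. \<phi> w \<zeta> * poly (Qp w) \<zeta> * \<zeta> ^ j) = 0" if w: "w \<in> S" for w j
  proof -
    have int: "(\<lambda>\<zeta>. \<phi> w \<zeta> * \<zeta> ^ i) contour_integrable_on circlepath 0 1" for i
      by (intro contour_integrable_continuous_circlepath continuous_intros) (use \<phi>_cont[OF w] in simp)
    have "contour_integral (circlepath 0 1) (\<lambda>\<zeta>. \<phi> w \<zeta> * poly (Qp w) \<zeta> * \<zeta> ^ j) =
        contour_integral (circlepath 0 1) (\<lambda>\<zeta>. \<Sum>i<k. q i w * (\<phi> w \<zeta> * \<zeta> ^ (i + j)))"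
      by (simp add: Qp sum_distrib_left sum_distrib_right power_add mult_ac)
    also have "\<dots> = (\<Sum>i<k. contour_integral (circlepath 0 1) (\<lambda>\<zeta>. q i w * (\<phi> w \<zeta> * \<zeta> ^ (i + j))))"
      by (intro contour_integral_sum contour_integrable_lmul int) auto
    also have "\<dots> = (\<Sum>i<k. q i w * c (i + j) w)"
      by (simp add: contour_integral_lmul int c_def)
    finally show ?thesis using q(3)[OF w] by simp
  qed
  obtain i0 w1 where w1: "i0 < k" "w1 \<in> S" "q i0 w1 \<noteq> 0" using q(2) by blast
  have "coeff (Qp w1) i0 = q i0 w1" using w1(1) by (simp add: Qp_def coeff_sum)
  then have "Qp w1 \<noteq> 0" using w1(3) by auto
  then have "finite {\<zeta>. poly (Qp w1) \<zeta> = 0}" by (rule poly_roots_finite)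
  (* The parameter is shifted by \<zeta>0 v1, because the coefficient of \<zeta>^0 alone could vanish identically;
     \<delta> bounds the shift by \<epsilon> / 2. *)
  define \<delta> where "\<delta> = min 1 (\<epsilon> / (2 * (norm v1 + 1)))"
  have "\<delta> > 0" using \<epsilon>(1) by (simp add: \<delta>_def add_nonneg_pos)
  then have "infinite (ball (0::complex) \<delta>)"
    using uncountable_ball countable_finite by blast
  then have "\<not> ball 0 \<delta> \<subseteq> {\<zeta>. poly (Qp w1) \<zeta> = 0}" using \<open>finite _\<close> finite_subset by blast
  then obtain \<zeta>0 where "\<zeta>0 \<in> ball 0 \<delta>" "poly (Qp w1) \<zeta>0 \<noteq> 0" by blast
  then have \<zeta>0: "norm \<zeta>0 < \<delta>" "poly (Qp w1) \<zeta>0 \<noteq> 0" by auto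
  have \<zeta>01: "norm \<zeta>0 < 1" using \<zeta>0(1) by (simp add: \<delta>_def)
  define Q' where "Q' = (\<lambda>w. poly (Qp w) \<zeta>0)"
  define G' where "G' = (\<lambda>w. 1 / (2 * of_real pi * \<i>) *
      contour_integral (circlepath 0 1) (\<lambda>\<zeta>. \<phi> w \<zeta> * poly (Qp w) \<zeta> / (\<zeta> - \<zeta>0)))"
  have Q'_line: "line_holo Q' S"
    unfolding Q'_def Qp by (intro line_holo_sum line_holo_mult q line_holo_const) auto
  have G'_line: "line_holo G' S"
    unfolding G'_def
  proof (intro line_holo_mult line_holo_const line_holo_circle_integral S(1))
    have "continuous_on (sphere 0 1 \<times> S) (\<lambda>y. q i (snd y))" if "i < k" for i
      by (rule continuous_on_compose2[OF line_holo_continuous[OF q(1)[OF that]]]) (auto intro!: continuous_intros)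
    then show "continuous_on (sphere 0 1 \<times> S) (\<lambda>(\<zeta>, w). \<phi> w \<zeta> * poly (Qp w) \<zeta> / (\<zeta> - \<zeta>0))"
      using \<phi>_joint \<zeta>01 unfolding split_def Qp by (intro continuous_intros) auto
    show "line_holo (\<lambda>w. \<phi> w \<zeta> * poly (Qp w) \<zeta> / (\<zeta> - \<zeta>0)) S" if "\<zeta> \<in> sphere 0 1" for \<zeta>
      unfolding Qp using that \<zeta>01
      by (intro line_holo_divide line_holo_mult line_holo_sum \<phi>_line q line_holo_const) auto
  qed simp
  have FQ: "\<phi> w \<zeta>0 * Q' w = G' w" if w: "w \<in> S" "w + \<zeta>0 *s v1 \<in> R" for w
  proof (rule ccontr)
    let ?S' = "{w \<in> S. w + \<zeta>0 *s v1 \<in> R}"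
    let ?f = "\<lambda>w. \<phi> w \<zeta>0 * Q' w - G' w"
    assume ne: "\<phi> w \<zeta>0 * Q' w \<noteq> G' w"
    have "open ((\<lambda>w. w + \<zeta>0 *s v1) -` R)" by (intro open_vimage R continuous_intros)
    then have oS': "open ?S'" using S(1) by (auto simp: Collect_conj_eq vimage_def)
    have "line_holo ?f ?S'"
      unfolding \<phi>_def
      by (intro line_holo_diff line_holo_mult line_holo_translate[OF FR] line_holo_subset[OF Q'_line] line_holo_subset[OF G'_line]) auto
    then have "open {w \<in> ?S'. ?f w \<noteq> 0}" by (intro open_nonzero line_holo_continuous oS')
    moreover have "w \<in> {w \<in> ?S'. ?f w \<noteq> 0}" using w ne by simp
    ultimately have "\<exists>w\<in>{w \<in> ?S'. ?f w \<noteq> 0}. good w \<and> (\<forall>T\<in>{}. w \<in> T)"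
      by (intro good_dense) auto
    then obtain u where u: "u \<in> S" "u + \<zeta>0 *s v1 \<in> R" "\<phi> u \<zeta>0 * Q' u \<noteq> G' u" "good u" by auto
    obtain P \<Psi> where P: "\<forall>\<zeta>\<in>W u. poly P \<zeta> \<noteq> 0" "\<Psi> holomorphic_on cball 0 1"
        "\<forall>\<zeta>\<in>cball 0 1 \<inter> W u. \<Psi> \<zeta> = \<phi> u \<zeta> * poly P \<zeta>"
      using u(4) unfolding good_def by blast
    have sub: "sphere 0 1 \<subseteq> W u" using SR[OF u(1)] by (auto simp: W_def)
    have \<zeta>W: "\<zeta>0 \<in> W u" using u(2) by (simp add: W_def)
    have "contour_integral (circlepath 0 1) (\<lambda>\<zeta>. \<phi> u \<zeta> * poly (Qp u) \<zeta> / (\<zeta> - \<zeta>0)) =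
        2 * of_real pi * \<i> * (\<phi> u \<zeta>0 * poly (Qp u) \<zeta>0)"
      by (rule cauchy_formula_from_moments[OF \<phi>_cont[OF u(1)] sub P(2) _ Qp_mom[OF u(1)] \<zeta>01 \<zeta>W])
         (use P \<zeta>W in auto)
    then show False using u(3) by (simp add: G'_def Q'_def)
  qed

  define b where "b = - (\<zeta>0 *s v1)"
  have "norm b = norm \<zeta>0 * norm v1"
    unfolding b_def norm_minus_cancel by (rule norm_vsmult)
  also have "\<dots> \<le> \<delta> * norm v1" using \<zeta>0(1) by (intro mult_right_mono) auto
  also have "\<dots> \<le> \<epsilon> / (2 * (norm v1 + 1)) * norm v1" by (intro mult_right_mono) (auto simp: \<delta>_def)
  also have "\<dots> \<le> \<epsilon> / 2" using \<epsilon>(1) by (simp add: divide_simps add_nonneg_pos)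
  finally have b: "norm b \<le> \<epsilon> / 2" .
  have shift: "u + b \<in> S" if "u \<in> ball 0 (\<epsilon> / 2)" for u
    using that b norm_triangle_ineq[of u b] by (simp add: S_def)
  let ?G = "\<lambda>u. G' (u + b)" and ?Q = "\<lambda>u. Q' (u + b)"
  have "line_holo ?G (ball 0 (\<epsilon> / 2))" "line_holo ?Q (ball 0 (\<epsilon> / 2))"
    by (rule line_holo_translate[OF G'_line], rule shift, assumption)
      (rule line_holo_translate[OF Q'_line], rule shift, assumption)
  moreover have "\<exists>u\<in>ball 0 (\<epsilon> / 2). ?Q u \<noteq> 0"
  proof (rule ccontr)
    assume no: "\<not> ?thesis"
    have "Q' z = 0" if "z \<in> ball b (\<epsilon> / 2)" for z
    proof -
      have "z - b \<in> ball 0 (\<epsilon> / 2)" using that by (simp add: dist_norm norm_minus_commute)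
      then have "?Q (z - b) = 0" using no by blast
      then show ?thesis by simp
    qed
    moreover have "ball b (\<epsilon> / 2) \<subseteq> S"
    proof
      fix z assume "z \<in> ball b (\<epsilon> / 2)"
      then have "z - b \<in> ball 0 (\<epsilon> / 2)" by (simp add: dist_norm norm_minus_commute)
      from shift[OF this] show "z \<in> S" by simp
    qed
    ultimately have "Q' w1 = 0"
      by (intro line_holo_identity[OF Q'_line S(1,2) open_ball _ _ _ w1(2), of b "\<epsilon> / 2"]) (use \<epsilon>(1) in auto)
    then show False using \<zeta>0(2) by (simp add: Q'_def)
  qed
  moreover have "F u * ?Q u = ?G u" if u: "u \<in> R \<inter> ball 0 (\<epsilon> / 2)" for u
    using FQ[of "u + b"] shift u by (simp add: \<phi>_def b_def)
  ultimately show ?thesis using \<epsilon>(1) by (intro exI[of _ "\<epsilon> / 2"] conjI exI[of _ ?G] exI[of _ ?Q]) auto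
qed

section \<open>Separating eigenvalues\<close>

text \<open>An infinite Vandermonde argument.  A polynomial in the eigenvalue can be inserted into the vanishing power sums; choosing its
zeros at the other eigenvalues of modulus at least \<open>|c|\<close> leaves \<open>c\<close> as the dominant
one, and \<open>k \<rightarrow> \<infinity>\<close> isolates its contribution.\<close>

lemma eigenvalue_separation:
  fixes x ev :: "'m \<Rightarrow> complex"
  assumes fin: "\<And>\<delta>. \<delta> > 0 \<Longrightarrow> finite {m \<in> M. norm (ev m) \<ge> \<delta>}" and c: "c \<noteq> 0"
    and zero: "\<And>k. ((\<lambda>m. x m * ev m ^ k) has_sum 0) M"
  shows "(\<Sum>m | m \<in> M \<and> ev m = c. x m) = 0"
proof -
  define E where "E = ev ` {m \<in> M. norm (ev m) \<ge> norm c} - {c}"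
  have E: "finite E" unfolding E_def using fin[of "norm c"] c by auto
  (* p kills the finitely many other eigenvalues that are at least as large as c *)
  define p where "p = (\<Prod>e\<in>E. [:- e, 1:])"
  have pc: "poly p c \<noteq> 0" unfolding p_def poly_prod using E by (auto simp: E_def)
  have pzero: "((\<lambda>m. x m * poly p (ev m) * ev m ^ k) has_sum 0) M" for p k
  proof (induction p arbitrary: k)
    case 0
    then show ?case by simp
  next
    case (pCons a p)
    have "((\<lambda>m. a * (x m * ev m ^ k) + x m * poly p (ev m) * ev m ^ Suc k) has_sum a * 0 + 0) M"
      by (intro has_sum_add has_sum_cmult_right zero pCons.IH)
    then show ?case by (simp add: algebra_simps)
  qed
  define y where "y = (\<lambda>m. x m * poly p (ev m))"
  define A where "A = {m \<in> M. ev m = c}"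
  have A: "finite A" "A \<subseteq> M"
    using finite_subset[OF _ fin[of "norm c"], of A] c by (auto simp: A_def)
  have ysum: "((\<lambda>m. y m * ev m ^ k) has_sum 0) M" for k
    unfolding y_def by (rule pzero)
  have "y summable_on M" using ysum[of 0] by (auto simp: summable_on_def)
  then have "(\<lambda>m. norm (y m)) summable_on M"
    by (simp add: summable_on_iff_abs_summable_on_complex)
  then have "(\<lambda>m. norm (y m)) summable_on (M - A)"
    by (rule summable_on_subset_banach) auto
  then obtain T where T: "((\<lambda>m. norm (y m)) has_sum T) (M - A)"
    by (auto simp: summable_on_def)
  define H where "H = {m \<in> M. norm (ev m) \<ge> norm c / 2 \<and> norm (ev m) < norm c}"
  have H: "finite H" using finite_subset[OF _ fin[of "norm c / 2"], of H] c by (auto simp: H_def)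
  (* all smaller eigenvalues are at most \<theta> |c| *)
  define \<theta> where "\<theta> = Max (insert (1/2) ((\<lambda>m. norm (ev m) / norm c) ` H))"
  have \<theta>: "\<theta> < 1" "0 \<le> \<theta>"
  proof -
    show "\<theta> < 1" unfolding \<theta>_def using H c by (subst Max_less_iff) (auto simp: H_def)
    have "1/2 \<le> \<theta>" unfolding \<theta>_def using H by (intro Max_ge) auto
    then show "0 \<le> \<theta>" by simp
  qed
  have small: "norm (ev m) \<le> \<theta> * norm c" if "m \<in> M" "norm (ev m) < norm c" for m
  proof -
    have "norm (ev m) / norm c \<le> \<theta>"
    proof (cases "m \<in> H")
      case True
      then show ?thesis unfolding \<theta>_def using H by (intro Max_ge) auto
    next
      case False
      then have "norm (ev m) / norm c \<le> 1/2" using that c by (auto simp: H_def field_simps)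
      also have "\<dots> \<le> \<theta>" unfolding \<theta>_def using H by (intro Max_ge) auto
      finally show ?thesis .
    qed
    then show ?thesis using c by (simp add: field_simps)
  qed
  have bound: "norm (\<Sum>m\<in>A. y m) \<le> \<theta> ^ k * T" for k
  proof -
    let ?f = "\<lambda>m. y m * ev m ^ k"
    have "?f summable_on M" using ysum[of k] by (auto simp: summable_on_def)
    then have "?f summable_on (M - A)" by (rule summable_on_subset_banach) auto
    then obtain s where s: "(?f has_sum s) (M - A)" by (auto simp: summable_on_def)
    have "(?f has_sum sum ?f A + s) (A \<union> (M - A))"
      using A s by (intro has_sum_Un_disjoint) auto
    moreover have "A \<union> (M - A) = M" using A by auto
    ultimately have "sum ?f A + s = 0" using ysum[of k] has_sum_unique by metis
    moreover have "sum ?f A = c ^ k * (\<Sum>m\<in>A. y m)"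
      unfolding sum_distrib_left by (intro sum.cong) (auto simp: A_def)
    ultimately have s_eq: "norm s = norm c ^ k * norm (\<Sum>m\<in>A. y m)"
      by (metis add_eq_0_iff norm_minus_cancel norm_mult norm_power)
    have "norm s \<le> (\<theta> * norm c) ^ k * T"
    proof (rule norm_infsum_le[OF s has_sum_cmult_right[OF T]])
      fix m assume m: "m \<in> M - A"
      show "norm (?f m) \<le> (\<theta> * norm c) ^ k * norm (y m)"
      proof (cases "norm (ev m) < norm c")
        case True
        then have "norm (ev m) ^ k \<le> (\<theta> * norm c) ^ k" using small m by (intro power_mono) auto
        then have "norm (ev m) ^ k * norm (y m) \<le> (\<theta> * norm c) ^ k * norm (y m)" by (intro mult_right_mono) auto
        then show ?thesis by (simp add: norm_mult norm_power mult.commute)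
      next
        case False
        then have "ev m \<in> E" using m by (auto simp: E_def A_def)
        then have "poly p (ev m) = 0" unfolding p_def poly_prod using E by (intro prod_zero) auto
        then show ?thesis by (simp add: y_def)
      qed
    qed
    then show ?thesis unfolding s_eq using c by (simp add: power_mult_distrib)
  qed
  have "(\<lambda>k. \<theta> ^ k * T) \<longlonglongrightarrow> 0"
    using \<theta> by (intro tendsto_mult_left_zero LIMSEQ_power_zero) auto
  then have "norm (\<Sum>m\<in>A. y m) \<le> 0"
    by (rule LIMSEQ_le_const) (use bound in auto)
  moreover have "(\<Sum>m\<in>A. y m) = poly p c * (\<Sum>m\<in>A. x m)"
    unfolding sum_distrib_left by (intro sum.cong) (auto simp: A_def y_def)
  ultimately show ?thesis using pc by (simp add: A_def)
qed

text \<open>The value \<open>cmonomial m lam\<close> is at the same time the eigenvalue of this monomial under the contraction.\<close>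

definition cmonomial :: "('n::finite \<Rightarrow> nat) \<Rightarrow> complex^'n \<Rightarrow> complex" where
  "cmonomial m z = (\<Prod>i\<in>UNIV. z $ i ^ m i)"

lemma psi_pow: "psi (\<chi> i. (z $ i) ^ k) m = psi z m ^ k"
  by (simp add: psi_def prod_power_distrib power_int_power power_int_power' mult.commute)

lemma psi_nonzero: "(\<And>i. z $ i \<noteq> 0) \<Longrightarrow> psi z m \<noteq> 0"
  by (auto simp: psi_def)

text \<open>Number the coordinates by \<open>f\<close> and put \<open>z\<^sub>i = exp(t\<^bsup>f i\<^esup>)\<close>.  Then \<open>z\<^sup>m\<close> is the exponential of a polynomial in \<open>t\<close>
that has the components of \<open>m\<close> as coefficients, and all but finitely many \<open>t\<close> separate finitely many polynomials.\<close>

lemma separating_point: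
  fixes E :: "(int^'n::finite) set"
  assumes E: "finite E"
  shows "\<exists>z :: complex^'n. (\<forall>i. z $ i \<noteq> 0) \<and> inj_on (psi z) E"
proof -
  obtain f :: "'n \<Rightarrow> nat" where f: "inj f"
    using finite_imp_inj_to_nat_seg[of "UNIV :: 'n set"] by auto
  define p :: "int^'n \<Rightarrow> real poly" where "p = (\<lambda>m. \<Sum>i\<in>UNIV. monom (of_int (m $ i)) (f i))"
  have coeff_p: "coeff (p m) (f i) = of_int (m $ i)" for m i
  proof -
    have "coeff (p m) (f i) = (\<Sum>j\<in>UNIV. if j = i then of_int (m $ j) else 0)"
      unfolding p_def coeff_sum using f by (intro sum.cong) (auto simp: inj_eq)
    then show ?thesis by simp
  qed
  have p_inj: "p m \<noteq> p m'" if "m \<noteq> m'" for m m'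
    using that coeff_p by (metis of_int_eq_iff vec_eq_iff)
  define Z where "Z = (\<Union>m\<in>E. \<Union>m'\<in>E - {m}. {t. poly (p m - p m') t = 0})"
  have "finite Z" unfolding Z_def using E p_inj
    by (intro finite_UN_I poly_roots_finite) auto
  then obtain t where t: "t \<notin> Z" using ex_new_if_finite infinite_UNIV_char_0 by blast
  define z :: "complex^'n" where "z = (\<chi> i. of_real (exp (t ^ f i)))"
  have psi_z: "psi z m = of_real (exp (poly (p m) t))" for m
  proof -
    have "psi z m = (\<Prod>i\<in>UNIV. of_real (exp (of_int (m $ i) * t ^ f i)))"
      unfolding psi_def z_def
      by (intro prod.cong) (simp_all add: exp_power_int)
    also have "\<dots> = of_real (exp (\<Sum>i\<in>UNIV. of_int (m $ i) * t ^ f i))"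
      by (simp add: exp_sum)
    finally show ?thesis by (simp add: p_def poly_sum poly_monom)
  qed
  have "inj_on (psi z) E"
  proof (rule inj_onI, rule ccontr)
    fix m m' assume m: "m \<in> E" "m' \<in> E" "psi z m = psi z m'" "m \<noteq> m'"
    then have "poly (p m) t = poly (p m') t" by (simp add: psi_z)
    then have "t \<in> Z" using m by (auto simp: Z_def)
    with t show False by simp
  qed
  then show ?thesis by (intro exI[of _ z]) (auto simp: z_def)
qed

text \<open>On the powers of a separating point, the relation becomes a vanishing power sum with distinct eigenvalues.\<close>

lemma laurent_monomials_independent:
  fixes c :: "int^'n::finite \<Rightarrow> complex"
  assumes E: "finite E" and zero: "\<And>z. (\<And>i. z $ i \<noteq> 0) \<Longrightarrow> (\<Sum>m\<in>E. c m * psi z m) = 0"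
    and m0: "m0 \<in> E"
  shows "c m0 = 0"
proof -
  obtain z :: "complex^'n" where z: "\<And>i. z $ i \<noteq> 0" "inj_on (psi z) E"
    using separating_point[OF E] by blast
  have "((\<lambda>m. c m * psi z m ^ k) has_sum 0) E" for k
    using zero[of "\<chi> i. (z $ i) ^ k"] z(1) E by (simp add: psi_pow has_sum_finite_iff)
  from eigenvalue_separation[OF _ psi_nonzero[of z m0] this] E z(1)
  have "(\<Sum>m | m \<in> E \<and> psi z m = psi z m0. c m) = 0" by auto
  moreover have "{m. m \<in> E \<and> psi z m = psi z m0} = {m0}"
    using z(2) m0 by (auto dest: inj_onD)
  ultimately show ?thesis by simp
qed

lemma cmonomial_eq_psi: "cmonomial m z = psi z (\<chi> i. int (m i))"
  by (simp add: cmonomial_def psi_def)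

lemma monomials_independent:
  fixes b :: "('n::finite \<Rightarrow> nat) \<Rightarrow> complex"
  assumes E: "finite E" and m0: "m0 \<in> E" "b m0 \<noteq> 0"
  shows "\<exists>z. (\<forall>i. z $ i \<noteq> 0) \<and> (\<Sum>m\<in>E. b m * cmonomial m z) \<noteq> 0"
proof (rule ccontr)
  assume no: "\<not> ?thesis"
  let ?j = "\<lambda>m. (\<chi> i. int (m i)) :: int^'n"
  have inj: "inj_on ?j E" by (auto simp: inj_on_def vec_eq_iff fun_eq_iff)
  have "(\<Sum>m\<in>?j ` E. b (inv_into E ?j m) * psi z m) = 0" if "\<And>i. z $ i \<noteq> 0" for z
  proof -
    have "(\<Sum>m\<in>?j ` E. b (inv_into E ?j m) * psi z m) = (\<Sum>m\<in>E. b m * cmonomial m z)"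
      by (subst sum.reindex[OF inj]) (auto intro!: sum.cong simp: cmonomial_eq_psi inv_into_f_f[OF inj])
    then show ?thesis using no that by auto
  qed
  then have "b (inv_into E ?j (?j m0)) = 0"
    by (rule laurent_monomials_independent[where E = "?j ` E" and c = "\<lambda>m. b (inv_into E ?j m)", OF finite_imageI[OF E]])
       (use m0 in auto)
  then show False using m0 by (simp add: inv_into_f_f[OF inj m0(1)])
qed

section \<open>Invariant meromorphic functions are quotients of eigenpolynomials\<close>

lemma diag_iterate: "(diag_map lam ^^ k) z = (\<chi> i. (lam $ i) ^ k * z $ i)"
  by (induction k) (auto simp: diag_map_def vec_eq_iff)

lemma cmonomial_iterate: "cmonomial m ((diag_map lam ^^ k) z) = cmonomial m lam ^ k * cmonomial m z"
  unfolding diag_iterate cmonomial_def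
  by (simp add: power_mult_distrib prod.distrib prod_power_distrib mult.commute flip: power_mult)

lemma norm_cmonomial_le:
  fixes lam :: "complex^'n::finite"
  assumes lam: "\<And>i. norm (lam $ i) < 1"
  shows "norm (cmonomial m lam) \<le> norm (lam $ i) ^ m i"
proof -
  have "norm (cmonomial m lam) = norm (lam $ i) ^ m i * (\<Prod>j\<in>UNIV - {i}. norm (lam $ j) ^ m j)"
    unfolding cmonomial_def by (subst prod.remove[of UNIV i]) (simp_all add: norm_mult norm_power prod_norm[symmetric])
  also have "\<dots> \<le> norm (lam $ i) ^ m i * 1"
    using lam by (intro mult_left_mono prod_le_1) (simp_all add: power_le_one less_imp_le)
  finally show ?thesis by simp
qed

lemma finite_large_eigenvalues:
  fixes lam :: "complex^'n::finite"
  assumes lam: "\<And>i. norm (lam $ i) < 1" and \<delta>: "\<delta> > 0"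
  shows "finite {m. norm (cmonomial m lam) \<ge> \<delta>}"
proof -
  have "\<forall>i. \<exists>K. norm (lam $ i) ^ K < \<delta>"
    using lam \<delta> by (intro allI real_arch_pow_inv) auto
  then obtain K where K: "\<And>i. norm (lam $ i) ^ K i < \<delta>" by metis
  have "m i < K i" if m: "norm (cmonomial m lam) \<ge> \<delta>" for m i
  proof (rule ccontr)
    assume "\<not> m i < K i"
    then have "norm (lam $ i) ^ m i \<le> norm (lam $ i) ^ K i"
      using lam[of i] by (intro power_decreasing) auto
    moreover have "norm (cmonomial m lam) \<le> norm (lam $ i) ^ m i"
      by (rule norm_cmonomial_le[OF lam])
    ultimately show False using K[of i] m by linarith
  qed
  then have "{m. norm (cmonomial m lam) \<ge> \<delta>} \<subseteq> (\<Pi>\<^sub>E i\<in>UNIV. {..<K i})" by (auto simp: PiE_def)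
  then show ?thesis by (rule finite_subset) (auto intro: finite_PiE)
qed

lemma cmonomial_nonzero: "(\<And>i. z $ i \<noteq> 0) \<Longrightarrow> cmonomial m z \<noteq> 0"
  by (auto simp: cmonomial_def)

lemma finite_eigenvalue:
  fixes lam :: "complex^'n::finite"
  assumes "\<And>i. norm (lam $ i) < 1" "c \<noteq> 0"
  shows "finite {m. cmonomial m lam = c}"
  by (rule finite_subset[OF _ finite_large_eigenvalues[OF assms(1), of "norm c"]]) (use assms in auto)

text \<open>Near the origin the power series of \<open>G\<close> and \<open>Q\<close> converge along the whole forward orbit of \<open>z\<close>, on which \<open>F\<close> is constant,
so the eigenvalues can be separated.  Every orbit enters this neighbourhood, and
both sides of the resulting equation are multiplied by \<open>c\<close> when \<open>z\<close> moves along its orbit.\<close>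

theorem invariant_eigen_quotient:
  fixes lam :: "complex^'n::finite"
  assumes lam: "\<And>i. 0 < norm (lam $ i)" "\<And>i. norm (lam $ i) < 1"
    and inv: "\<And>z. z \<in> U \<Longrightarrow> diag_map lam z \<in> U" "\<And>z. z \<in> U \<Longrightarrow> F (diag_map lam z) = F z"
    and e: "e > 0" and G: "line_holo G (ball 0 e)" and Q: "line_holo Q (ball 0 e)"
    and Q0: "w \<in> ball 0 e" "Q w \<noteq> 0"
    and FQ: "\<And>u. u \<in> U \<inter> ball 0 e \<Longrightarrow> F u * Q u = G u"
  shows "\<exists>c a b m0. c \<noteq> 0 \<and> cmonomial m0 lam = c \<and> b m0 \<noteq> 0 \<and>
      (\<forall>z\<in>U. F z * (\<Sum>m | cmonomial m lam = c. b m * cmonomial m z) = (\<Sum>m | cmonomial m lam = c. a m * cmonomial m z))"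
proof -
  obtain a r1 where r1: "0 < r1" "polydisc r1 \<subseteq> ball (0::complex^'n) e"
    and a: "\<And>z. z \<in> polydisc r1 \<Longrightarrow> ((\<lambda>m. a m * cmonomial m z) has_sum G z) UNIV"
    using power_series_at_0[OF G e] unfolding cmonomial_def by blast
  obtain b r2 where r2: "0 < r2" "polydisc r2 \<subseteq> ball (0::complex^'n) e"
    and b: "\<And>z. z \<in> polydisc r2 \<Longrightarrow> ((\<lambda>m. b m * cmonomial m z) has_sum Q z) UNIV"
    using power_series_at_0[OF Q e] unfolding cmonomial_def by blast
  have "\<exists>m0. b m0 \<noteq> 0"
  proof (rule ccontr)
    assume "\<not> ?thesis"
    then have "Q z = 0" if "z \<in> polydisc r2" for z
      using has_sum_unique[OF b[OF that], of 0] by simp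
    moreover have "0 \<in> (polydisc r2 :: (complex^'n) set)" using r2 by (auto simp: polydisc_def)
    then have "polydisc r2 \<noteq> ({} :: (complex^'n) set)" by blast
    ultimately have "Q w = 0"
      by (intro line_holo_identity[OF Q open_ball convex_ball open_polydisc _ r2(2) _ Q0(1)])
    with Q0 show False by simp
  qed
  then obtain m0 where m0: "b m0 \<noteq> 0" by blast
  define c where "c = cmonomial m0 lam"
  have lam0: "lam $ i \<noteq> 0" for i using lam(1)[of i] by auto
  have c: "c \<noteq> 0" unfolding c_def by (rule cmonomial_nonzero) (rule lam0)
  define r where "r = min r1 r2"
  have iter_U: "(diag_map lam ^^ k) z \<in> U" "F ((diag_map lam ^^ k) z) = F z" if "z \<in> U" for z k
  proof (induction k)
    case (Suc k)
    { case 1 show ?case using inv(1) Suc by simp }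
    { case 2 show ?case using inv(2) Suc by simp }
  qed (use that in auto)
  have iter_disc: "(diag_map lam ^^ k) z \<in> polydisc r" if "z \<in> polydisc r" for z k
  proof -
    have "norm (lam $ i ^ k * z $ i) < r" for i
    proof -
      have "norm (lam $ i ^ k * z $ i) \<le> 1 * norm (z $ i)"
        unfolding norm_mult norm_power
        using lam(2)[of i] by (intro mult_right_mono power_le_one) auto
      also have "\<dots> < r" using that by (simp add: polydisc_def)
      finally show ?thesis .
    qed
    then show ?thesis by (simp add: diag_iterate polydisc_def)
  qed
  let ?B = "\<lambda>z. \<Sum>m | cmonomial m lam = c. b m * cmonomial m z" and ?A = "\<lambda>z. \<Sum>m | cmonomial m lam = c. a m * cmonomial m z"
  have near: "F z * ?B z = ?A z" if z: "z \<in> U" "z \<in> polydisc r" for z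
  proof -
    have "((\<lambda>m. ((F z * b m - a m) * cmonomial m z) * cmonomial m lam ^ k) has_sum 0) UNIV" for k
    proof -
      let ?z = "(diag_map lam ^^ k) z"
      have z': "?z \<in> polydisc r1" "?z \<in> polydisc r2" "?z \<in> U \<inter> ball 0 e"
        using iter_disc[OF z(2), of k] iter_U(1)[OF z(1), of k] r2(2) by (auto simp: r_def polydisc_def)
      have "((\<lambda>m. F z * (b m * cmonomial m ?z) + (- 1) * (a m * cmonomial m ?z)) has_sum (F z * Q ?z + (- 1) * G ?z)) UNIV"
        by (intro has_sum_add has_sum_cmult_right a b z')
      moreover have "F z * Q ?z + (- 1) * G ?z = 0" using FQ[OF z'(3)] iter_U(2)[OF z(1), of k] by simp
      ultimately show ?thesis by (simp add: cmonomial_iterate algebra_simps)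
    qed
    then have "(\<Sum>m | m \<in> UNIV \<and> cmonomial m lam = c. (F z * b m - a m) * cmonomial m z) = 0"
      by (intro eigenvalue_separation[OF _ c]) (use finite_large_eigenvalues[OF lam(2)] in auto)
    then show ?thesis by (simp add: algebra_simps sum_subtractf sum_distrib_left)
  qed
  have "F z * ?B z = ?A z" if z: "z \<in> U" for z
  proof -
    have "\<forall>i. eventually (\<lambda>k. norm (lam $ i ^ k * z $ i) < r) sequentially"
    proof
      fix i
      have "(\<lambda>k. norm (lam $ i ^ k * z $ i)) \<longlonglongrightarrow> 0"
        using lam(2)[of i] by (intro tendsto_norm_zero tendsto_mult_left_zero LIMSEQ_power_zero) auto
      then show "eventually (\<lambda>k. norm (lam $ i ^ k * z $ i) < r) sequentially"
        by (rule order_tendstoD(2)) (use r1 r2 in \<open>auto simp: r_def\<close>)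
    qed
    then have "eventually (\<lambda>k. \<forall>i. norm (lam $ i ^ k * z $ i) < r) sequentially"
      by (simp add: eventually_all_finite)
    then obtain k where "\<forall>i. norm (lam $ i ^ k * z $ i) < r"
      using eventually_happens' sequentially_bot by blast
    then have "(diag_map lam ^^ k) z \<in> polydisc r" by (simp add: diag_iterate polydisc_def)
    from near[OF iter_U(1)[OF z] this]
    have "F z * (\<Sum>m | cmonomial m lam = c. c ^ k * (b m * cmonomial m z)) = (\<Sum>m | cmonomial m lam = c. c ^ k * (a m * cmonomial m z))"
      by (simp add: iter_U(2)[OF z] cmonomial_iterate mult_ac)
    then show ?thesis using c by (simp flip: sum_distrib_left)
  qed
  then show ?thesis using c m0 by (intro exI[of _ c] exI[of _ a] exI[of _ b] exI[of _ m0]) (auto simp: c_def)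
qed

section \<open>Lattices of multiplicative relations\<close>

definition int_span :: "nat \<Rightarrow> (nat \<Rightarrow> int^'n) \<Rightarrow> (nat \<Rightarrow> int) \<Rightarrow> int^'n" where
  "int_span r v a = (\<Sum>i<r. a i *s v i)"

text \<open>This quantitative form of linear independence over the integers is what the count of lattice points in a box needs.\<close>

definition bounded_coefficients :: "nat \<Rightarrow> (nat \<Rightarrow> int^'n) \<Rightarrow> int \<Rightarrow> bool" where
  "bounded_coefficients r v C \<longleftrightarrow>
     (\<forall>a N. (\<forall>j. \<bar>int_span r v a $ j\<bar> \<le> N) \<longrightarrow> (\<forall>i<r. \<bar>a i\<bar> \<le> C * N))"

lemma bounded_coefficientsD:
  "bounded_coefficients r v C \<Longrightarrow> (\<And>j. \<bar>int_span r v a $ j\<bar> \<le> N) \<Longrightarrow> i < r \<Longrightarrow> \<bar>a i\<bar> \<le> C * N"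
  by (simp add: bounded_coefficients_def)

lemma int_multiple_in_subgroup:
  fixes L :: "(int^'n) set"
  assumes L: "0 \<in> L" "\<And>x y. x \<in> L \<Longrightarrow> y \<in> L \<Longrightarrow> x - y \<in> L" and x: "x \<in> L"
  shows "k *s x \<in> L"
proof -
  have neg: "- y \<in> L" if "y \<in> L" for y using L(2)[OF L(1) that] by simp
  have "int j *s x \<in> L" for j
  proof (induction j)
    case 0
    then show ?case using L by simp
  next
    case (Suc j)
    have "int (Suc j) *s x = int j *s x - (- x)" by (simp add: vec_eq_iff algebra_simps)
    then show ?case using L(2)[OF Suc neg[OF x]] by metis
  qed
  moreover have "k *s x = - (int (nat (- k)) *s x)" if "k < 0" using that by (simp add: vec_eq_iff)
  moreover have "k *s x = int (nat k) *s x" if "\<not> k < 0" using that by simp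
  ultimately show ?thesis using neg by metis
qed

lemma int_span_in_subgroup:
  fixes L :: "(int^'n) set"
  assumes L: "0 \<in> L" "\<And>x y. x \<in> L \<Longrightarrow> y \<in> L \<Longrightarrow> x - y \<in> L" and v: "\<And>i. i < r \<Longrightarrow> v i \<in> L"
  shows "int_span r v a \<in> L"
  using v
proof (induction r)
  case 0
  then show ?case using L by (simp add: int_span_def)
next
  case (Suc r)
  have "int_span (Suc r) v a = int_span r v a - (- a r) *s v r"
    by (simp add: int_span_def vec_eq_iff)
  moreover have "(- a r) *s v r \<in> L" by (rule int_multiple_in_subgroup[OF L]) (use Suc in auto)
  ultimately show ?case using L(2) Suc by auto
qed

text \<open>Induction over the coordinates in which \<open>L\<close> can be nonzero: the \<open>j\<close>-th coordinates of \<open>L\<close> form a cyclic group, and a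
vector \<open>w\<close> that realises its generator \<open>d\<close> splits off.  The coefficient of \<open>w\<close> is read off from the \<open>j\<close>-th
coordinate, which bounds it.\<close>

lemma lattice_basis:
  fixes L :: "(int^'n::finite) set"
  assumes "finite J" and "0 \<in> L" "\<And>x y. x \<in> L \<Longrightarrow> y \<in> L \<Longrightarrow> x - y \<in> L"
    and "\<And>x i. x \<in> L \<Longrightarrow> i \<notin> J \<Longrightarrow> x $ i = 0"
  shows "\<exists>r v C. 0 \<le> C \<and> (\<forall>i<r. v i \<in> L) \<and> (\<forall>x\<in>L. \<exists>a. x = int_span r v a) \<and>
      bounded_coefficients r v C"
  using assms
proof (induction J arbitrary: L)
  case empty
  then have "\<And>x. x \<in> L \<Longrightarrow> x = 0" by (simp add: vec_eq_iff)
  then show ?case by (intro exI[of _ 0] exI[of _ "\<lambda>_. 0"]) (auto simp: int_span_def bounded_coefficients_def)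
next
  case (insert j J)
  show ?case
  proof (cases "\<forall>x\<in>L. x $ j = 0")
    case True
    have "x $ i = 0" if "x \<in> L" "i \<notin> J" for x i
      using True insert.prems(3)[OF that(1), of i] that by (cases "i = j") auto
    with insert.prems(1,2) show ?thesis by (intro insert.IH)
  next
    case False
    then obtain x0 where x0: "x0 \<in> L" "x0 $ j \<noteq> 0" by blast
    define P where "P = (\<lambda>d. d > 0 \<and> (\<exists>x\<in>L. x $ j = int d))"
    have "\<exists>d. P d"
    proof (cases "x0 $ j > 0")
      case True
      then show ?thesis using x0 by (intro exI[of _ "nat (x0 $ j)"]) (auto simp: P_def)
    next
      case False
      have "- x0 \<in> L" using insert.prems(2)[OF insert.prems(1) x0(1)] by simp
      then show ?thesis using False x0 by (intro exI[of _ "nat (- (x0 $ j))"]) (force simp: P_def)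
    qed
    define d where "d = (LEAST d. P d)"
    have Pd: "P d" unfolding d_def using \<open>\<exists>d. P d\<close> by (rule LeastI_ex)
    have dmin: "d \<le> d'" if "P d'" for d' unfolding d_def using that by (rule Least_le)
    obtain w where w: "w \<in> L" "w $ j = int d" using Pd by (auto simp: P_def)
    have d0: "d > 0" using Pd by (simp add: P_def)
    define L' where "L' = {x \<in> L. x $ j = 0}"
    have red: "x - (x $ j div int d) *s w \<in> L'" if x: "x \<in> L" for x
    proof -
      let ?y = "x - (x $ j div int d) *s w"
      have y: "?y \<in> L" using insert.prems(2)[OF x int_multiple_in_subgroup[OF insert.prems(1,2) w(1)]] .
      have yj: "?y $ j = x $ j mod int d" using w by (simp add: minus_div_mult_eq_mod)
      have "?y $ j = 0"
      proof (rule ccontr)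
        assume ne: "?y $ j \<noteq> 0"
        have "0 \<le> ?y $ j" "?y $ j < int d" unfolding yj using d0 by auto
        then have "P (nat (?y $ j))" using ne y unfolding P_def by (intro conjI bexI[of _ ?y]) auto
        from dmin[OF this] \<open>?y $ j < int d\<close> \<open>0 \<le> ?y $ j\<close> show False by linarith
      qed
      then show ?thesis using y by (simp add: L'_def)
    qed
    have L': "0 \<in> L'" "\<And>x y. x \<in> L' \<Longrightarrow> y \<in> L' \<Longrightarrow> x - y \<in> L'"
      using insert.prems by (auto simp: L'_def)
    have L'J: "x $ i = 0" if "x \<in> L'" "i \<notin> J" for x i
      using insert.prems(3)[of x i] that by (cases "i = j") (auto simp: L'_def)
    obtain r v C where C: "0 \<le> C" and v: "\<And>i. i < r \<Longrightarrow> v i \<in> L'" and gen: "\<And>x. x \<in> L' \<Longrightarrow> \<exists>a. x = int_span r v a"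
      and bd: "bounded_coefficients r v C"
      using insert.IH[OF L' L'J] by blast
    define V where "V = (\<Sum>k\<in>UNIV. \<bar>w $ k\<bar>)"
    have V: "\<bar>w $ k\<bar> \<le> V" for k unfolding V_def by (rule member_le_sum) auto
    have V0: "0 \<le> V" using V[of j] by linarith
    define v' where "v' = (\<lambda>i. if i = r then w else v i)"
    have span': "int_span (Suc r) v' a = int_span r v a + a r *s w" for a
      by (simp add: int_span_def v'_def)
    have "\<forall>i<Suc r. v' i \<in> L" using v w by (auto simp: v'_def L'_def less_Suc_eq)
    moreover have "\<exists>a. x = int_span (Suc r) v' a" if x: "x \<in> L" for x
    proof -
      obtain a where a: "x - (x $ j div int d) *s w = int_span r v a" using gen[OF red[OF x]] by blast
      have "int_span (Suc r) v' (a(r := x $ j div int d)) = int_span r v a + (x $ j div int d) *s w"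
        unfolding span' by (simp add: int_span_def)
      then show ?thesis using a by (metis diff_add_cancel)
    qed
    moreover have "\<bar>a i\<bar> \<le> (1 + C * (1 + V)) * N"
      if N: "\<forall>k. \<bar>int_span (Suc r) v' a $ k\<bar> \<le> N" and i: "i < Suc r" for a N i
    proof -
      have N0: "0 \<le> N" using N by (meson abs_ge_zero order_trans)
      have "int_span r v a \<in> L'" by (rule int_span_in_subgroup[OF L' v])
      then have "\<bar>a r\<bar> * int d \<le> N"
        using N[rule_format, of j] w by (simp add: span' L'_def abs_mult)
      moreover have "\<bar>a r\<bar> * 1 \<le> \<bar>a r\<bar> * int d" using d0 by (intro mult_left_mono) auto
      ultimately have ar: "\<bar>a r\<bar> \<le> N" by linarith
      have "\<bar>int_span r v a $ k\<bar> \<le> (1 + V) * N" for k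
      proof -
        have "int_span r v a $ k = int_span (Suc r) v' a $ k - a r * w $ k" by (simp add: span')
        moreover have "\<bar>a r * w $ k\<bar> \<le> N * V"
          unfolding abs_mult using ar V N0 by (intro mult_mono) auto
        ultimately have "\<bar>int_span r v a $ k\<bar> \<le> N + N * V" using N[rule_format, of k] by linarith
        then show ?thesis by (simp add: algebra_simps)
      qed
      then have "\<bar>a i\<bar> \<le> C * ((1 + V) * N)" if "i < r" using bounded_coefficientsD[OF bd] that by blast
      moreover have "0 \<le> C * ((1 + V) * N)" using C V0 N0 by simp
      ultimately show ?thesis using i ar N0 by (cases "i = r") (auto simp: algebra_simps less_Suc_eq)
    qed
    ultimately show ?thesis using C V0
      by (intro exI[of _ "Suc r"] exI[of _ v'] exI[of _ "1 + C * (1 + V)"]) (auto simp: bounded_coefficients_def)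
  qed
qed

lemma int_span_zero_coefficients:
  assumes bd: "bounded_coefficients r v C"
    and eq: "int_span r v a = int_span r v b" and i: "i < r"
  shows "a i = b i"
proof -
  have "int_span r v (\<lambda>i. a i - b i) = 0"
    using eq by (simp add: int_span_def vec_eq_iff algebra_simps sum_subtractf)
  then have "\<bar>a i - b i\<bar> \<le> C * 0" by (intro bounded_coefficientsD[OF bd _ i]) auto
  then show ?thesis by simp
qed

lemma free_rank_lattice:
  fixes L :: "(int^'n::finite) set"
  assumes L: "0 \<in> L" "\<And>x y. x \<in> L \<Longrightarrow> y \<in> L \<Longrightarrow> x - y \<in> L"
    and v: "\<And>i. i < r \<Longrightarrow> v i \<in> L" and gen: "\<And>x. x \<in> L \<Longrightarrow> \<exists>a. x = int_span r v a"
    and inj: "\<And>a b i. int_span r v a = int_span r v b \<Longrightarrow> i < r \<Longrightarrow> a i = b i"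
  shows "free_rank (int_vec_group\<lparr>carrier := L\<rparr>) = r"
proof -
  let ?K = "int_vec_group\<lparr>carrier := L\<rparr>" and ?A = "free_Abelian_group {..<r}"
  define \<phi> where "\<phi> = (\<lambda>f. int_span r v (Poly_Mapping.lookup f))"
  have "\<phi> \<in> iso ?A ?K"
  proof (rule isoI)
    show "\<phi> \<in> hom ?A ?K"
    proof (rule homI)
      show "\<phi> f \<in> carrier ?K" for f
        using int_span_in_subgroup[OF L v] by (simp add: \<phi>_def)
      show "\<phi> (f \<otimes>\<^bsub>?A\<^esub> g) = \<phi> f \<otimes>\<^bsub>?K\<^esub> \<phi> g" for f g
        by (simp add: \<phi>_def int_vec_group_def int_span_def vec_eq_iff lookup_add algebra_simps sum.distrib)
    qed
    show "bij_betw \<phi> (carrier ?A) (carrier ?K)"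
      unfolding bij_betw_def
    proof (intro conjI equalityI subsetI)
      show "inj_on \<phi> (carrier ?A)"
      proof (rule inj_onI)
        fix f g assume f: "f \<in> carrier ?A" and g: "g \<in> carrier ?A" and eq: "\<phi> f = \<phi> g"
        have "Poly_Mapping.lookup f i = Poly_Mapping.lookup g i" for i
        proof (cases "i < r")
          case True
          then show ?thesis using inj eq by (simp add: \<phi>_def)
        next
          case False
          then have "i \<notin> Poly_Mapping.keys f" "i \<notin> Poly_Mapping.keys g" using f g by auto
          then show ?thesis by (simp add: in_keys_iff)
        qed
        then show "f = g" by (simp add: poly_mapping_eqI)
      qed
      show "x \<in> carrier ?K" if "x \<in> \<phi> ` carrier ?A" for x
        using that int_span_in_subgroup[OF L v] by (auto simp: \<phi>_def)
      show "x \<in> \<phi> ` carrier ?A" if "x \<in> carrier ?K" for x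
      proof -
        from that have "x \<in> L" by simp
        then obtain a where a: "x = int_span r v a" using gen by blast
        define f where "f = Poly_Mapping.Abs_poly_mapping (\<lambda>i. if i < r then a i else 0)"
        have "finite {i. (if i < r then a i else 0) \<noteq> 0}" by (rule finite_subset[of _ "{..<r}"]) auto
        then have lf: "Poly_Mapping.lookup f = (\<lambda>i. if i < r then a i else 0)"
          unfolding f_def by (simp add: Abs_poly_mapping_inverse)
        then have "f \<in> carrier ?A" by (auto simp: in_keys_iff split: if_splits)
        moreover have "\<phi> f = x" by (simp add: \<phi>_def lf a int_span_def)
        ultimately show ?thesis by blast
      qed
    qed
  qed
  then have "?A \<cong> ?K" by (auto simp: is_iso_def)
  then have K: "?K \<cong> ?A" by (rule group.iso_sym[OF group_free_Abelian_group])
  have uniq: "r' = r" if "?K \<cong> free_Abelian_group {..<r'}" for r'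
  proof -
    have "?A \<cong> free_Abelian_group {..<r'}" using iso_trans[OF \<open>?A \<cong> ?K\<close> that] .
    then have "{..<r} \<approx> {..<r'}" by (simp add: isomorphic_free_Abelian_groups)
    then show ?thesis by (simp add: eqpoll_iff_card)
  qed
  show ?thesis unfolding free_rank_def by (rule the_equality, rule K, erule uniq)
qed

section \<open>Counting monomials\<close>

text \<open>If \<open>|\<lambda>\<^sub>i|\<^sup>K \<le> |c|\<close> for all \<open>i\<close>, then \<open>\<lambda>\<^sup>m = c\<^sup>N\<close> forces \<open>m\<^sub>i \<le> K N\<close>.  Two such exponents differ by
a lattice vector, whose \<open>r\<close> coefficients are of size \<open>O(N)\<close>.\<close>

lemma eigenvalue_count:
  fixes lam :: "complex^'n::finite"
  assumes lam: "\<And>i. 0 < norm (lam $ i)" "\<And>i. norm (lam $ i) < 1" and c: "c \<noteq> 0"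
    and C: "0 \<le> C" and gen: "\<And>x. psi lam x = 1 \<Longrightarrow> \<exists>a. x = int_span r v a"
    and bd: "bounded_coefficients r v C"
  shows "\<exists>T. \<forall>N. card {m. cmonomial m lam = c ^ N} \<le> (T * (N + 1)) ^ r"
proof -
  have "\<forall>i. \<exists>K. norm (lam $ i) ^ K < norm c"
    using lam c by (intro allI real_arch_pow_inv) auto
  then obtain k where k: "\<And>i. norm (lam $ i) ^ k i < norm c" by metis
  define K where "K = (\<Sum>i\<in>UNIV. k i)"
  have K: "norm (lam $ i) ^ K \<le> norm c" for i
  proof -
    have "k i \<le> K" unfolding K_def by (rule member_le_sum) auto
    then have "norm (lam $ i) ^ K \<le> norm (lam $ i) ^ k i"
      using lam[of i] by (intro power_decreasing) auto
    then show ?thesis using k[of i] by linarith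
  qed
  define D where "D = C * int K"
  have D0: "0 \<le> D" using C by (simp add: D_def)
  have "card {m. cmonomial m lam = c ^ N} \<le> (nat (2 * D + 1) * (N + 1)) ^ r" for N
  proof (cases "{m. cmonomial m lam = c ^ N} = {}")
    case False
    then obtain m0 where m0: "cmonomial m0 lam = c ^ N" by blast
    have small: "m i \<le> K * N" if m: "cmonomial m lam = c ^ N" for m i
    proof (rule ccontr)
      assume "\<not> m i \<le> K * N"
      then have "norm (lam $ i) ^ m i < norm (lam $ i) ^ (K * N)"
        using lam[of i] by (intro power_strict_decreasing) auto
      also have "\<dots> = (norm (lam $ i) ^ K) ^ N" by (simp add: power_mult)
      also have "\<dots> \<le> norm c ^ N" using K by (intro power_mono) auto
      also have "\<dots> = norm (cmonomial m lam)" using m by (simp add: norm_power)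
      also have "\<dots> \<le> norm (lam $ i) ^ m i" by (rule norm_cmonomial_le[OF lam(2)])
      finally show False by simp
    qed
    define diff :: "('n \<Rightarrow> nat) \<Rightarrow> int^'n" where "diff = (\<lambda>m. (\<chi> i. int (m i) - int (m0 i)))"
    have "\<exists>a. diff m = int_span r v a" if m: "cmonomial m lam = c ^ N" for m
    proof (rule gen)
      have lam0: "lam $ i \<noteq> 0" for i using lam(1)[of i] by auto
      have "psi lam (diff m) = psi lam (\<chi> i. int (m i)) / psi lam (\<chi> i. int (m0 i))"
        by (simp add: psi_def diff_def power_int_diff lam0 prod_dividef)
      also have "\<dots> = 1" using m m0 c by (simp flip: cmonomial_eq_psi)
      finally show "psi lam (diff m) = 1" .
    qed
    then obtain a where a: "\<And>m. cmonomial m lam = c ^ N \<Longrightarrow> diff m = int_span r v (a m)" by metis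
    define A where "A = (\<lambda>m. restrict (a m) {..<r})"
    have "inj_on A {m. cmonomial m lam = c ^ N}"
    proof (rule inj_onI)
      fix m m' assume m: "m \<in> {m. cmonomial m lam = c ^ N}" "m' \<in> {m. cmonomial m lam = c ^ N}" "A m = A m'"
      have "int_span r v (a m) = int_span r v (a m')"
        unfolding int_span_def
      proof (rule sum.cong)
        fix i assume "i \<in> {..<r}"
        then show "a m i *s v i = a m' i *s v i" using fun_cong[OF m(3), of i] by (simp add: A_def)
      qed simp
      then have "diff m = diff m'" using a m by simp
      then show "m = m'" by (simp add: diff_def vec_eq_iff fun_eq_iff)
    qed
    moreover have "A ` {m. cmonomial m lam = c ^ N} \<subseteq> (\<Pi>\<^sub>E i\<in>{..<r}. {- (D * int N)..D * int N})"
    proof clarify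
      fix m assume m: "cmonomial m lam = c ^ N"
      have "\<bar>a m i\<bar> \<le> C * (int K * int N)" if "i < r" for i
      proof (rule bounded_coefficientsD[OF bd _ that])
        fix j
        have "int (m j) \<le> int K * int N" "int (m0 j) \<le> int K * int N"
          using small[OF m, of j] small[OF m0, of j] by (simp_all flip: of_nat_mult)
        then show "\<bar>int_span r v (a m) $ j\<bar> \<le> int K * int N"
          unfolding a[OF m, symmetric] by (simp add: diff_def)
      qed
      then have "\<bar>a m i\<bar> \<le> D * int N" if "i < r" for i using that by (simp add: D_def mult_ac)
      then show "A m \<in> (\<Pi>\<^sub>E i\<in>{..<r}. {- (D * int N)..D * int N})"
        by (auto simp: A_def abs_le_iff minus_le_iff)
    qed
    ultimately have "card {m. cmonomial m lam = c ^ N} \<le> card (\<Pi>\<^sub>E i\<in>{..<r}. {- (D * int N)..D * int N})"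
      by (intro card_inj_on_le finite_PiE) auto
    also have "\<dots> = (nat (2 * (D * int N) + 1)) ^ r"
      by (simp add: card_PiE)
    also have "\<dots> \<le> (nat (2 * D + 1) * (N + 1)) ^ r"
    proof (rule power_mono)
      have "2 * (D * int N) + 1 \<le> (2 * D + 1) * (int N + 1)" using D0 by (simp add: algebra_simps)
      then have "nat (2 * (D * int N) + 1) \<le> nat ((2 * D + 1) * (int N + 1))" by (rule nat_mono)
      also have "\<dots> = nat (2 * D + 1) * (N + 1)"
        using D0 by (simp add: nat_mult_distrib nat_add_distrib)
      finally show "nat (2 * (D * int N) + 1) \<le> nat (2 * D + 1) * (N + 1)" .
    qed simp
    finally show ?thesis .
  qed auto
  then show ?thesis by blast
qed

section \<open>Algebraic dependence\<close>

text \<open>More unknowns than equations.\<close>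

lemma linear_dependence:
  fixes D :: "'a \<Rightarrow> 'm \<Rightarrow> 'k::field"
  assumes "finite M" "finite A" "card M < card A"
  shows "\<exists>d. (\<exists>\<alpha>\<in>A. d \<alpha> \<noteq> 0) \<and> (\<forall>m\<in>M. (\<Sum>\<alpha>\<in>A. d \<alpha> * D \<alpha> m) = 0)"
  using assms
proof (induction M arbitrary: A D)
  case empty
  then have "A \<noteq> {}" by auto
  then show ?case by (intro exI[of _ "\<lambda>_. 1"]) auto
next
  case (insert m M)
  show ?case
  proof (cases "\<forall>\<alpha>\<in>A. D \<alpha> m = 0")
    case True
    have "card M < card A" using insert by simp
    from insert.IH[OF insert.prems(1) this, of D] show ?thesis using True by auto
  next
    case False
    then obtain \<alpha>0 where \<alpha>0: "\<alpha>0 \<in> A" "D \<alpha>0 m \<noteq> 0" by blast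
    define D' where "D' = (\<lambda>\<alpha> m'. D \<alpha> m' - D \<alpha> m / D \<alpha>0 m * D \<alpha>0 m')"
    have "card M < card (A - {\<alpha>0})" using insert \<alpha>0 by simp
    from insert.IH[OF _ this, of D'] insert.prems obtain d where d: "\<exists>\<alpha>\<in>A - {\<alpha>0}. d \<alpha> \<noteq> 0"
      "\<And>m'. m' \<in> M \<Longrightarrow> (\<Sum>\<alpha>\<in>A - {\<alpha>0}. d \<alpha> * D' \<alpha> m') = 0" by auto
    define d' where "d' = d(\<alpha>0 := - (\<Sum>\<alpha>\<in>A - {\<alpha>0}. d \<alpha> * D \<alpha> m / D \<alpha>0 m))"
    have sum_eq: "(\<Sum>\<alpha>\<in>A. d' \<alpha> * D \<alpha> m') = (\<Sum>\<alpha>\<in>A - {\<alpha>0}. d \<alpha> * D' \<alpha> m')" for m'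
    proof -
      have "(\<Sum>\<alpha>\<in>A. d' \<alpha> * D \<alpha> m') = d' \<alpha>0 * D \<alpha>0 m' + (\<Sum>\<alpha>\<in>A - {\<alpha>0}. d \<alpha> * D \<alpha> m')"
        using insert.prems \<alpha>0 by (subst sum.remove[of _ \<alpha>0]) (auto simp: d'_def intro!: sum.cong)
      also have "\<dots> = (\<Sum>\<alpha>\<in>A - {\<alpha>0}. d \<alpha> * D' \<alpha> m')"
        by (simp add: d'_def D'_def algebra_simps sum_subtractf sum_distrib_left)
      finally show ?thesis .
    qed
    have "(\<Sum>\<alpha>\<in>A. d' \<alpha> * D \<alpha> m') = 0" if "m' \<in> insert m M" for m'
    proof (cases "m' = m")
      case True
      then show ?thesis unfolding sum_eq using \<alpha>0 by (simp add: D'_def)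
    next
      case False
      then show ?thesis unfolding sum_eq using d that by simp
    qed
    moreover have "\<exists>\<alpha>\<in>A. d' \<alpha> \<noteq> 0" using d(1) by (auto simp: d'_def)
    ultimately show ?thesis by blast
  qed
qed

definition eigenpolys :: "complex^'n::finite \<Rightarrow> complex \<Rightarrow> (complex^'n \<Rightarrow> complex) set" where
  "eigenpolys lam c = {g. \<exists>a. \<forall>z. g z = (\<Sum>m | cmonomial m lam = c. a m * cmonomial m z)}"

lemma cmonomial_add: "cmonomial (\<lambda>i. m i + m' i) z = cmonomial m z * cmonomial m' z"
  by (simp add: cmonomial_def power_add prod.distrib)

lemma eigenpolys_mult:
  fixes lam :: "complex^'n::finite"
  assumes lam: "\<And>i. norm (lam $ i) < 1" and c: "c \<noteq> 0" "c' \<noteq> 0"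
    and f: "f \<in> eigenpolys lam c" and g: "g \<in> eigenpolys lam c'"
  shows "(\<lambda>z. f z * g z) \<in> eigenpolys lam (c * c')"
proof -
  let ?M = "\<lambda>c. {m. cmonomial m lam = c}"
  have fin: "finite (?M c)" "finite (?M c')" "finite (?M (c * c'))"
    using finite_eigenvalue[OF lam] c by auto
  obtain a where a: "\<And>z. f z = (\<Sum>m\<in>?M c. a m * cmonomial m z)" using f by (auto simp: eigenpolys_def)
  obtain b where b: "\<And>z. g z = (\<Sum>m\<in>?M c'. b m * cmonomial m z)" using g by (auto simp: eigenpolys_def)
  let ?s = "\<lambda>p. (\<lambda>i. fst p i + snd p i)"
  define d where "d = (\<lambda>k. \<Sum>p\<in>{p \<in> ?M c \<times> ?M c'. ?s p = k}. a (fst p) * b (snd p))"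
  have "f z * g z = (\<Sum>k\<in>?M (c * c'). d k * cmonomial k z)" for z
  proof -
    have "f z * g z = (\<Sum>p\<in>?M c \<times> ?M c'. a (fst p) * b (snd p) * cmonomial (?s p) z)"
      unfolding a b sum_product sum.cartesian_product
      by (intro sum.cong) (auto simp: cmonomial_add mult_ac)
    also have "\<dots> = (\<Sum>k\<in>?M (c * c'). \<Sum>p\<in>{p \<in> ?M c \<times> ?M c'. ?s p = k}. a (fst p) * b (snd p) * cmonomial (?s p) z)"
      using fin by (intro sum.group[symmetric]) (auto simp: cmonomial_add)
    also have "\<dots> = (\<Sum>k\<in>?M (c * c'). d k * cmonomial k z)"
      unfolding d_def sum_distrib_right by (intro sum.cong) auto
    finally show ?thesis .
  qed
  then show ?thesis by (auto simp: eigenpolys_def)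
qed

lemma eigenpolys_one:
  fixes lam :: "complex^'n::finite"
  assumes lam: "\<And>i. norm (lam $ i) < 1"
  shows "(\<lambda>z. 1) \<in> eigenpolys lam 1"
proof -
  let ?M = "{m. cmonomial m lam = 1}"
  have fin: "finite ?M" using finite_eigenvalue[OF lam, of 1] by simp
  have "(\<Sum>m\<in>?M. (if m = (\<lambda>_. 0) then 1 else 0) * cmonomial m z) = 1" for z
  proof -
    have "(\<Sum>m\<in>?M. (if m = (\<lambda>_. 0) then 1 else 0) * cmonomial m z) = (\<Sum>m\<in>{(\<lambda>_. 0) :: 'n \<Rightarrow> nat}. 1)"
      by (rule sum.mono_neutral_cong_right[OF fin]) (auto simp: cmonomial_def)
    then show ?thesis by simp
  qed
  then show ?thesis
    unfolding eigenpolys_def by (intro CollectI exI[of _ "\<lambda>m. if m = (\<lambda>_. 0) then 1 else 0"]) simp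
qed

lemma eigenpolys_power:
  fixes lam :: "complex^'n::finite"
  assumes lam: "\<And>i. norm (lam $ i) < 1" and c: "c \<noteq> 0" and f: "f \<in> eigenpolys lam c"
  shows "(\<lambda>z. f z ^ k) \<in> eigenpolys lam (c ^ k)"
proof (induction k)
  case 0
  then show ?case using eigenpolys_one[OF lam] by simp
next
  case (Suc k)
  then show ?case using eigenpolys_mult[OF lam c _ f Suc] c by simp
qed

lemma eigenpolys_prod:
  fixes lam :: "complex^'n::finite"
  assumes lam: "\<And>i. norm (lam $ i) < 1" and I: "finite I" "\<And>i. i \<in> I \<Longrightarrow> c i \<noteq> 0"
    "\<And>i. i \<in> I \<Longrightarrow> f i \<in> eigenpolys lam (c i)"
  shows "(\<lambda>z. \<Prod>i\<in>I. f i z) \<in> eigenpolys lam (\<Prod>i\<in>I. c i)"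
  using I
proof (induction I)
  case empty
  then show ?case using eigenpolys_one[OF lam] by simp
next
  case (insert i I)
  then show ?case using eigenpolys_mult[OF lam, of "c i" "\<Prod>i\<in>I. c i" "f i" "\<lambda>z. \<Prod>i\<in>I. f i z"] by simp
qed

text \<open>Multiplied by \<open>\<Prod> B i ^ N\<close>, each monomial in the quotients \<open>A i / B i\<close> of degree at most \<open>N\<close> in each becomes a
polynomial with eigenvalue \<open>\<omega>\<^sup>N\<close>.  For \<open>N = T\<^sup>r\<close> there are more such monomials, namely
\<open>(N + 1)\<^bsup>card I\<^esup>\<close>, than the \<open>T\<^sup>r (N + 1)\<^sup>r\<close> exponents that the count allows.\<close>

theorem eigen_quotients_dependent:
  fixes lam :: "complex^'n::finite" and A B :: "'i \<Rightarrow> complex^'n \<Rightarrow> complex"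
  assumes lam: "\<And>i. 0 < norm (lam $ i)" "\<And>i. norm (lam $ i) < 1"
    and C: "0 \<le> C" and gen: "\<And>x. psi lam x = 1 \<Longrightarrow> \<exists>a. x = int_span r v a"
    and bd: "bounded_coefficients r v C"
    and I: "finite I" "r < card I" and c: "\<And>i. i \<in> I \<Longrightarrow> c i \<noteq> 0"
    and A: "\<And>i. i \<in> I \<Longrightarrow> A i \<in> eigenpolys lam (c i)" and B: "\<And>i. i \<in> I \<Longrightarrow> B i \<in> eigenpolys lam (c i)"
  shows "\<exists>N d. (\<exists>\<alpha>\<in>I \<rightarrow>\<^sub>E {..N::nat}. d \<alpha> \<noteq> 0) \<and>
    (\<forall>z f. (\<forall>i\<in>I. f i * B i z = A i z \<and> B i z \<noteq> 0) \<longrightarrow> (\<Sum>\<alpha>\<in>I \<rightarrow>\<^sub>E {..N}. d \<alpha> * (\<Prod>i\<in>I. f i ^ \<alpha> i)) = 0)"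
proof -
  define \<omega> where "\<omega> = (\<Prod>i\<in>I. c i)"
  have \<omega>: "\<omega> \<noteq> 0" using I c by (simp add: \<omega>_def)
  obtain T where T: "\<And>N. card {m. cmonomial m lam = \<omega> ^ N} \<le> (T * (N + 1)) ^ r"
    using eigenvalue_count[OF lam \<omega> C gen bd] by blast
  define N where "N = T ^ r"
  let ?M = "{m. cmonomial m lam = \<omega> ^ N}" and ?\<Lambda> = "I \<rightarrow>\<^sub>E {..N}"
  have "card ?M \<le> (T * (N + 1)) ^ r" by (rule T)
  also have "\<dots> = T ^ r * (N + 1) ^ r" by (rule power_mult_distrib)
  also have "\<dots> < (N + 1) * (N + 1) ^ r" by (simp add: N_def)
  also have "\<dots> \<le> (N + 1) ^ card I" using power_increasing[of "Suc r" "card I" "N + 1"] I by simp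
  also have "\<dots> = card ?\<Lambda>" using I by (simp add: card_PiE)
  finally have card: "card ?M < card ?\<Lambda>" .
  have "\<forall>\<alpha>\<in>?\<Lambda>. \<exists>a. \<forall>z. (\<Prod>i\<in>I. A i z ^ \<alpha> i * B i z ^ (N - \<alpha> i)) = (\<Sum>m\<in>?M. a m * cmonomial m z)"
  proof
    fix \<alpha> assume that: "\<alpha> \<in> ?\<Lambda>"
    have "(\<lambda>z. \<Prod>i\<in>I. A i z ^ \<alpha> i * B i z ^ (N - \<alpha> i)) \<in> eigenpolys lam (\<Prod>i\<in>I. c i ^ \<alpha> i * c i ^ (N - \<alpha> i))"
      by (intro eigenpolys_prod eigenpolys_mult eigenpolys_power lam I A B) (auto simp: c)
    moreover have "(\<Prod>i\<in>I. c i ^ \<alpha> i * c i ^ (N - \<alpha> i)) = \<omega> ^ N"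
      unfolding \<omega>_def prod_power_distrib
    proof (rule prod.cong)
      fix i assume "i \<in> I"
      then have "\<alpha> i \<le> N" using that by (auto dest: PiE_mem)
      then show "c i ^ \<alpha> i * c i ^ (N - \<alpha> i) = c i ^ N" by (simp flip: power_add)
    qed simp
    ultimately show "\<exists>a. \<forall>z. (\<Prod>i\<in>I. A i z ^ \<alpha> i * B i z ^ (N - \<alpha> i)) = (\<Sum>m\<in>?M. a m * cmonomial m z)"
      by (simp add: eigenpolys_def)
  qed
  from bchoice[OF this] obtain D where D0: "\<forall>\<alpha>\<in>?\<Lambda>. \<forall>z.
      (\<Prod>i\<in>I. A i z ^ \<alpha> i * B i z ^ (N - \<alpha> i)) = (\<Sum>m\<in>?M. D \<alpha> m * cmonomial m z)" by (elim exE)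
  have D: "(\<Prod>i\<in>I. A i z ^ \<alpha> i * B i z ^ (N - \<alpha> i)) = (\<Sum>m\<in>?M. D \<alpha> m * cmonomial m z)"
    if "\<alpha> \<in> ?\<Lambda>" for \<alpha> z using D0 that by blast
  have "finite ?M" using finite_eigenvalue[OF lam(2)] \<omega> by simp
  moreover have fin\<Lambda>: "finite ?\<Lambda>" using I by (intro finite_PiE) auto
  ultimately obtain d where d: "\<exists>\<alpha>\<in>?\<Lambda>. d \<alpha> \<noteq> 0" "\<And>m. m \<in> ?M \<Longrightarrow> (\<Sum>\<alpha>\<in>?\<Lambda>. d \<alpha> * D \<alpha> m) = 0"
    using linear_dependence[OF _ _ card, of D] by blast
  have "(\<Sum>\<alpha>\<in>?\<Lambda>. d \<alpha> * (\<Prod>i\<in>I. f i ^ \<alpha> i)) = 0" if f: "\<forall>i\<in>I. f i * B i z = A i z \<and> B i z \<noteq> 0" for z f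
  proof -
    have "(\<Prod>i\<in>I. B i z ^ N) * (\<Sum>\<alpha>\<in>?\<Lambda>. d \<alpha> * (\<Prod>i\<in>I. f i ^ \<alpha> i)) =
        (\<Sum>\<alpha>\<in>?\<Lambda>. d \<alpha> * (\<Prod>i\<in>I. A i z ^ \<alpha> i * B i z ^ (N - \<alpha> i)))"
      unfolding sum_distrib_left
    proof (rule sum.cong)
      fix \<alpha> assume \<alpha>: "\<alpha> \<in> ?\<Lambda>"
      have "(\<Prod>i\<in>I. A i z ^ \<alpha> i * B i z ^ (N - \<alpha> i)) = (\<Prod>i\<in>I. B i z ^ N * f i ^ \<alpha> i)"
      proof (rule prod.cong)
        fix i assume i: "i \<in> I"
        have "\<alpha> i \<le> N" using \<alpha> i by (auto dest: PiE_mem)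
        then have "B i z ^ N = B i z ^ \<alpha> i * B i z ^ (N - \<alpha> i)" by (simp flip: power_add)
        moreover have "A i z ^ \<alpha> i = f i ^ \<alpha> i * B i z ^ \<alpha> i" using f i by (simp flip: power_mult_distrib)
        ultimately show "A i z ^ \<alpha> i * B i z ^ (N - \<alpha> i) = B i z ^ N * f i ^ \<alpha> i" by simp
      qed simp
      then show "(\<Prod>i\<in>I. B i z ^ N) * (d \<alpha> * (\<Prod>i\<in>I. f i ^ \<alpha> i)) =
          d \<alpha> * (\<Prod>i\<in>I. A i z ^ \<alpha> i * B i z ^ (N - \<alpha> i))"
        by (simp add: prod.distrib)
    qed simp
    also have "\<dots> = (\<Sum>\<alpha>\<in>?\<Lambda>. \<Sum>m\<in>?M. d \<alpha> * (D \<alpha> m * cmonomial m z))"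
      by (simp add: D sum_distrib_left)
    also have "\<dots> = (\<Sum>m\<in>?M. \<Sum>\<alpha>\<in>?\<Lambda>. d \<alpha> * (D \<alpha> m * cmonomial m z))"
      by (rule sum.swap)
    also have "\<dots> = (\<Sum>m\<in>?M. (\<Sum>\<alpha>\<in>?\<Lambda>. d \<alpha> * D \<alpha> m) * cmonomial m z)"
      by (simp add: sum_distrib_right mult.assoc)
    also have "\<dots> = 0" using d(2) by simp
    finally show ?thesis using f I by auto
  qed
  then show ?thesis using d(1) by blast
qed

section \<open>The quotient map\<close>

lemma dense_Int_open:
  fixes A B S :: "'a::topological_space set"
  assumes "open S" "open A" "S \<subseteq> closure A" "S \<subseteq> closure B"
  shows "S \<subseteq> closure (A \<inter> B)"
proof
  fix x assume x: "x \<in> S"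
  show "x \<in> closure (A \<inter> B)"
    unfolding closure_iff_nhds_not_empty
  proof (intro allI impI)
    fix N V assume V: "V \<subseteq> N" "open V" "x \<in> V"
    have "x \<in> closure A" "open (V \<inter> S)" "x \<in> V \<inter> S" using x V assms by auto
    then obtain y where y: "y \<in> A" "y \<in> V \<inter> S" unfolding closure_iff_nhds_not_empty by blast
    have "y \<in> closure B" "open (A \<inter> (V \<inter> S))" "y \<in> A \<inter> (V \<inter> S)" using y assms V by auto
    then obtain u where "u \<in> B" "u \<in> A \<inter> (V \<inter> S)" unfolding closure_iff_nhds_not_empty by blast
    then show "A \<inter> B \<inter> N \<noteq> {}" using V by blast
  qed
qed

lemma holo_on_cong:
  assumes "\<And>z. z \<in> S \<Longrightarrow> f z = g z" "holo_on f S"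
  shows "holo_on g S"
  unfolding holo_on_def
proof (intro conjI ballI)
  show S: "open S" using assms by (simp add: holo_on_def)
  fix z assume z: "z \<in> S"
  then obtain D where D: "(f has_derivative D) (at z)" "\<forall>c v. D (c *s v) = c * D v"
    using assms(2) unfolding holo_on_def by blast
  have "(g has_derivative D) (at z)"
    by (rule has_derivative_transform_within_open[OF D(1) S z]) (use assms in auto)
  with D show "\<exists>D. (g has_derivative D) (at z) \<and> (\<forall>c v. D (c *s v) = c * D v)" by blast
qed

lemma holo_on_subset: "holo_on f S \<Longrightarrow> open T \<Longrightarrow> T \<subseteq> S \<Longrightarrow> holo_on f T"
  by (auto simp: holo_on_def)

lemma holo_on_locally:
  assumes "\<And>z. z \<in> S \<Longrightarrow> \<exists>T. z \<in> T \<and> T \<subseteq> S \<and> holo_on f T"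
  shows "holo_on f S"
  unfolding holo_on_def
proof (intro conjI ballI)
  show "open S"
    unfolding open_subopen[of S] using assms by (fastforce simp: holo_on_def)
  fix z assume "z \<in> S"
  then show "\<exists>D. (f has_derivative D) (at z) \<and> (\<forall>c v. D (c *s v) = c * D v)"
    using assms unfolding holo_on_def by blast
qed

lemma holo_on_const: "open S \<Longrightarrow> holo_on (\<lambda>_. c) S"
  unfolding holo_on_def by (intro conjI ballI exI[of _ "\<lambda>_. 0"]) auto

lemma holo_on_component: "open S \<Longrightarrow> holo_on (\<lambda>z. z $ i) S"
  unfolding holo_on_def
  by (intro conjI ballI exI[of _ "\<lambda>z. z $ i"])
     (auto intro!: bounded_linear_imp_has_derivative bounded_linear_vec_nth)

lemma holo_on_add: "holo_on f S \<Longrightarrow> holo_on g S \<Longrightarrow> holo_on (\<lambda>z. f z + g z) S"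
  unfolding holo_on_def
proof (elim conjE, intro conjI ballI)
  fix z assume z: "z \<in> S"
    and f: "\<forall>z\<in>S. \<exists>D. (f has_derivative D) (at z) \<and> (\<forall>c v. D (c *s v) = c * D v)"
    and g: "\<forall>z\<in>S. \<exists>D. (g has_derivative D) (at z) \<and> (\<forall>c v. D (c *s v) = c * D v)"
  obtain D where D: "(f has_derivative D) (at z)" "\<forall>c v. D (c *s v) = c * D v" using f z by blast
  obtain E where E: "(g has_derivative E) (at z)" "\<forall>c v. E (c *s v) = c * E v" using g z by blast
  show "\<exists>D. ((\<lambda>z. f z + g z) has_derivative D) (at z) \<and> (\<forall>c v. D (c *s v) = c * D v)"
    by (intro exI[of _ "\<lambda>v. D v + E v"] conjI has_derivative_add D(1) E(1))
       (use D(2) E(2) in \<open>simp add: algebra_simps\<close>)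
qed

lemma holo_on_mult: "holo_on f S \<Longrightarrow> holo_on g S \<Longrightarrow> holo_on (\<lambda>z. f z * g z) S"
  unfolding holo_on_def
proof (elim conjE, intro conjI ballI)
  fix z assume z: "z \<in> S"
    and f: "\<forall>z\<in>S. \<exists>D. (f has_derivative D) (at z) \<and> (\<forall>c v. D (c *s v) = c * D v)"
    and g: "\<forall>z\<in>S. \<exists>D. (g has_derivative D) (at z) \<and> (\<forall>c v. D (c *s v) = c * D v)"
  obtain D where D: "(f has_derivative D) (at z)" "\<forall>c v. D (c *s v) = c * D v" using f z by blast
  obtain E where E: "(g has_derivative E) (at z)" "\<forall>c v. E (c *s v) = c * E v" using g z by blast
  show "\<exists>D. ((\<lambda>z. f z * g z) has_derivative D) (at z) \<and> (\<forall>c v. D (c *s v) = c * D v)"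
    by (intro exI[of _ "\<lambda>v. f z * E v + D v * g z"] conjI has_derivative_mult D(1) E(1))
       (use D(2) E(2) in \<open>simp add: algebra_simps\<close>)
qed

lemma holo_on_inverse: "holo_on f S \<Longrightarrow> (\<And>z. z \<in> S \<Longrightarrow> f z \<noteq> 0) \<Longrightarrow> holo_on (\<lambda>z. inverse (f z)) S"
  unfolding holo_on_def
proof (elim conjE, intro conjI ballI)
  fix z assume z: "z \<in> S" and nz: "\<And>z. z \<in> S \<Longrightarrow> f z \<noteq> 0"
    and f: "\<forall>z\<in>S. \<exists>D. (f has_derivative D) (at z) \<and> (\<forall>c v. D (c *s v) = c * D v)"
  obtain D where D: "(f has_derivative D) (at z)" "\<forall>c v. D (c *s v) = c * D v" using f z by blast
  show "\<exists>D. ((\<lambda>z. inverse (f z)) has_derivative D) (at z) \<and> (\<forall>c v. D (c *s v) = c * D v)"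
    by (intro exI[of _ "\<lambda>v. - (inverse (f z) * D v * inverse (f z))"] conjI Deriv.has_derivative_inverse D(1) nz z)
       (use D(2) in \<open>simp add: algebra_simps\<close>)
qed

lemma holo_on_power: "holo_on f S \<Longrightarrow> holo_on (\<lambda>z. f z ^ k) S"
proof (induction k)
  case 0
  then have "open S" by (simp add: holo_on_def)
  then show ?case by (simp add: holo_on_const)
qed (auto intro: holo_on_mult)

lemma holo_on_prod: "open S \<Longrightarrow> (\<And>i. i \<in> I \<Longrightarrow> holo_on (f i) S) \<Longrightarrow> holo_on (\<lambda>z. \<Prod>i\<in>I. f i z) S"
  by (induction I rule: infinite_finite_induct) (auto intro!: holo_on_mult holo_on_const)

lemma holo_on_cmonomial: "open S \<Longrightarrow> holo_on (cmonomial m) S"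
  unfolding cmonomial_def[abs_def]
  by (intro holo_on_prod holo_on_power holo_on_component)

locale diagonal_hopf =
  fixes lam :: "complex^'n::finite"
  assumes lam_pos: "\<And>i. 0 < norm (lam $ i)" and lam_less_1: "\<And>i. norm (lam $ i) < 1"
begin

abbreviation "\<pi> \<equiv> hopf_proj lam"
abbreviation "X \<equiv> hopf_topology lam"
abbreviation "A \<equiv> hopf_atlas lam"
abbreviation "E \<equiv> UNIV - {0 :: complex^'n}"

definition act :: "int \<Rightarrow> complex^'n \<Rightarrow> complex^'n" where
  "act k z = (\<chi> i. lam $ i powi k * z $ i)"

definition pre :: "(complex^'n) set set \<Rightarrow> (complex^'n) set" where
  "pre U = {z \<in> E. \<pi> z \<in> U}"

lemma lam_nonzero: "lam $ i \<noteq> 0"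
  using lam_pos[of i] by auto

lemma act_0 [simp]: "act 0 z = z"
  by (simp add: act_def vec_eq_iff)

lemma act_act: "act j (act k z) = act (j + k) z"
  by (simp add: act_def vec_eq_iff power_int_add lam_nonzero)

lemma act_minus [simp]: "act (- k) (act k z) = z" "act k (act (- k) z) = z"
  by (simp_all add: act_act)

lemma act_nonzero [simp]: "act k z = 0 \<longleftrightarrow> z = 0"
  by (simp add: act_def vec_eq_iff lam_nonzero)

lemma act_nat: "(diag_map lam ^^ k) z = act (int k) z"
  by (simp add: diag_iterate act_def)

lemma mem_proj: "w \<in> \<pi> z \<longleftrightarrow> (\<exists>k. w = act k z)"
proof
  assume "w \<in> \<pi> z"
  then obtain k where "w = act (int k) z \<or> z = act (int k) w" by (auto simp: hopf_proj_def act_nat)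
  then show "\<exists>k. w = act k z" by (metis act_minus(1))
next
  assume "\<exists>k. w = act k z"
  then obtain k where k: "w = act k z" by blast
  show "w \<in> \<pi> z"
  proof (cases "k \<ge> 0")
    case True
    then have "w = (diag_map lam ^^ nat k) z" using k by (simp add: act_nat)
    then show ?thesis unfolding hopf_proj_def by blast
  next
    case False
    then have "z = (diag_map lam ^^ nat (- k)) w" using k by (simp add: act_nat)
    then show ?thesis unfolding hopf_proj_def by blast
  qed
qed

lemma proj_act [simp]: "\<pi> (act k z) = \<pi> z"
proof -
  have "(\<exists>j. w = act j (act k z)) \<longleftrightarrow> (\<exists>j. w = act j z)" for w
    by (metis act_act diff_add_cancel)
  then show ?thesis by (auto simp: mem_proj)
qed

lemma proj_eq_iff: "\<pi> z = \<pi> w \<longleftrightarrow> (\<exists>k. w = act k z)"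
proof
  assume "\<pi> z = \<pi> w"
  moreover have "w \<in> \<pi> w" unfolding mem_proj by (metis act_0)
  ultimately show "\<exists>k. w = act k z" by (simp flip: mem_proj)
qed auto

lemma open_act_vimage: "open V \<Longrightarrow> open (act k -` V)"
  unfolding act_def by (intro open_vimage continuous_intros) auto

lemma openin_iff: "openin X U \<longleftrightarrow> U \<subseteq> \<pi> ` E \<and> open (pre U)"
proof -
  have "open E" by auto
  then show ?thesis
    unfolding openin_hopf_topology pre_def by (simp add: openin_open_eq) blast
qed

lemma topspace_eq: "topspace X = \<pi> ` E"
proof
  have "openin X (\<pi> ` E)"
  proof -
    have "pre (\<pi> ` E) = E" by (auto simp: pre_def)
    moreover have "open E" by auto
    ultimately show ?thesis by (simp add: openin_iff)
  qed
  then show "\<pi> ` E \<subseteq> topspace X" by (rule openin_subset)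
  show "topspace X \<subseteq> \<pi> ` E" using openin_topspace[of X] unfolding openin_iff by blast
qed

lemma pre_proj: "V \<subseteq> E \<Longrightarrow> pre (\<pi> ` V) = (\<Union>k. act k -` V)"
proof (intro equalityI subsetI)
  fix z assume "V \<subseteq> E" "z \<in> pre (\<pi> ` V)"
  then obtain w where "w \<in> V" "\<pi> z = \<pi> w" by (auto simp: pre_def)
  then show "z \<in> (\<Union>k. act k -` V)" by (auto simp: proj_eq_iff)
next
  fix z assume V: "V \<subseteq> E" and "z \<in> (\<Union>k. act k -` V)"
  then obtain k where k: "act k z \<in> V" by auto
  then have "z \<noteq> 0" using V by auto
  moreover have "\<pi> z = \<pi> (act k z)" by simp
  ultimately show "z \<in> pre (\<pi> ` V)" using k unfolding pre_def by blast
qed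

lemma openin_proj: "open V \<Longrightarrow> V \<subseteq> E \<Longrightarrow> openin X (\<pi> ` V)"
  unfolding openin_iff by (auto simp: pre_proj intro: open_act_vimage)

lemma pre_act: "z \<in> pre U \<Longrightarrow> act k z \<in> pre U"
  by (simp add: pre_def)

lemma pre_diag_map: "z \<in> pre U \<Longrightarrow> diag_map lam z \<in> pre U" "\<pi> (diag_map lam z) = \<pi> z"
  using pre_act[of z U 1] proj_act[of 1 z] act_nat[of 1 z] by simp_all

lemma pre_Int: "pre (U \<inter> V) = pre U \<inter> pre V"
  by (auto simp: pre_def)

lemma pre_subset: "pre U \<subseteq> E"
  by (auto simp: pre_def)

lemma injective_neighbourhood:
  fixes z :: "complex^'n"
  assumes "z \<noteq> 0"
  obtains V where "open V" "z \<in> V" "V \<subseteq> E" "inj_on \<pi> V"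
proof -
  obtain i where i: "z $ i \<noteq> 0" using assms by (auto simp: vec_eq_iff)
  define c where "c = norm (lam $ i)"
  have c: "0 < c" "c < 1" using lam_pos lam_less_1 by (auto simp: c_def)
  define b where "b = 2 * norm (z $ i) / (1 + c)"
  (* the shell c b < |w_i| < b is so thin that it is disjoint from its images under all other powers of the contraction *)
  define V where "V = {w :: complex^'n. c * b < norm (w $ i) \<and> norm (w $ i) < b}"
  have b: "0 < b" using i c by (simp add: b_def)
  have "z \<in> V" using i c by (simp add: V_def b_def field_simps)
  moreover have "open V" unfolding V_def
    by (intro open_Collect_conj open_Collect_less continuous_intros)
  moreover have "V \<subseteq> E" using b c by (auto simp: V_def mult_less_0_iff)
  moreover have "inj_on \<pi> V"
  proof (rule inj_onI)
    have shift: False if "w \<in> V" "act k w \<in> V" "k > 0" for w k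
    proof -
      have "norm (act k w $ i) = c ^ nat k * norm (w $ i)"
        using that by (simp add: act_def norm_mult c_def norm_power power_int_def)
      also have "\<dots> \<le> c ^ 1 * norm (w $ i)"
        using c that by (intro mult_right_mono power_decreasing) auto
      also have "\<dots> < c * b" using c that by (simp add: V_def)
      finally show False using that by (simp add: V_def)
    qed
    fix w w' assume w: "w \<in> V" "w' \<in> V" "\<pi> w = \<pi> w'"
    then obtain k where k: "w' = act k w" by (auto simp: proj_eq_iff)
    then have "w = act (- k) w'" by simp
    then have "k = 0" using shift[of w k] shift[of w' "- k"] w k by (cases k "0::int" rule: linorder_cases) auto
    then show "w = w'" using k by simp
  qed
  ultimately show thesis using that by blast
qed

text \<open>The charts are local inverses of the covering map, so holomorphy in the charts is holomorphy of the pullback.\<close>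

lemma holomorphic_fun_iff: "holomorphic_fun X A U f \<longleftrightarrow> openin X U \<and> holo_on (f \<circ> \<pi>) (pre U)"
proof -
  have chart: "inv_into V \<pi> ` (U \<inter> \<pi> ` V) = pre U \<inter> V"
      "\<And>z. z \<in> V \<Longrightarrow> inv_into (\<pi> ` V) (inv_into V \<pi>) z = \<pi> z"
    if V: "V \<subseteq> E" "inj_on \<pi> V" for V
  proof -
    have [simp]: "inv_into V \<pi> (\<pi> z) = z" if "z \<in> V" for z using V that by simp
    show "inv_into V \<pi> ` (U \<inter> \<pi> ` V) = pre U \<inter> V"
    proof (intro equalityI subsetI)
      fix z assume "z \<in> inv_into V \<pi> ` (U \<inter> \<pi> ` V)"
      then show "z \<in> pre U \<inter> V" using V by (auto simp: pre_def)
    next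
      fix z assume z: "z \<in> pre U \<inter> V"
      then have "z = inv_into V \<pi> (\<pi> z)" "\<pi> z \<in> U \<inter> \<pi> ` V" by (auto simp: pre_def)
      then show "z \<in> inv_into V \<pi> ` (U \<inter> \<pi> ` V)" by blast
    qed
    have "inj_on (inv_into V \<pi>) (\<pi> ` V)" by (rule inj_on_inv_into) auto
    then show "inv_into (\<pi> ` V) (inv_into V \<pi>) z = \<pi> z" if "z \<in> V" for z
      using inv_into_f_f[of "inv_into V \<pi>" "\<pi> ` V" "\<pi> z"] that by simp
  qed
  show ?thesis
  proof
    assume h: "holomorphic_fun X A U f"
    have "holo_on (f \<circ> \<pi>) (pre U)"
    proof (rule holo_on_locally)
      fix z assume z: "z \<in> pre U"
      then have "z \<noteq> 0" using pre_subset by auto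
      then obtain V where V: "open V" "z \<in> V" "V \<subseteq> E" "inj_on \<pi> V" by (rule injective_neighbourhood)
      then have "(\<pi> ` V, inv_into V \<pi>) \<in> A" unfolding hopf_atlas_def by blast
      then have "holo_on (f \<circ> inv_into (\<pi> ` V) (inv_into V \<pi>)) (pre U \<inter> V)"
        using h chart(1)[OF V(3,4)] unfolding holomorphic_fun_def by fastforce
      then have "holo_on (f \<circ> \<pi>) (pre U \<inter> V)"
        by (rule holo_on_cong[rotated]) (use chart(2)[OF V(3,4)] in auto)
      then show "\<exists>T. z \<in> T \<and> T \<subseteq> pre U \<and> holo_on (f \<circ> \<pi>) T" using z V by blast
    qed
    then show "openin X U \<and> holo_on (f \<circ> \<pi>) (pre U)" using h by (simp add: holomorphic_fun_def)
  next
    assume h: "openin X U \<and> holo_on (f \<circ> \<pi>) (pre U)"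
    show "holomorphic_fun X A U f"
      unfolding holomorphic_fun_def
    proof (intro conjI ballI, goal_cases)
      case (2 x)
      then obtain V where x: "x = (\<pi> ` V, inv_into V \<pi>)" and V: "open V" "V \<subseteq> E" "inj_on \<pi> V"
        by (auto simp: hopf_atlas_def)
      have "holo_on (f \<circ> \<pi>) (pre U \<inter> V)"
        by (rule holo_on_subset) (use h V in \<open>auto simp: openin_iff\<close>)
      then have "holo_on (f \<circ> inv_into (\<pi> ` V) (inv_into V \<pi>)) (pre U \<inter> V)"
        by (rule holo_on_cong[rotated]) (use chart(2)[OF V(2,3)] in auto)
      then show ?case unfolding x by (simp add: chart(1)[OF V(2,3)])
    qed (use h in auto)
  qed
qed

lemma in_closure_of_iff:
  assumes z: "z \<noteq> 0"
  shows "\<pi> z \<in> X closure_of S \<longleftrightarrow> z \<in> closure (pre S)"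
proof
  assume h: "\<pi> z \<in> X closure_of S"
  show "z \<in> closure (pre S)"
    unfolding closure_iff_nhds_not_empty
  proof (intro allI impI)
    fix N V assume V: "V \<subseteq> N" "open V" "z \<in> V"
    have "openin X (\<pi> ` (V \<inter> E))" by (rule openin_proj) (use V in auto)
    moreover have "\<pi> z \<in> \<pi> ` (V \<inter> E)" using V z by blast
    moreover have "\<forall>T. \<pi> z \<in> T \<and> openin X T \<longrightarrow> (\<exists>y. y \<in> S \<and> y \<in> T)"
      using h by (simp add: in_closure_of)
    ultimately obtain y where "y \<in> S" "y \<in> \<pi> ` (V \<inter> E)" by meson
    then show "pre S \<inter> N \<noteq> {}" using V by (auto simp: pre_def)
  qed
next
  assume h: "z \<in> closure (pre S)"
  show "\<pi> z \<in> X closure_of S"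
    unfolding in_closure_of
  proof (intro conjI allI impI)
    show "\<pi> z \<in> topspace X" using z by (auto simp: topspace_eq)
    fix T assume T: "\<pi> z \<in> T \<and> openin X T"
    then have "open (pre T)" "z \<in> pre T" using z by (auto simp: openin_iff pre_def)
    then have "pre S \<inter> pre T \<noteq> {}" using h unfolding closure_iff_nhds_not_empty by blast
    then show "\<exists>y. y \<in> S \<and> y \<in> T" by (auto simp: pre_def)
  qed
qed

lemma dense_iff: "openin X U \<Longrightarrow> X closure_of U = topspace X \<longleftrightarrow> E \<subseteq> closure (pre U)"
proof -
  have "X closure_of U = topspace X \<longleftrightarrow> (\<forall>z\<in>E. \<pi> z \<in> X closure_of U)"
    using closure_of_subset_topspace[of X U] by (auto simp: topspace_eq)
  also have "\<dots> \<longleftrightarrow> E \<subseteq> closure (pre U)"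
    using in_closure_of_iff by auto
  finally show ?thesis by simp
qed

lemma relatively_dense_iff:
  assumes "openin X V"
  shows "V \<subseteq> X closure_of {x \<in> V. h x \<noteq> (0::complex)} \<longleftrightarrow> pre V \<subseteq> closure {z \<in> pre V. h (\<pi> z) \<noteq> 0}"
proof -
  have e0: "pre {x \<in> V. h x \<noteq> 0} = {z \<in> pre V. h (\<pi> z) \<noteq> 0}" by (auto simp: pre_def)
  have V: "\<pi> ` pre V = V" using assms by (auto simp: openin_iff pre_def)
  have e1: "V \<subseteq> X closure_of {x \<in> V. h x \<noteq> 0} \<longleftrightarrow> (\<forall>z\<in>pre V. \<pi> z \<in> X closure_of {x \<in> V. h x \<noteq> 0})"
    using image_subset_iff[of \<pi> "pre V" "X closure_of {x \<in> V. h x \<noteq> 0}"] unfolding V .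
  have e2: "\<dots> \<longleftrightarrow> (\<forall>z\<in>pre V. z \<in> closure (pre {x \<in> V. h x \<noteq> 0}))"
    using pre_subset by (intro ball_cong in_closure_of_iff) auto
  show ?thesis by (subst e1, subst e2, subst e0, subst subset_eq, rule refl)
qed

end

section \<open>Enlarging the domain of a meromorphic function\<close>

text \<open>The domain \<open>U\<close> of a representative may be needlessly small, for example omit a real hypersurface.  Taking
limits extends \<open>F\<close> to all points where some local denominator does not vanish.\<close>

lemma meromorphic_maximal_domain:
  fixes F :: "complex^'n \<Rightarrow> complex"
  assumes U: "open U" "UNIV - {0} \<subseteq> closure U" and F: "line_holo F U"
    and loc: "\<And>p. p \<noteq> 0 \<Longrightarrow> \<exists>V g h. open V \<and> p \<in> V \<and> line_holo g V \<and> line_holo h V \<and>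
        V \<subseteq> closure {z \<in> V. h z \<noteq> 0} \<and> (\<forall>z\<in>U \<inter> V. F z * h z = g z)"
  shows "\<exists>R F'. meromorphic_off_0 F' R \<and> U - {0} \<subseteq> R \<and> (\<forall>z\<in>U - {0}. F' z = F z)"
proof -
  have "\<exists>e>0. \<exists>g h. ball p e \<subseteq> - {0} \<and> line_holo g (ball p e) \<and> line_holo h (ball p e) \<and>
      ball p e \<subseteq> closure {z \<in> ball p e. h z \<noteq> 0} \<and> (\<forall>z\<in>U \<inter> ball p e. F z * h z = g z)" if p: "p \<noteq> 0" for p
  proof -
    obtain V g h where V: "open V" "p \<in> V" "line_holo g V" "line_holo h V"
      "V \<subseteq> closure {z \<in> V. h z \<noteq> 0}" "\<forall>z\<in>U \<inter> V. F z * h z = g z" using loc[OF p] by blast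
    have "open (V \<inter> - {0})" "p \<in> V \<inter> - {0}" using V p by auto
    then obtain e where e: "e > 0" "ball p e \<subseteq> V \<inter> - {0}" using open_contains_ball by blast
    have "ball p e \<subseteq> closure (ball p e \<inter> {z \<in> V. h z \<noteq> 0})"
      by (rule dense_Int_open[OF open_ball open_ball closure_subset]) (use e V in auto)
    moreover have "ball p e \<inter> {z \<in> V. h z \<noteq> 0} = {z \<in> ball p e. h z \<noteq> 0}" using e by auto
    ultimately have "ball p e \<subseteq> closure {z \<in> ball p e. h z \<noteq> 0}" by simp
    moreover have "line_holo g (ball p e)" "line_holo h (ball p e)"
      using V(3,4) e(2) line_holo_subset by blast+
    moreover have "\<forall>z\<in>U \<inter> ball p e. F z * h z = g z" using V(6) e(2) by blast
    ultimately show ?thesis using e by (intro exI[of _ e] conjI exI[of _ g] exI[of _ h]) auto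
  qed
  then have "\<forall>p\<in>- {0}. \<exists>e g h. e > 0 \<and> ball p e \<subseteq> - {0} \<and> line_holo g (ball p e) \<and> line_holo h (ball p e) \<and>
      ball p e \<subseteq> closure {z \<in> ball p e. h z \<noteq> 0} \<and> (\<forall>z\<in>U \<inter> ball p e. F z * h z = g z)"
    by blast
  then obtain e g h where egh: "\<forall>p\<in>- {0}. e p > 0 \<and> ball p (e p) \<subseteq> - {0} \<and>
      line_holo (g p) (ball p (e p)) \<and> line_holo (h p) (ball p (e p)) \<and>
      ball p (e p) \<subseteq> closure {z \<in> ball p (e p). h p z \<noteq> 0} \<and> (\<forall>z\<in>U \<inter> ball p (e p). F z * h p z = g p z)"
    unfolding bchoice_iff by blast
  have e: "\<And>p. p \<noteq> 0 \<Longrightarrow> e p > 0" "\<And>p. p \<noteq> 0 \<Longrightarrow> ball p (e p) \<subseteq> - {0}"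
    and g: "\<And>p. p \<noteq> 0 \<Longrightarrow> line_holo (g p) (ball p (e p))"
    and h: "\<And>p. p \<noteq> 0 \<Longrightarrow> line_holo (h p) (ball p (e p))"
    and hd: "\<And>p. p \<noteq> 0 \<Longrightarrow> ball p (e p) \<subseteq> closure {z \<in> ball p (e p). h p z \<noteq> 0}"
    and eq: "\<And>p z. p \<noteq> 0 \<Longrightarrow> z \<in> U \<Longrightarrow> z \<in> ball p (e p) \<Longrightarrow> F z * h p z = g p z"
    using egh by auto
  define F' where "F' = (\<lambda>z. Lim (at z within U) F)"
  have nontriv: "at z within U \<noteq> bot" if "z \<noteq> 0" for z
  proof -
    have "z islimpt U"
    proof (cases "z \<in> U")
      case True
      then show ?thesis using U(1) by (simp add: open_imp_islimpt)
    next
      case False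
      then show ?thesis using U(2) that by (auto simp: closure_def)
    qed
    then show ?thesis by (simp add: trivial_limit_within)
  qed
  have F'_U: "F' z = F z" if "z \<in> U" "z \<noteq> 0" for z
  proof -
    have "(F \<longlongrightarrow> F z) (at z within U)"
      using line_holo_continuous[OF F] that(1) by (simp add: continuous_on_def)
    then show ?thesis unfolding F'_def using nontriv[OF that(2)] by (intro tendsto_Lim) auto
  qed
  let ?N = "\<lambda>p. {z \<in> ball p (e p). h p z \<noteq> 0}"
  have N_open: "open (?N p)" if "p \<noteq> 0" for p
    by (rule open_nonzero[OF line_holo_continuous[OF h[OF that]] open_ball])
  have F'_N: "F' z = g p z / h p z" if p: "p \<noteq> 0" and z: "z \<in> ?N p" for p z
  proof -
    have "isCont (\<lambda>z. g p z / h p z) z"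
    proof -
      have "continuous_on (?N p) (\<lambda>z. g p z / h p z)"
        by (intro continuous_on_divide continuous_on_subset[OF line_holo_continuous[OF g[OF p]]]
            continuous_on_subset[OF line_holo_continuous[OF h[OF p]]]) auto
      then show ?thesis using z N_open[OF p] by (simp add: continuous_on_eq_continuous_at)
    qed
    then have "((\<lambda>z. g p z / h p z) \<longlongrightarrow> g p z / h p z) (at z within U)"
      unfolding isCont_def by (rule tendsto_within_subset) simp
    moreover have "eventually (\<lambda>z. g p z / h p z = F z) (at z within U)"
      unfolding eventually_at_topological
    proof (intro exI conjI ballI impI)
      show "open (?N p)" by (rule N_open[OF p])
      show "z \<in> ?N p" by (rule z)
      fix x assume "x \<in> ?N p" "x \<noteq> z" "x \<in> U"
      then show "g p x / h p x = F x" using eq[OF p, of x] by (auto simp: field_simps)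
    qed
    ultimately have "(F \<longlongrightarrow> g p z / h p z) (at z within U)" by (rule Lim_transform_eventually)
    moreover have "z \<noteq> 0" using z e(2)[OF p] by auto
    ultimately show ?thesis unfolding F'_def by (intro tendsto_Lim nontriv)
  qed
  define R where "R = (U - {0}) \<union> (\<Union>p\<in>- {0}. ?N p)"
  have R_open: "open R" unfolding R_def using U(1) N_open by (intro open_Un open_UN) auto
  have hol_U: "line_holo F' (U - {0})"
  proof -
    have "line_holo F (U - {0})" using F line_holo_subset by blast
    then show ?thesis using line_holo_cong[of "U - {0}" F' F] F'_U by blast
  qed
  have hol_N: "line_holo F' (?N p)" if p: "p \<noteq> 0" for p
  proof -
    have "line_holo (\<lambda>z. g p z / h p z) (?N p)"
      by (intro line_holo_divide line_holo_subset[OF g[OF p]] line_holo_subset[OF h[OF p]]) auto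
    then show ?thesis using line_holo_cong[of "?N p" F' "\<lambda>z. g p z / h p z"] F'_N[OF p] by blast
  qed
  have R_hol: "line_holo F' R"
  proof (rule line_holo_locally)
    fix z assume "z \<in> R"
    then consider "z \<in> U - {0}" | p where "p \<noteq> 0" "z \<in> ?N p" unfolding R_def by auto
    then show "\<exists>T. open T \<and> z \<in> T \<and> line_holo F' T"
    proof cases
      case 1
      then show ?thesis using hol_U U(1) by (intro exI[of _ "U - {0}"]) auto
    next
      case 2
      then show ?thesis using hol_N N_open by (intro exI[of _ "?N p"]) auto
    qed
  qed
  have eqR: "F' z * h p z = g p z" if p: "p \<noteq> 0" and z: "z \<in> R \<inter> ball p (e p)" for p z
  proof (rule ccontr)
    let ?S = "R \<inter> ball p (e p)"
    let ?d = "\<lambda>z. F' z * h p z - g p z"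
    assume ne: "F' z * h p z \<noteq> g p z"
    have "continuous_on ?S ?d"
      by (intro continuous_intros continuous_on_subset[OF line_holo_continuous[OF R_hol]]
          continuous_on_subset[OF line_holo_continuous[OF g[OF p]]]
          continuous_on_subset[OF line_holo_continuous[OF h[OF p]]]) auto
    then have "open {z \<in> ?S. ?d z \<noteq> 0}" using R_open by (intro open_nonzero) auto
    moreover have "z \<in> {z \<in> ?S. ?d z \<noteq> 0}" using z ne by simp
    moreover have "z \<in> closure (?N p)" using hd[OF p] z by blast
    ultimately obtain y where "y \<in> ?N p" "?d y \<noteq> 0"
      unfolding closure_iff_nhds_not_empty by blast
    then show False using F'_N[OF p] by simp
  qed
  have "meromorphic_off_0 F' R"
    unfolding meromorphic_off_0_def
  proof (intro conjI allI impI R_open R_hol)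
    fix p :: "complex^'n" assume p: "p \<noteq> 0"
    have "?N p \<subseteq> R" unfolding R_def using p by blast
    then show "\<exists>e>0. \<exists>g h. line_holo g (ball p e) \<and> line_holo h (ball p e) \<and>
        ball p e \<subseteq> closure {z \<in> ball p e. h z \<noteq> 0} \<and> {z \<in> ball p e. h z \<noteq> 0} \<subseteq> R \<and>
        (\<forall>z\<in>R \<inter> ball p e. F' z * h z = g z)"
      using e(1)[OF p] g[OF p] h[OF p] hd[OF p] eqR[OF p]
      by (intro exI[of _ "e p"] conjI exI[of _ "g p"] exI[of _ "h p"]) auto
  qed
  moreover have "U - {0} \<subseteq> R" unfolding R_def by blast
  ultimately show ?thesis using F'_U
    by (intro exI[of _ R] exI[of _ F']) auto
qed

section \<open>The field of meromorphic functions\<close>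

context diagonal_hopf
begin

abbreviation "Rep \<equiv> mero_rep X A"
abbreviation "Rel \<equiv> mero_rel X A"
abbreviation "M \<equiv> mero_field X A"

definition cls :: "(complex^'n) set set \<Rightarrow> ((complex^'n) set \<Rightarrow> complex) \<Rightarrow>
    ((complex^'n) set set \<times> ((complex^'n) set \<Rightarrow> complex)) set" where
  "cls U f = Rel `` {(U, f)}"

definition dense_open :: "(complex^'n) set set \<Rightarrow> bool" where
  "dense_open U \<longleftrightarrow> openin X U \<and> E \<subseteq> closure (pre U)"

lemma holo_on_continuous: "holo_on f S \<Longrightarrow> continuous_on S f"
  by (intro line_holo_continuous holo_on_imp_line_holo)

lemma dense_open_topspace: "dense_open (topspace X)"
proof -
  have "pre (topspace X) = E" by (auto simp: topspace_eq pre_def)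
  then show ?thesis using closure_subset by (auto simp: dense_open_def)
qed

lemma dense_open_Int: "dense_open U \<Longrightarrow> dense_open V \<Longrightarrow> dense_open (U \<inter> V)"
proof -
  assume U: "dense_open U" and V: "dense_open V"
  have "open E" by auto
  then have "E \<subseteq> closure (pre U \<inter> pre V)"
    by (rule dense_Int_open) (use U V in \<open>auto simp: dense_open_def openin_iff\<close>)
  then show ?thesis using U V by (auto simp: dense_open_def pre_Int)
qed

lemma mero_rep_iff:
  "(U, f) \<in> Rep \<longleftrightarrow> dense_open U \<and> holo_on (f \<circ> \<pi>) (pre U) \<and>
     (\<forall>p\<in>topspace X. \<exists>V g h. p \<in> V \<and> holomorphic_fun X A V g \<and> holomorphic_fun X A V h \<and>
        pre V \<subseteq> closure {z \<in> pre V. h (\<pi> z) \<noteq> 0} \<and> (\<forall>x\<in>U \<inter> V. f x * h x = g x))"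
proof -
  have *: "V \<subseteq> X closure_of {x \<in> V. h x \<noteq> 0} \<longleftrightarrow> pre V \<subseteq> closure {z \<in> pre V. h (\<pi> z) \<noteq> 0}"
    if "holomorphic_fun X A V h" for V h
    using that by (intro relatively_dense_iff) (simp add: holomorphic_fun_def)
  have **: "(\<exists>V g h. p \<in> V \<and> holomorphic_fun X A V g \<and> holomorphic_fun X A V h \<and>
        V \<subseteq> X closure_of {x \<in> V. h x \<noteq> 0} \<and> (\<forall>x\<in>U \<inter> V. f x * h x = g x)) \<longleftrightarrow>
      (\<exists>V g h. p \<in> V \<and> holomorphic_fun X A V g \<and> holomorphic_fun X A V h \<and>
        pre V \<subseteq> closure {z \<in> pre V. h (\<pi> z) \<noteq> 0} \<and> (\<forall>x\<in>U \<inter> V. f x * h x = g x))" for p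
    by (intro ex_cong1 conj_cong refl *)
  have h: "(holomorphic_fun X A U f \<and> X closure_of U = topspace X) =
      (dense_open U \<and> holo_on (f \<circ> \<pi>) (pre U))"
    unfolding holomorphic_fun_iff dense_open_def using dense_iff by blast
  have "((holomorphic_fun X A U f \<and> X closure_of U = topspace X) \<and> R) =
      ((dense_open U \<and> holo_on (f \<circ> \<pi>) (pre U)) \<and> R)" for R
    by (simp only: h)
  then show ?thesis
    unfolding mero_rep_def by (simp only: mem_Collect_eq case_prod_conv ** conj_assoc)
qed

lemma holomorphic_fun_restrict:
  "holomorphic_fun X A V f \<Longrightarrow> openin X W \<Longrightarrow> W \<subseteq> V \<Longrightarrow> holomorphic_fun X A W f"
  unfolding holomorphic_fun_iff
  by (auto intro: holo_on_subset simp: openin_iff pre_def)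

lemma holomorphic_fun_mult:
  "holomorphic_fun X A V f \<Longrightarrow> holomorphic_fun X A V g \<Longrightarrow> holomorphic_fun X A V (\<lambda>x. f x * g x)"
  unfolding holomorphic_fun_iff using holo_on_mult[of "f \<circ> \<pi>" "pre V" "g \<circ> \<pi>"] by (simp add: o_def)

lemma holomorphic_fun_add:
  "holomorphic_fun X A V f \<Longrightarrow> holomorphic_fun X A V g \<Longrightarrow> holomorphic_fun X A V (\<lambda>x. f x + g x)"
  unfolding holomorphic_fun_iff using holo_on_add[of "f \<circ> \<pi>" "pre V" "g \<circ> \<pi>"] by (simp add: o_def)

lemma holomorphic_fun_const: "openin X V \<Longrightarrow> holomorphic_fun X A V (\<lambda>_. c)"
  unfolding holomorphic_fun_iff by (simp add: o_def holo_on_const openin_iff)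

lemma rep_const: "dense_open U \<Longrightarrow> (U, \<lambda>_. c) \<in> Rep"
  unfolding mero_rep_iff
proof (intro conjI ballI)
  assume U: "dense_open U"
  then show "holo_on ((\<lambda>_. c) \<circ> \<pi>) (pre U)" by (simp add: o_def holo_on_const dense_open_def openin_iff)
  fix p assume "p \<in> topspace X"
  then show "\<exists>V g h. p \<in> V \<and> holomorphic_fun X A V g \<and> holomorphic_fun X A V h \<and>
      pre V \<subseteq> closure {z \<in> pre V. h (\<pi> z) \<noteq> 0} \<and> (\<forall>x\<in>U \<inter> V. c * h x = g x)"
    by (intro exI[of _ "topspace X"] exI[of _ "\<lambda>_. c"] exI[of _ "\<lambda>_. 1"])
       (auto intro!: holomorphic_fun_const simp: closure_subset)
qed

lemma rep_restrict:
  assumes f: "(U, f) \<in> Rep" and U': "dense_open U'" "U' \<subseteq> U"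
  shows "(U', f) \<in> Rep"
  unfolding mero_rep_iff
proof (intro conjI ballI)
  show "dense_open U'" by (rule U')
  have "holo_on (f \<circ> \<pi>) (pre U)" using f by (simp add: mero_rep_iff)
  then show "holo_on (f \<circ> \<pi>) (pre U')"
    by (rule holo_on_subset) (use U' in \<open>auto simp: dense_open_def openin_iff pre_def\<close>)
  fix p assume "p \<in> topspace X"
  then obtain V g h where "p \<in> V" "holomorphic_fun X A V g" "holomorphic_fun X A V h"
      "pre V \<subseteq> closure {z \<in> pre V. h (\<pi> z) \<noteq> 0}" and eq: "\<forall>x\<in>U \<inter> V. f x * h x = g x"
    using f unfolding mero_rep_iff by blast
  moreover have "\<forall>x\<in>U' \<inter> V. f x * h x = g x" using eq U'(2) by blast
  ultimately show "\<exists>V g h. p \<in> V \<and> holomorphic_fun X A V g \<and> holomorphic_fun X A V h \<and>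
      pre V \<subseteq> closure {z \<in> pre V. h (\<pi> z) \<noteq> 0} \<and> (\<forall>x\<in>U' \<inter> V. f x * h x = g x)"
    by (intro exI[of _ V] exI[of _ g] exI[of _ h] conjI)
qed

text \<open>The two local denominators are made simultaneously non-degenerate; this is what sums and products need.\<close>

lemma rep_local_pair:
  assumes "(U, f) \<in> Rep" "(V, k) \<in> Rep" "p \<in> topspace X"
  obtains W a b c d where "p \<in> W" "holomorphic_fun X A W a" "holomorphic_fun X A W b"
    "holomorphic_fun X A W c" "holomorphic_fun X A W d"
    "pre W \<subseteq> closure {z \<in> pre W. b (\<pi> z) * d (\<pi> z) \<noteq> 0}"
    "\<And>x. x \<in> U \<inter> W \<Longrightarrow> f x * b x = a x" "\<And>x. x \<in> V \<inter> W \<Longrightarrow> k x * d x = c x"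
proof -
  obtain W1 a b where 1: "p \<in> W1" "holomorphic_fun X A W1 a" "holomorphic_fun X A W1 b"
      "pre W1 \<subseteq> closure {z \<in> pre W1. b (\<pi> z) \<noteq> 0}" "\<forall>x\<in>U \<inter> W1. f x * b x = a x"
    using assms(1,3) unfolding mero_rep_iff by blast
  obtain W2 c d where 2: "p \<in> W2" "holomorphic_fun X A W2 c" "holomorphic_fun X A W2 d"
      "pre W2 \<subseteq> closure {z \<in> pre W2. d (\<pi> z) \<noteq> 0}" "\<forall>x\<in>V \<inter> W2. k x * d x = c x"
    using assms(2,3) unfolding mero_rep_iff by blast
  define W where "W = W1 \<inter> W2"
  have W: "openin X W" "W \<subseteq> W1" "W \<subseteq> W2" using 1 2 by (auto simp: W_def holomorphic_fun_def)
  let ?B = "{z \<in> pre W1. b (\<pi> z) \<noteq> 0}" and ?D = "{z \<in> pre W2. d (\<pi> z) \<noteq> 0}"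
  have "open ?B" "open ?D"
  proof -
    have "open {z \<in> pre V. h (\<pi> z) \<noteq> 0}" if "holomorphic_fun X A V h" for V h
    proof -
      have "continuous_on (pre V) (h \<circ> \<pi>)" "open (pre V)"
        using that holo_on_continuous[of "h \<circ> \<pi>"] unfolding holomorphic_fun_iff openin_iff by blast+
      from open_nonzero[OF this] show ?thesis by (simp add: o_def)
    qed
    with 1(3) 2(3) show "open ?B" "open ?D" by blast+
  qed
  have oW: "open (pre W)" using W by (simp add: openin_iff)
  have sW: "pre W \<subseteq> pre W1" "pre W \<subseteq> pre W2" by (auto simp: W_def pre_def)
  have "pre W \<subseteq> closure (?B \<inter> ?D)"
    by (rule dense_Int_open[OF oW \<open>open ?B\<close>]) (use 1(4) 2(4) sW in auto)
  moreover have "?B \<inter> ?D = {z \<in> pre W. b (\<pi> z) * d (\<pi> z) \<noteq> 0}"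
    by (auto simp: W_def pre_def)
  ultimately have dense: "pre W \<subseteq> closure {z \<in> pre W. b (\<pi> z) * d (\<pi> z) \<noteq> 0}" by simp
  have "p \<in> W" using 1(1) 2(1) by (simp add: W_def)
  moreover have "f x * b x = a x" if "x \<in> U \<inter> W" for x using 1(5) that W(2) by blast
  moreover have "k x * d x = c x" if "x \<in> V \<inter> W" for x using 2(5) that W(3) by blast
  ultimately show thesis
    using holomorphic_fun_restrict[OF 1(2) W(1,2)] holomorphic_fun_restrict[OF 1(3) W(1,2)]
      holomorphic_fun_restrict[OF 2(2) W(1,3)] holomorphic_fun_restrict[OF 2(3) W(1,3)] dense
    by (intro that[of W a b c d])
qed

lemma rep_mult:
  assumes f: "(U, f) \<in> Rep" and g: "(V, g) \<in> Rep"
  shows "(U \<inter> V, \<lambda>x. f x * g x) \<in> Rep"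
  unfolding mero_rep_iff
proof (intro conjI ballI)
  show UV: "dense_open (U \<inter> V)" using f g by (auto simp: mero_rep_iff intro: dense_open_Int)
  have "holo_on (f \<circ> \<pi>) (pre (U \<inter> V))" "holo_on (g \<circ> \<pi>) (pre (U \<inter> V))"
    using f g UV by (auto simp: mero_rep_iff dense_open_def openin_iff pre_Int intro: holo_on_subset)
  from holo_on_mult[OF this] show "holo_on ((\<lambda>x. f x * g x) \<circ> \<pi>) (pre (U \<inter> V))" by (simp add: o_def)
  fix p assume p: "p \<in> topspace X"
  obtain W a b c d where *: "p \<in> W" "holomorphic_fun X A W a" "holomorphic_fun X A W b"
    "holomorphic_fun X A W c" "holomorphic_fun X A W d"
    "pre W \<subseteq> closure {z \<in> pre W. b (\<pi> z) * d (\<pi> z) \<noteq> 0}"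
    "\<And>x. x \<in> U \<inter> W \<Longrightarrow> f x * b x = a x" "\<And>x. x \<in> V \<inter> W \<Longrightarrow> g x * d x = c x"
    by (rule rep_local_pair[OF f g p]) blast
  have "\<forall>x\<in>U \<inter> V \<inter> W. f x * g x * (b x * d x) = a x * c x"
  proof
    fix x assume "x \<in> U \<inter> V \<inter> W"
    then have "f x * b x = a x" "g x * d x = c x" using * by auto
    then show "f x * g x * (b x * d x) = a x * c x" by (metis mult.assoc mult.left_commute)
  qed
  then show "\<exists>W a b. p \<in> W \<and> holomorphic_fun X A W a \<and> holomorphic_fun X A W b \<and>
      pre W \<subseteq> closure {z \<in> pre W. b (\<pi> z) \<noteq> 0} \<and> (\<forall>x\<in>U \<inter> V \<inter> W. f x * g x * b x = a x)"
    using * by (intro exI[of _ W] exI[of _ "\<lambda>x. a x * c x"] exI[of _ "\<lambda>x. b x * d x"] conjI holomorphic_fun_mult)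
qed

lemma rep_add:
  assumes f: "(U, f) \<in> Rep" and g: "(V, g) \<in> Rep"
  shows "(U \<inter> V, \<lambda>x. f x + g x) \<in> Rep"
  unfolding mero_rep_iff
proof (intro conjI ballI)
  show UV: "dense_open (U \<inter> V)" using f g by (auto simp: mero_rep_iff intro: dense_open_Int)
  have "holo_on (f \<circ> \<pi>) (pre (U \<inter> V))" "holo_on (g \<circ> \<pi>) (pre (U \<inter> V))"
    using f g UV by (auto simp: mero_rep_iff dense_open_def openin_iff pre_Int intro: holo_on_subset)
  from holo_on_add[OF this] show "holo_on ((\<lambda>x. f x + g x) \<circ> \<pi>) (pre (U \<inter> V))" by (simp add: o_def)
  fix p assume p: "p \<in> topspace X"
  obtain W a b c d where *: "p \<in> W" "holomorphic_fun X A W a" "holomorphic_fun X A W b"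
    "holomorphic_fun X A W c" "holomorphic_fun X A W d"
    "pre W \<subseteq> closure {z \<in> pre W. b (\<pi> z) * d (\<pi> z) \<noteq> 0}"
    "\<And>x. x \<in> U \<inter> W \<Longrightarrow> f x * b x = a x" "\<And>x. x \<in> V \<inter> W \<Longrightarrow> g x * d x = c x"
    by (rule rep_local_pair[OF f g p]) blast
  have "\<forall>x\<in>U \<inter> V \<inter> W. (f x + g x) * (b x * d x) = a x * d x + b x * c x"
  proof
    fix x assume "x \<in> U \<inter> V \<inter> W"
    then have "a x = f x * b x" "c x = g x * d x" using *(7,8) by auto
    then show "(f x + g x) * (b x * d x) = a x * d x + b x * c x" by (simp add: algebra_simps)
  qed
  then show "\<exists>W a b. p \<in> W \<and> holomorphic_fun X A W a \<and> holomorphic_fun X A W b \<and>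
      pre W \<subseteq> closure {z \<in> pre W. b (\<pi> z) \<noteq> 0} \<and> (\<forall>x\<in>U \<inter> V \<inter> W. (f x + g x) * b x = a x)"
    using * by (intro exI[of _ W] exI[of _ "\<lambda>x. a x * d x + b x * c x"] exI[of _ "\<lambda>x. b x * d x"]
        conjI holomorphic_fun_mult holomorphic_fun_add)
qed

lemma rel_iff: "((U, f), (V, g)) \<in> Rel \<longleftrightarrow> (U, f) \<in> Rep \<and> (V, g) \<in> Rep \<and> (\<forall>x\<in>U \<inter> V. f x = g x)"
  by (simp add: mero_rel_def)

lemma agree_on_dense:
  assumes f: "(U, f) \<in> Rep" and g: "(W, g) \<in> Rep" and V: "dense_open V"
    and eq: "\<And>x. x \<in> U \<inter> W \<inter> V \<Longrightarrow> f x = g x" and x: "x \<in> U \<inter> W"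
  shows "f x = g x"
proof (rule ccontr)
  assume ne: "f x \<noteq> g x"
  let ?S = "pre (U \<inter> W)"
  have S: "open ?S" using f g by (simp add: mero_rep_iff dense_open_def openin_iff pre_Int open_Int)
  have "x \<in> topspace X" using x f by (auto simp: mero_rep_iff dense_open_def dest: openin_subset)
  then obtain z where z: "z \<in> E" "x = \<pi> z" by (auto simp: topspace_eq)
  have "continuous_on (pre U) (f \<circ> \<pi>)" "continuous_on (pre W) (g \<circ> \<pi>)"
    using f g holo_on_continuous unfolding mero_rep_iff by blast+
  then have "continuous_on ?S (\<lambda>z. f (\<pi> z) - g (\<pi> z))"
    unfolding o_def by (intro continuous_on_diff) (auto elim: continuous_on_subset simp: pre_Int)
  then have "open {z \<in> ?S. f (\<pi> z) - g (\<pi> z) \<noteq> 0}" using S by (rule open_nonzero)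
  moreover have "z \<in> {z \<in> ?S. f (\<pi> z) - g (\<pi> z) \<noteq> 0}" using z x ne by (simp add: pre_def)
  moreover have "z \<in> closure (pre V)" using V z by (auto simp: dense_open_def)
  ultimately obtain y where "y \<in> pre V" "y \<in> ?S" "f (\<pi> y) - g (\<pi> y) \<noteq> 0"
    unfolding closure_iff_nhds_not_empty by blast
  then show False using eq[of "\<pi> y"] by (auto simp: pre_def)
qed

lemma rel_equiv: "equiv Rep Rel"
proof (rule equivI)
  show "Rel \<subseteq> Rep \<times> Rep" by (auto simp: mero_rel_def)
  show "refl_on Rep Rel" by (auto simp: refl_on_def mero_rel_def)
  show "sym Rel" by (auto simp: sym_def mero_rel_def)
  show "trans Rel"
  proof (rule transI)
    fix a b c assume ab: "(a, b) \<in> Rel" and bc: "(b, c) \<in> Rel"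
    obtain U f V g W h where abc: "a = (U, f)" "b = (V, g)" "c = (W, h)" by (metis surj_pair)
    have f: "(U, f) \<in> Rep" and g: "(V, g) \<in> Rep" and h: "(W, h) \<in> Rep"
      and fg: "\<And>x. x \<in> U \<inter> V \<Longrightarrow> f x = g x" and gh: "\<And>x. x \<in> V \<inter> W \<Longrightarrow> g x = h x"
      using ab bc by (auto simp: abc rel_iff)
    have "dense_open V" using g by (simp add: mero_rep_iff)
    then have "\<forall>x\<in>U \<inter> W. f x = h x" using agree_on_dense[OF f h] fg gh by simp
    then show "(a, c) \<in> Rel" using f h by (simp add: abc rel_iff)
  qed
qed

lemma cls_eq_iff:
  "(U, f) \<in> Rep \<Longrightarrow> (V, g) \<in> Rep \<Longrightarrow> cls U f = cls V g \<longleftrightarrow> (\<forall>x\<in>U \<inter> V. f x = g x)"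
  unfolding cls_def using eq_equiv_class_iff[OF rel_equiv] by (simp add: rel_iff)

lemma carrier_eq: "carrier M = Rep // Rel"
  by (simp add: mero_field_def)

lemma cls_carrier: "(U, f) \<in> Rep \<Longrightarrow> cls U f \<in> carrier M"
  unfolding carrier_eq cls_def by (rule quotientI)

lemma carrier_cases:
  assumes "P \<in> carrier M"
  obtains U f where "(U, f) \<in> Rep" "P = cls U f"
  using assms unfolding carrier_eq cls_def by (auto elim!: quotientE)

lemma mem_cls: "(U', f') \<in> cls U f \<longleftrightarrow> ((U, f), (U', f')) \<in> Rel"
  by (simp add: cls_def)

lemma cls_op:
  assumes f: "(U, f) \<in> Rep" and g: "(V, g) \<in> Rep"
    and op: "\<And>U f V g. (U, f) \<in> Rep \<Longrightarrow> (V, g) \<in> Rep \<Longrightarrow> (U \<inter> V, \<lambda>x. op (f x) (g x)) \<in> Rep"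
  shows "(\<Union>(U', f')\<in>cls U f. \<Union>(V', g')\<in>cls V g. Rel `` {(U' \<inter> V', \<lambda>x. op (f' x) (g' x))}) =
      cls (U \<inter> V) (\<lambda>x. op (f x) (g x))"
proof -
  have key: "Rel `` {(U' \<inter> V', \<lambda>x. op (f' x) (g' x))} = cls (U \<inter> V) (\<lambda>x. op (f x) (g x))"
    if "(U', f') \<in> cls U f" "(V', g') \<in> cls V g" for U' f' V' g'
  proof -
    have f': "(U', f') \<in> Rep" "\<forall>x\<in>U \<inter> U'. f x = f' x" and g': "(V', g') \<in> Rep" "\<forall>x\<in>V \<inter> V'. g x = g' x"
      using that by (auto simp: mem_cls rel_iff)
    have "cls (U' \<inter> V') (\<lambda>x. op (f' x) (g' x)) = cls (U \<inter> V) (\<lambda>x. op (f x) (g x))"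
      by (subst cls_eq_iff[OF op[OF f'(1) g'(1)] op[OF f g]]) (use f'(2) g'(2) in auto)
    then show ?thesis by (simp add: cls_def)
  qed
  have ne: "cls U f \<noteq> {}" "cls V g \<noteq> {}"
    using mem_cls[of U f U f] mem_cls[of V g V g] f g by (auto simp: rel_iff)
  have "(\<Union>(U', f')\<in>cls U f. \<Union>(V', g')\<in>cls V g. Rel `` {(U' \<inter> V', \<lambda>x. op (f' x) (g' x))}) =
      (\<Union>p\<in>cls U f. \<Union>q\<in>cls V g. cls (U \<inter> V) (\<lambda>x. op (f x) (g x)))"
    by (intro SUP_cong refl) (simp add: split_beta key)
  then show ?thesis using ne by simp
qed

lemma cls_mult:
  "(U, f) \<in> Rep \<Longrightarrow> (V, g) \<in> Rep \<Longrightarrow> cls U f \<otimes>\<^bsub>M\<^esub> cls V g = cls (U \<inter> V) (\<lambda>x. f x * g x)"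
  using cls_op[of U f V g "(*)"] rep_mult by (simp add: mero_field_def)

lemma cls_add:
  "(U, f) \<in> Rep \<Longrightarrow> (V, g) \<in> Rep \<Longrightarrow> cls U f \<oplus>\<^bsub>M\<^esub> cls V g = cls (U \<inter> V) (\<lambda>x. f x + g x)"
  using cls_op[of U f V g "(+)"] rep_add by (simp add: mero_field_def)

lemma const_eq: "dense_open U \<Longrightarrow> mero_const X A c = cls U (\<lambda>_. c)"
proof -
  assume "dense_open U"
  then have "cls (topspace X) (\<lambda>_. c) = cls U (\<lambda>_. c)"
    by (subst cls_eq_iff) (auto intro: rep_const dense_open_topspace)
  then show ?thesis by (simp add: mero_const_def cls_def)
qed

lemma one_eq: "dense_open U \<Longrightarrow> \<one>\<^bsub>M\<^esub> = cls U (\<lambda>_. 1)"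
  using const_eq[of U 1] by (simp add: mero_field_def)

lemma zero_eq: "dense_open U \<Longrightarrow> \<zero>\<^bsub>M\<^esub> = cls U (\<lambda>_. 0)"
  using const_eq[of U 0] by (simp add: mero_field_def)

lemma rep_dense: "(U, f) \<in> Rep \<Longrightarrow> dense_open U"
  by (simp add: mero_rep_iff)

lemma comm_monoid_M: "comm_monoid M"
proof (rule comm_monoidI)
  fix P Q T assume PQT: "P \<in> carrier M" "Q \<in> carrier M" "T \<in> carrier M"
  obtain U f where P: "(U, f) \<in> Rep" "P = cls U f" using PQT(1) by (rule carrier_cases)
  obtain V g where Q: "(V, g) \<in> Rep" "Q = cls V g" using PQT(2) by (rule carrier_cases)
  obtain W h where T: "(W, h) \<in> Rep" "T = cls W h" using PQT(3) by (rule carrier_cases)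
  note * = P Q T
  show "P \<otimes>\<^bsub>M\<^esub> Q \<otimes>\<^bsub>M\<^esub> T = P \<otimes>\<^bsub>M\<^esub> (Q \<otimes>\<^bsub>M\<^esub> T)"
    using * by (simp add: cls_mult rep_mult mult.assoc Int_assoc)
next
  fix P Q assume PQ: "P \<in> carrier M" "Q \<in> carrier M"
  obtain U f where P: "(U, f) \<in> Rep" "P = cls U f" using PQ(1) by (rule carrier_cases)
  obtain V g where Q: "(V, g) \<in> Rep" "Q = cls V g" using PQ(2) by (rule carrier_cases)
  note * = P Q
  show "P \<otimes>\<^bsub>M\<^esub> Q \<in> carrier M" using * by (simp add: cls_mult rep_mult cls_carrier)
  show "P \<otimes>\<^bsub>M\<^esub> Q = Q \<otimes>\<^bsub>M\<^esub> P" using * by (simp add: cls_mult mult.commute Int_commute)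
next
  show "\<one>\<^bsub>M\<^esub> \<in> carrier M"
    using one_eq[OF dense_open_topspace] rep_const[OF dense_open_topspace] cls_carrier by simp
  fix P assume "P \<in> carrier M"
  then obtain U f where *: "(U, f) \<in> Rep" "P = cls U f" by (rule carrier_cases)
  then show "\<one>\<^bsub>M\<^esub> \<otimes>\<^bsub>M\<^esub> P = P"
    by (simp add: one_eq[OF rep_dense[OF *(1)]] cls_mult rep_const rep_dense)
qed

lemma abelian_monoid_M: "abelian_monoid M"
proof (rule abelian_monoidI)
  fix P Q T assume PQT: "P \<in> carrier M" "Q \<in> carrier M" "T \<in> carrier M"
  obtain U f where P: "(U, f) \<in> Rep" "P = cls U f" using PQT(1) by (rule carrier_cases)
  obtain V g where Q: "(V, g) \<in> Rep" "Q = cls V g" using PQT(2) by (rule carrier_cases)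
  obtain W h where T: "(W, h) \<in> Rep" "T = cls W h" using PQT(3) by (rule carrier_cases)
  note * = P Q T
  show "P \<oplus>\<^bsub>M\<^esub> Q \<oplus>\<^bsub>M\<^esub> T = P \<oplus>\<^bsub>M\<^esub> (Q \<oplus>\<^bsub>M\<^esub> T)"
    using * by (simp add: cls_add rep_add add.assoc Int_assoc)
next
  fix P Q assume PQ: "P \<in> carrier M" "Q \<in> carrier M"
  obtain U f where P: "(U, f) \<in> Rep" "P = cls U f" using PQ(1) by (rule carrier_cases)
  obtain V g where Q: "(V, g) \<in> Rep" "Q = cls V g" using PQ(2) by (rule carrier_cases)
  note * = P Q
  show "P \<oplus>\<^bsub>M\<^esub> Q \<in> carrier M" using * by (simp add: cls_add rep_add cls_carrier)
  show "P \<oplus>\<^bsub>M\<^esub> Q = Q \<oplus>\<^bsub>M\<^esub> P" using * by (simp add: cls_add add.commute Int_commute)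
next
  show "\<zero>\<^bsub>M\<^esub> \<in> carrier M"
    using zero_eq[OF dense_open_topspace] rep_const[OF dense_open_topspace] cls_carrier by simp
  fix P assume "P \<in> carrier M"
  then obtain U f where *: "(U, f) \<in> Rep" "P = cls U f" by (rule carrier_cases)
  then show "\<zero>\<^bsub>M\<^esub> \<oplus>\<^bsub>M\<^esub> P = P"
    by (simp add: zero_eq[OF rep_dense[OF *(1)]] cls_add rep_const rep_dense)
qed

lemma cls_sum:
  assumes U: "dense_open U" and J: "finite J" "\<And>j. j \<in> J \<Longrightarrow> (U, f j) \<in> Rep"
  shows "(U, \<lambda>x. \<Sum>j\<in>J. f j x) \<in> Rep" "(\<Oplus>\<^bsub>M\<^esub>j\<in>J. cls U (f j)) = cls U (\<lambda>x. \<Sum>j\<in>J. f j x)"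
proof -
  interpret abelian_monoid M by (rule abelian_monoid_M)
  have "(U, \<lambda>x. \<Sum>j\<in>J. f j x) \<in> Rep \<and> (\<Oplus>\<^bsub>M\<^esub>j\<in>J. cls U (f j)) = cls U (\<lambda>x. \<Sum>j\<in>J. f j x)"
    using J
  proof (induction J)
    case empty
    then show ?case using zero_eq[OF U] rep_const[OF U] by simp
  next
    case (insert j J)
    then show ?case
      using rep_add[of U "f j" U "\<lambda>x. \<Sum>j\<in>J. f j x"] cls_add[of U "f j" U "\<lambda>x. \<Sum>j\<in>J. f j x"]
      by (simp add: finsum_insert cls_carrier Pi_def)
  qed
  then show "(U, \<lambda>x. \<Sum>j\<in>J. f j x) \<in> Rep" "(\<Oplus>\<^bsub>M\<^esub>j\<in>J. cls U (f j)) = cls U (\<lambda>x. \<Sum>j\<in>J. f j x)"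
    by auto
qed

lemma cls_prod:
  assumes U: "dense_open U" and J: "finite J" "\<And>j. j \<in> J \<Longrightarrow> (U, f j) \<in> Rep"
  shows "(U, \<lambda>x. \<Prod>j\<in>J. f j x) \<in> Rep" "(\<Otimes>\<^bsub>M\<^esub>j\<in>J. cls U (f j)) = cls U (\<lambda>x. \<Prod>j\<in>J. f j x)"
proof -
  interpret comm_monoid M by (rule comm_monoid_M)
  have "(U, \<lambda>x. \<Prod>j\<in>J. f j x) \<in> Rep \<and> (\<Otimes>\<^bsub>M\<^esub>j\<in>J. cls U (f j)) = cls U (\<lambda>x. \<Prod>j\<in>J. f j x)"
    using J
  proof (induction J)
    case empty
    then show ?case using one_eq[OF U] rep_const[OF U] by simp
  next
    case (insert j J)
    then show ?case
      using rep_mult[of U "f j" U "\<lambda>x. \<Prod>j\<in>J. f j x"] cls_mult[of U "f j" U "\<lambda>x. \<Prod>j\<in>J. f j x"]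
      by (simp add: finprod_insert cls_carrier Pi_def)
  qed
  then show "(U, \<lambda>x. \<Prod>j\<in>J. f j x) \<in> Rep" "(\<Otimes>\<^bsub>M\<^esub>j\<in>J. cls U (f j)) = cls U (\<lambda>x. \<Prod>j\<in>J. f j x)"
    by auto
qed

lemma cls_power:
  assumes f: "(U, f) \<in> Rep"
  shows "(U, \<lambda>x. f x ^ k) \<in> Rep" "cls U f [^]\<^bsub>M\<^esub> (k::nat) = cls U (\<lambda>x. f x ^ k)"
proof -
  interpret comm_monoid M by (rule comm_monoid_M)
  have "(U, \<lambda>x. f x ^ k) \<in> Rep \<and> cls U f [^]\<^bsub>M\<^esub> k = cls U (\<lambda>x. f x ^ k)"
  proof (induction k)
    case 0
    then show ?case using one_eq[OF rep_dense[OF f]] rep_const[OF rep_dense[OF f]] by simp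
  next
    case (Suc k)
    then show ?case
      using rep_mult[of U f U "\<lambda>x. f x ^ k"] cls_mult[of U "\<lambda>x. f x ^ k" U f] f by (simp add: mult.commute)
  qed
  then show "(U, \<lambda>x. f x ^ k) \<in> Rep" "cls U f [^]\<^bsub>M\<^esub> (k::nat) = cls U (\<lambda>x. f x ^ k)" by auto
qed

lemma pre_nonempty: "dense_open U \<Longrightarrow> \<exists>z. z \<in> pre U"
proof (rule ccontr)
  assume U: "dense_open U" and no: "\<not> (\<exists>z. z \<in> pre U)"
  then have "pre U = {}" by blast
  then have "E = {}" using U by (simp add: dense_open_def)
  moreover have "(\<chi> i. 1) \<in> E" by (simp add: vec_eq_iff)
  ultimately show False by blast
qed

lemma ball_pre_iff: "dense_open U \<Longrightarrow> (\<forall>x\<in>U. P x) \<longleftrightarrow> (\<forall>z\<in>pre U. P (\<pi> z))"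
  by (auto simp: dense_open_def openin_iff pre_def)

text \<open>Over a common domain \<open>U\<close> the operations of the field are pointwise operations on functions.\<close>

lemma polynomial_value:
  assumes U: "dense_open U" and S: "\<And>s. s \<in> S \<Longrightarrow> (U, f s) \<in> Rep" "\<And>s. s \<in> S \<Longrightarrow> s = cls U (f s)"
    and N: "finite N" "\<forall>m\<in>N. set_mset m \<subseteq> S"
  shows "(\<Oplus>\<^bsub>M\<^esub>m\<in>N. mero_const X A (k m) \<otimes>\<^bsub>M\<^esub> (\<Otimes>\<^bsub>M\<^esub>s\<in>set_mset m. s [^]\<^bsub>M\<^esub> count m s)) = \<zero>\<^bsub>M\<^esub> \<longleftrightarrow>
    (\<forall>z\<in>pre U. (\<Sum>m\<in>N. k m * (\<Prod>s\<in>set_mset m. f s (\<pi> z) ^ count m s)) = 0)"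
proof -
  interpret comm_monoid M by (rule comm_monoid_M)
  interpret abelian_monoid M by (rule abelian_monoid_M)
  let ?t = "\<lambda>m x. k m * (\<Prod>s\<in>set_mset m. f s x ^ count m s)"
  have t: "(U, ?t m) \<in> Rep \<and> mero_const X A (k m) \<otimes>\<^bsub>M\<^esub> (\<Otimes>\<^bsub>M\<^esub>s\<in>set_mset m. s [^]\<^bsub>M\<^esub> count m s) = cls U (?t m)"
    if m: "m \<in> N" for m
  proof -
    have sub: "set_mset m \<subseteq> S" using N m by blast
    have fs: "(U, \<lambda>x. f s x ^ count m s) \<in> Rep" if "s \<in> set_mset m" for s
      using cls_power(1) S(1) sub that by blast
    have pw: "s [^]\<^bsub>M\<^esub> count m s = cls U (\<lambda>x. f s x ^ count m s)" if "s \<in> set_mset m" for s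
      using cls_power(2)[OF S(1)] S(2) sub that by (metis subsetD)
    have "(\<Otimes>\<^bsub>M\<^esub>s\<in>set_mset m. s [^]\<^bsub>M\<^esub> count m s) = (\<Otimes>\<^bsub>M\<^esub>s\<in>set_mset m. cls U (\<lambda>x. f s x ^ count m s))"
      by (rule finprod_cong') (use pw fs cls_carrier in auto)
    also have "\<dots> = cls U (\<lambda>x. \<Prod>s\<in>set_mset m. f s x ^ count m s)"
      by (rule cls_prod(2)[OF U]) (use fs in auto)
    finally have eq: "(\<Otimes>\<^bsub>M\<^esub>s\<in>set_mset m. s [^]\<^bsub>M\<^esub> count m s) = cls U (\<lambda>x. \<Prod>s\<in>set_mset m. f s x ^ count m s)" .
    have "(U, \<lambda>x. \<Prod>s\<in>set_mset m. f s x ^ count m s) \<in> Rep"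
      by (rule cls_prod(1)[OF U]) (use fs in auto)
    then show ?thesis
      unfolding eq const_eq[OF U]
      using cls_mult[OF rep_const[OF U, of "k m"]] rep_mult[OF rep_const[OF U, of "k m"]] by fastforce
  qed
  have "(\<Oplus>\<^bsub>M\<^esub>m\<in>N. mero_const X A (k m) \<otimes>\<^bsub>M\<^esub> (\<Otimes>\<^bsub>M\<^esub>s\<in>set_mset m. s [^]\<^bsub>M\<^esub> count m s)) = (\<Oplus>\<^bsub>M\<^esub>m\<in>N. cls U (?t m))"
    by (rule finsum_cong') (use t cls_carrier in auto)
  also have "\<dots> = cls U (\<lambda>x. \<Sum>m\<in>N. ?t m x)"
    by (rule cls_sum(2)[OF U N(1)]) (use t in auto)
  finally have eq: "(\<Oplus>\<^bsub>M\<^esub>m\<in>N. mero_const X A (k m) \<otimes>\<^bsub>M\<^esub> (\<Otimes>\<^bsub>M\<^esub>s\<in>set_mset m. s [^]\<^bsub>M\<^esub> count m s)) =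
      cls U (\<lambda>x. \<Sum>m\<in>N. ?t m x)" .
  have rep: "(U, \<lambda>x. \<Sum>m\<in>N. ?t m x) \<in> Rep"
    by (rule cls_sum(1)[OF U N(1)]) (use t in auto)
  have "(\<forall>x\<in>U. (\<Sum>m\<in>N. ?t m x) = 0) \<longleftrightarrow> (\<forall>z\<in>pre U. (\<Sum>m\<in>N. ?t m (\<pi> z)) = 0)"
    by (rule ball_pre_iff[OF U])
  then show ?thesis
    unfolding eq zero_eq[OF U] by (subst cls_eq_iff[OF rep rep_const[OF U]]) simp
qed

lemma const_zero_iff: "mero_const X A c = \<zero>\<^bsub>M\<^esub> \<longleftrightarrow> c = 0"
proof -
  have "topspace X \<noteq> {}"
    using pre_nonempty[OF dense_open_topspace] by (auto simp: pre_def)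
  then show ?thesis
    unfolding const_eq[OF dense_open_topspace] zero_eq[OF dense_open_topspace]
    by (subst cls_eq_iff) (auto intro: rep_const dense_open_topspace)
qed

lemma alg_indep_iff:
  assumes U: "dense_open U" and reps: "\<forall>s\<in>S. (U, f s) \<in> Rep \<and> s = cls U (f s)"
  shows "alg_indep M (range (mero_const X A)) S \<longleftrightarrow>
    (\<forall>N k. finite N \<longrightarrow> (\<forall>m\<in>N. set_mset m \<subseteq> S) \<longrightarrow>
      (\<forall>z\<in>pre U. (\<Sum>m\<in>N. k m * (\<Prod>s\<in>set_mset m. f s (\<pi> z) ^ count m s)) = 0) \<longrightarrow> (\<forall>m\<in>N. k m = 0))"
    (is "_ \<longleftrightarrow> ?R")
proof -
  have S: "(U, f s) \<in> Rep" "s = cls U (f s)" if "s \<in> S" for s using reps that by blast+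
  show ?thesis
  proof
    assume ai: "alg_indep M (range (mero_const X A)) S"
    show ?R
    proof (intro allI impI ballI)
      fix N k m assume N: "finite N" "\<forall>m\<in>N. set_mset m \<subseteq> S" and m: "m \<in> N"
        and z: "\<forall>z\<in>pre U. (\<Sum>m\<in>N. k m * (\<Prod>s\<in>set_mset m. f s (\<pi> z) ^ count m s)) = 0"
      have "(\<lambda>m. mero_const X A (k m)) \<in> N \<rightarrow> range (mero_const X A)" by auto
      then have "mero_const X A (k m) = \<zero>\<^bsub>M\<^esub>"
        using ai N m polynomial_value[OF U S N, of k] z unfolding alg_indep_def by blast
      then show "k m = 0" by (simp add: const_zero_iff)
    qed
  next
    assume R: ?R
    show "alg_indep M (range (mero_const X A)) S"
      unfolding alg_indep_def
    proof (intro conjI allI impI)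
      have SM: "s \<in> carrier M" if "s \<in> S" for s
        by (subst S(2)[OF that]) (rule cls_carrier[OF S(1)[OF that]])
      show "S \<subseteq> carrier M" using SM by blast
      fix N c assume N: "finite N" "\<forall>m\<in>N. set_mset m \<subseteq> S" and c: "c \<in> N \<rightarrow> range (mero_const X A)"
        and z: "(\<Oplus>\<^bsub>M\<^esub>m\<in>N. c m \<otimes>\<^bsub>M\<^esub> (\<Otimes>\<^bsub>M\<^esub>s\<in>set_mset m. s [^]\<^bsub>M\<^esub> count m s)) = \<zero>\<^bsub>M\<^esub>"
      interpret comm_monoid M by (rule comm_monoid_M)
      interpret abelian_monoid M by (rule abelian_monoid_M)
      have "\<forall>m\<in>N. \<exists>k. c m = mero_const X A k" using c by auto
      then obtain k where k: "\<forall>m\<in>N. c m = mero_const X A (k m)" unfolding bchoice_iff by blast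
      have closed: "c m \<otimes>\<^bsub>M\<^esub> (\<Otimes>\<^bsub>M\<^esub>s\<in>set_mset m. s [^]\<^bsub>M\<^esub> count m s) \<in> carrier M" if "m \<in> N" for m
      proof -
        have "c m \<in> carrier M"
          using k that const_eq[OF U] cls_carrier[OF rep_const[OF U]] by simp
        moreover have "s \<in> carrier M" if "s \<in> set_mset m" for s
        proof -
          have "s \<in> S" using N \<open>m \<in> N\<close> that by blast
          then show ?thesis by (rule SM)
        qed
        ultimately show ?thesis by (intro m_closed finprod_closed) auto
      qed
      have "(\<Oplus>\<^bsub>M\<^esub>m\<in>N. mero_const X A (k m) \<otimes>\<^bsub>M\<^esub> (\<Otimes>\<^bsub>M\<^esub>s\<in>set_mset m. s [^]\<^bsub>M\<^esub> count m s)) =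
          (\<Oplus>\<^bsub>M\<^esub>m\<in>N. c m \<otimes>\<^bsub>M\<^esub> (\<Otimes>\<^bsub>M\<^esub>s\<in>set_mset m. s [^]\<^bsub>M\<^esub> count m s))"
        by (rule finsum_cong') (use closed k in auto)
      then have "\<forall>m\<in>N. k m = 0"
        using R N polynomial_value[OF U S N, of k] z by simp
      then show "\<forall>m\<in>N. c m = \<zero>\<^bsub>M\<^esub>" using k const_zero_iff by simp
    qed
qed
qed

lemma common_representatives:
  assumes "finite S" "S \<subseteq> carrier M"
  shows "\<exists>U f. dense_open U \<and> (\<forall>s\<in>S. (U, f s) \<in> Rep \<and> s = cls U (f s))"
proof -
  have "\<forall>s\<in>S. \<exists>p. p \<in> Rep \<and> s = cls (fst p) (snd p)"
  proof
    fix s assume "s \<in> S"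
    then obtain U f where "(U, f) \<in> Rep" "s = cls U f" using assms(2) carrier_cases by blast
    then show "\<exists>p. p \<in> Rep \<and> s = cls (fst p) (snd p)" by (intro exI[of _ "(U, f)"]) simp
  qed
  then obtain p where p: "\<forall>s\<in>S. p s \<in> Rep \<and> s = cls (fst (p s)) (snd (p s))"
    unfolding bchoice_iff by blast
  define U where "U = topspace X \<inter> (\<Inter>s\<in>S. fst (p s))"
  have "dense_open (topspace X \<inter> (\<Inter>s\<in>T. fst (p s)))" if "T \<subseteq> S" for T
    using finite_subset[OF that assms(1)] that
  proof (induction T)
    case empty
    then show ?case using dense_open_topspace by simp
  next
    case (insert t T)
    have "dense_open (fst (p t))" using p insert.prems rep_dense by (metis insert_subset prod.collapse)
    then have "dense_open (fst (p t) \<inter> (topspace X \<inter> (\<Inter>s\<in>T. fst (p s))))"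
      by (rule dense_open_Int) (use insert in auto)
    moreover have "fst (p t) \<inter> (topspace X \<inter> (\<Inter>s\<in>T. fst (p s))) = topspace X \<inter> (\<Inter>s\<in>insert t T. fst (p s))" by auto
    ultimately show ?case by simp
  qed
  then have U: "dense_open U" by (simp add: U_def)
  have "(U, snd (p s)) \<in> Rep \<and> s = cls U (snd (p s))" if s: "s \<in> S" for s
  proof -
    have rp: "(fst (p s), snd (p s)) \<in> Rep" using p s by simp
    have "U \<subseteq> fst (p s)" using s by (auto simp: U_def)
    from rep_restrict[OF rp U this] have r: "(U, snd (p s)) \<in> Rep" .
    then have "cls (fst (p s)) (snd (p s)) = cls U (snd (p s))" by (subst cls_eq_iff[OF rp r]) auto
    then show ?thesis using r p s by auto
  qed
  then show ?thesis using U by (intro exI[of _ U] exI[of _ "\<lambda>s. snd (p s)"]) blast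
qed

end

section \<open>The upper bound\<close>

lemma eigenpolys_line_holo: "g \<in> eigenpolys lam c \<Longrightarrow> line_holo g S"
proof -
  assume "g \<in> eigenpolys lam c"
  then obtain a where a: "\<And>z. g z = (\<Sum>m | cmonomial m lam = c. a m * cmonomial m z)"
    by (auto simp: eigenpolys_def)
  have "line_holo (\<lambda>z. \<Sum>m | cmonomial m lam = c. a m * cmonomial m z) S"
    unfolding cmonomial_def
    by (intro line_holo_sum line_holo_mult line_holo_const line_holo_prod line_holo_power line_holo_component)
  moreover have "g = (\<lambda>z. \<Sum>m | cmonomial m lam = c. a m * cmonomial m z)" using a by (rule ext)
  ultimately show ?thesis by simp
qed

context diagonal_hopf
begin

lemma rep_eigen_quotient:
  assumes n: "CARD('n) \<ge> 2" and f: "(U, f) \<in> Rep"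
  shows "\<exists>c P Q. c \<noteq> 0 \<and> P \<in> eigenpolys lam c \<and> Q \<in> eigenpolys lam c \<and> (\<exists>z. Q z \<noteq> 0) \<and>
      (\<forall>z\<in>pre U. f (\<pi> z) * Q z = P z)"
proof -
  let ?F = "\<lambda>z. f (\<pi> z)"
  have U: "open (pre U)" "E \<subseteq> closure (pre U)" and F: "line_holo ?F (pre U)"
    using f holo_on_imp_line_holo[of "f \<circ> \<pi>" "pre U"] by (auto simp: mero_rep_iff dense_open_def openin_iff o_def)
  have loc: "\<exists>V g h. open V \<and> p \<in> V \<and> line_holo g V \<and> line_holo h V \<and>
      V \<subseteq> closure {z \<in> V. h z \<noteq> 0} \<and> (\<forall>z\<in>pre U \<inter> V. ?F z * h z = g z)" if p: "p \<noteq> 0" for p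
  proof -
    have "\<pi> p \<in> topspace X" using p by (auto simp: topspace_eq)
    then obtain V g h where V: "\<pi> p \<in> V" "holomorphic_fun X A V g" "holomorphic_fun X A V h"
        "pre V \<subseteq> closure {z \<in> pre V. h (\<pi> z) \<noteq> 0}" "\<forall>x\<in>U \<inter> V. f x * h x = g x"
      using f unfolding mero_rep_iff by blast
    have "line_holo (g \<circ> \<pi>) (pre V)" "line_holo (h \<circ> \<pi>) (pre V)" "open (pre V)"
      using V(2,3) unfolding holomorphic_fun_iff openin_iff by (auto intro: holo_on_imp_line_holo simp del: o_apply)
    moreover have "p \<in> pre V" using V(1) p by (simp add: pre_def)
    moreover have "\<forall>z\<in>pre U \<inter> pre V. ?F z * (h \<circ> \<pi>) z = (g \<circ> \<pi>) z" using V(5) by (auto simp: pre_def)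
    ultimately show ?thesis
      using V(4) by (intro exI[of _ "pre V"] exI[of _ "g \<circ> \<pi>"] exI[of _ "h \<circ> \<pi>"]) auto
  qed
  have "\<exists>R F'. meromorphic_off_0 F' R \<and> pre U - {0} \<subseteq> R \<and> (\<forall>z\<in>pre U - {0}. F' z = ?F z)"
    by (rule meromorphic_maximal_domain[OF U F]) (rule loc)
  then obtain R F' where R: "meromorphic_off_0 F' R"
    "pre U - {0} \<subseteq> R" "\<forall>z\<in>pre U - {0}. F' z = ?F z" by (elim exE conjE)
  from meromorphic_quotient_at_0[OF R(1) n] obtain e G Q where e: "e > 0" and GQ: "line_holo G (ball 0 e)"
    "line_holo Q (ball 0 e)" "\<exists>w\<in>ball 0 e. Q w \<noteq> 0" "\<forall>u\<in>R \<inter> ball 0 e. F' u * Q u = G u"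
    by (elim exE conjE)
  obtain w where w: "w \<in> ball 0 e" "Q w \<noteq> 0" using GQ(3) by blast
  have FQ: "?F u * Q u = G u" if "u \<in> pre U \<inter> ball 0 e" for u
  proof -
    have "u \<in> pre U - {0}" using that pre_subset by auto
    then show ?thesis using R(2,3) GQ(4) that by force
  qed
  have "\<exists>c a b m0. c \<noteq> 0 \<and> cmonomial m0 lam = c \<and> b m0 \<noteq> 0 \<and>
      (\<forall>z\<in>pre U. ?F z * (\<Sum>m | cmonomial m lam = c. b m * cmonomial m z) =
        (\<Sum>m | cmonomial m lam = c. a m * cmonomial m z))"
    by (rule invariant_eigen_quotient[OF lam_pos lam_less_1 _ _ e GQ(1,2) w FQ])
       (use pre_diag_map in auto)
  then obtain c a b m0 where c: "c \<noteq> 0" "cmonomial m0 lam = c" "b m0 \<noteq> 0"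
    and eq: "\<forall>z\<in>pre U. ?F z * (\<Sum>m | cmonomial m lam = c. b m * cmonomial m z) =
        (\<Sum>m | cmonomial m lam = c. a m * cmonomial m z)" by (elim exE conjE)
  have "finite {m. cmonomial m lam = c}" by (rule finite_eigenvalue[OF lam_less_1 c(1)])
  from monomials_independent[where b = b, OF this, of m0] c
  have "\<exists>z. (\<Sum>m | cmonomial m lam = c. b m * cmonomial m z) \<noteq> 0" by blast
  then show ?thesis
    using c(1) eq by (intro exI[of _ c] exI[of _ "\<lambda>z. \<Sum>m | cmonomial m lam = c. a m * cmonomial m z"]
        exI[of _ "\<lambda>z. \<Sum>m | cmonomial m lam = c. b m * cmonomial m z"]) (auto simp: eigenpolys_def)
qed

text \<open>A relation between the values of the quotients holds where no denominator vanishes, hence everywhere by continuity.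
Exponent functions \<open>\<alpha>\<close> are turned into multisets, which index the monomials in algebraic independence.\<close>

lemma alg_indep_card_le:
  assumes n: "CARD('n) \<ge> 2" and S: "finite S" "alg_indep M (range (mero_const X A)) S"
    and C: "0 \<le> C" and gen: "\<And>x. psi lam x = 1 \<Longrightarrow> \<exists>a. x = int_span r v a" and bd: "bounded_coefficients r v C"
  shows "card S \<le> r"
proof (rule ccontr)
  assume "\<not> card S \<le> r"
  then have cardS: "r < card S" by simp
  have "S \<subseteq> carrier M" using S(2) by (simp add: alg_indep_def)
  from common_representatives[OF S(1) this] obtain U f where U: "dense_open U"
    and f': "\<forall>s\<in>S. (U, f s) \<in> Rep \<and> s = cls U (f s)" by (elim exE conjE)
  have f: "(U, f s) \<in> Rep" "s = cls U (f s)" if "s \<in> S" for s using f' that by blast+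
  have "\<forall>s\<in>S. \<exists>c P Q. c \<noteq> 0 \<and> P \<in> eigenpolys lam c \<and> Q \<in> eigenpolys lam c \<and> (\<exists>z. Q z \<noteq> 0) \<and>
      (\<forall>z\<in>pre U. f s (\<pi> z) * Q z = P z)"
    using rep_eigen_quotient[OF n f(1)] by blast
  then obtain c P Q where cPQ: "\<forall>s\<in>S. c s \<noteq> 0 \<and> P s \<in> eigenpolys lam (c s) \<and> Q s \<in> eigenpolys lam (c s) \<and>
      (\<exists>z. Q s z \<noteq> 0) \<and> (\<forall>z\<in>pre U. f s (\<pi> z) * Q s z = P s z)"
    unfolding bchoice_iff by (elim exE)
  have "\<exists>N d. (\<exists>\<alpha>\<in>S \<rightarrow>\<^sub>E {..N::nat}. d \<alpha> \<noteq> 0) \<and>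
    (\<forall>z g. (\<forall>s\<in>S. g s * Q s z = P s z \<and> Q s z \<noteq> 0) \<longrightarrow> (\<Sum>\<alpha>\<in>S \<rightarrow>\<^sub>E {..N}. d \<alpha> * (\<Prod>s\<in>S. g s ^ \<alpha> s)) = 0)"
    by (rule eigen_quotients_dependent[OF lam_pos lam_less_1 C gen bd S(1) cardS, of c]) (use cPQ in auto)
  then obtain N d where d: "\<exists>\<alpha>\<in>S \<rightarrow>\<^sub>E {..N::nat}. d \<alpha> \<noteq> 0"
    and rel: "\<forall>z g. (\<forall>s\<in>S. g s * Q s z = P s z \<and> Q s z \<noteq> 0) \<longrightarrow>
        (\<Sum>\<alpha>\<in>S \<rightarrow>\<^sub>E {..N}. d \<alpha> * (\<Prod>s\<in>S. g s ^ \<alpha> s)) = 0" by (elim exE conjE)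
  let ?\<Lambda> = "S \<rightarrow>\<^sub>E {..N}"
  have Q_hol: "line_holo (Q s) UNIV" if "s \<in> S" for s
    using cPQ that eigenpolys_line_holo by blast
  have "\<exists>z. (\<Prod>s\<in>T. Q s z) \<noteq> 0" if "T \<subseteq> S" for T
    using finite_subset[OF that S(1)] that
  proof (induction T)
    case (insert t T)
    obtain z1 where z1: "Q t z1 \<noteq> 0" using cPQ insert.prems by blast
    obtain z2 where z2: "(\<Prod>s\<in>T. Q s z2) \<noteq> 0" using insert by auto
    have "line_holo (Q t) UNIV" "line_holo (\<lambda>z. \<Prod>s\<in>T. Q s z) UNIV"
      using insert.prems by (auto intro!: line_holo_prod Q_hol)
    from line_holo_mult_nonzero[OF this open_UNIV convex_UNIV UNIV_I z1 UNIV_I z2]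
    show ?case using insert.hyps by auto
  qed simp
  then obtain z1 where z1: "(\<Prod>s\<in>S. Q s z1) \<noteq> 0" by blast
  have dense: "closure {z. (\<Prod>s\<in>S. Q s z) \<noteq> 0} = UNIV"
    using line_holo_nonzero_dense[of "\<lambda>z. \<Prod>s\<in>S. Q s z" UNIV z1] z1 Q_hol line_holo_prod[of S Q UNIV] by auto
  let ?g = "\<lambda>z. \<Sum>\<alpha>\<in>?\<Lambda>. d \<alpha> * (\<Prod>s\<in>S. f s (\<pi> z) ^ \<alpha> s)"
  have g0: "?g z = 0" if z: "z \<in> pre U" for z
  proof (rule ccontr)
    assume ne: "?g z \<noteq> 0"
    have "continuous_on (pre U) (\<lambda>z. f s (\<pi> z))" if "s \<in> S" for s
      using holo_on_continuous[of "f s \<circ> \<pi>" "pre U"] f(1)[OF that] by (simp add: mero_rep_iff o_def)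
    then have "continuous_on (pre U) ?g" by (intro continuous_intros)
    then have "open {z \<in> pre U. ?g z \<noteq> 0}"
      by (rule open_nonzero) (use U in \<open>auto simp: dense_open_def openin_iff\<close>)
    moreover have "z \<in> {z \<in> pre U. ?g z \<noteq> 0}" using z ne by simp
    moreover have "z \<in> closure {z. (\<Prod>s\<in>S. Q s z) \<noteq> 0}" using dense by simp
    ultimately obtain y where y: "(\<Prod>s\<in>S. Q s y) \<noteq> 0" "y \<in> pre U" "?g y \<noteq> 0"
      unfolding closure_iff_nhds_not_empty by blast
    have "Q s y \<noteq> 0" if "s \<in> S" for s using y(1) that S(1) by auto
    then have "\<forall>s\<in>S. f s (\<pi> y) * Q s y = P s y \<and> Q s y \<noteq> 0" using cPQ y(2) by blast
    then show False using rel[rule_format, of "\<lambda>s. f s (\<pi> y)" y] y(3) by blast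
  qed
  define ms where "ms = (\<lambda>\<alpha>. \<Sum>s\<in>S. replicate_mset (\<alpha> s) s)"
  have count_ms: "count (ms \<alpha>) s = (if s \<in> S then \<alpha> s else 0)" for \<alpha> s
    using S(1) by (simp add: ms_def count_sum)
  have set_ms: "set_mset (ms \<alpha>) \<subseteq> S" for \<alpha>
    using count_ms[of \<alpha>] by (auto simp flip: count_greater_zero_iff split: if_splits)
  have inj: "inj_on ms ?\<Lambda>"
  proof (rule inj_onI)
    fix \<alpha> \<beta> assume \<alpha>: "\<alpha> \<in> ?\<Lambda>" "\<beta> \<in> ?\<Lambda>" "ms \<alpha> = ms \<beta>"
    have "\<alpha> s = \<beta> s" if "s \<in> S" for s using count_ms[of \<alpha> s] count_ms[of \<beta> s] \<alpha>(3) that by simp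
    then show "\<alpha> = \<beta>" using \<alpha>(1,2) by (intro PiE_ext)
  qed
  have fin: "finite ?\<Lambda>" using S(1) by (intro finite_PiE) auto
  define k where "k = (\<lambda>m. d (inv_into ?\<Lambda> ms m))"
  have "(\<Sum>m\<in>ms ` ?\<Lambda>. k m * (\<Prod>s\<in>set_mset m. f s (\<pi> z) ^ count m s)) = 0" if z: "z \<in> pre U" for z
  proof -
    have "(\<Prod>s\<in>set_mset (ms \<alpha>). f s (\<pi> z) ^ count (ms \<alpha>) s) = (\<Prod>s\<in>S. f s (\<pi> z) ^ \<alpha> s)" for \<alpha>
      using set_ms[of \<alpha>] S(1)
      by (intro prod.mono_neutral_cong_left) (auto simp: count_ms not_in_iff)
    then have "(\<Sum>m\<in>ms ` ?\<Lambda>. k m * (\<Prod>s\<in>set_mset m. f s (\<pi> z) ^ count m s)) = ?g z"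
      by (subst sum.reindex[OF inj]) (auto simp: k_def inv_into_f_f[OF inj] intro!: sum.cong)
    then show ?thesis using g0[OF z] by simp
  qed
  moreover have "finite (ms ` ?\<Lambda>)" "\<forall>m\<in>ms ` ?\<Lambda>. set_mset m \<subseteq> S" using fin set_ms by auto
  ultimately have "\<forall>m\<in>ms ` ?\<Lambda>. k m = 0"
    using iffD1[OF alg_indep_iff[OF U f'] S(2)] by blast
  then have "\<forall>\<alpha>\<in>?\<Lambda>. d \<alpha> = 0" by (simp add: k_def inv_into_f_f[OF inj])
  then show False using d by blast
qed

section \<open>The lower bound\<close>

definition torus :: "(complex^'n) set" where
  "torus = {z. \<forall>i. z $ i \<noteq> 0}"

text \<open>For \<open>psi lam v = 1\<close> the monomial is constant on orbits, so the choice of a point is immaterial.\<close>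

definition orbit_monomial :: "int^'n \<Rightarrow> (complex^'n) set \<Rightarrow> complex" where
  "orbit_monomial v x = psi (SOME z. z \<in> x) v"

lemma psi_add: "z \<in> torus \<Longrightarrow> psi z (v + w) = psi z v * psi z w"
  by (simp add: psi_def torus_def power_int_add prod.distrib)

lemma psi_nat_multiple: "psi z (int k *s v) = psi z v ^ k"
  unfolding psi_def prod_power_distrib
proof (rule prod.cong)
  fix i
  have "z $ i powi (v $ i * int k) = (z $ i powi (v $ i)) ^ k" by (simp add: power_int_mult)
  then show "z $ i powi ((int k *s v) $ i) = (z $ i powi (v $ i)) ^ k" by (simp add: mult.commute)
qed simp

lemma psi_int_span:
  "z \<in> torus \<Longrightarrow> psi z (int_span r v (\<lambda>i. int (a i))) = (\<Prod>i<r. psi z (v i) ^ a i)"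
proof (induction r)
  case 0
  then show ?case by (simp add: int_span_def psi_def)
next
  case (Suc r)
  have "int_span (Suc r) v (\<lambda>i. int (a i)) = int_span r v (\<lambda>i. int (a i)) + int (a r) *s v r"
    by (simp add: int_span_def)
  then show ?case using Suc by (simp add: psi_add psi_nat_multiple)
qed

lemma psi_proj:
  assumes v: "psi lam v = 1" and w: "w \<in> \<pi> z"
  shows "psi w v = psi z v"
proof -
  have step: "psi (diag_map lam x) v = psi x v" for x
    using v by (simp add: psi_def diag_map_def power_int_mult_distrib prod.distrib)
  have iter: "psi ((diag_map lam ^^ k) x) v = psi x v" for k x
    by (induction k) (auto simp: step)
  from w obtain k where "w = (diag_map lam ^^ k) z \<or> z = (diag_map lam ^^ k) w"
    unfolding hopf_proj_def by blast
  then show ?thesis using iter by metis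
qed

lemma orbit_monomial_proj: "psi lam v = 1 \<Longrightarrow> orbit_monomial v (\<pi> z) = psi z v"
proof -
  assume v: "psi lam v = 1"
  have "z \<in> \<pi> z" unfolding mem_proj by (metis act_0)
  then have "(SOME w. w \<in> \<pi> z) \<in> \<pi> z" by (rule someI)
  then show ?thesis unfolding orbit_monomial_def by (rule psi_proj[OF v])
qed

lemma torus_cmonomial: "torus = {z. cmonomial (\<lambda>_. 1) z \<noteq> 0}"
  by (auto simp: torus_def cmonomial_def)

lemma open_torus: "open torus"
  unfolding torus_cmonomial
  using open_nonzero[OF holo_on_continuous[OF holo_on_cmonomial] open_UNIV, of "\<lambda>_. 1"] by simp

lemma dense_torus: "closure torus = UNIV"
proof -
  have "line_holo (cmonomial (\<lambda>_. 1)) UNIV" by (intro holo_on_imp_line_holo holo_on_cmonomial) simp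
  from line_holo_nonzero_dense[OF this open_UNIV convex_UNIV, of "\<chi> i. 1"]
  show ?thesis unfolding torus_cmonomial by (auto simp: cmonomial_def)
qed

lemma torus_subset: "torus \<subseteq> E"
  by (auto simp: torus_def)

lemma act_torus: "act k z \<in> torus \<longleftrightarrow> z \<in> torus"
  by (simp add: torus_def act_def lam_nonzero)

lemma pre_torus: "pre (\<pi> ` torus) = torus"
  unfolding pre_proj[OF torus_subset] using act_torus by auto

lemma dense_open_torus: "dense_open (\<pi> ` torus)"
  unfolding dense_open_def pre_torus dense_torus
  using openin_proj[OF open_torus torus_subset] by simp

lemma cmonomial_act: "cmonomial m (act k z) = cmonomial m (\<chi> i. lam $ i powi k) * cmonomial m z"
  by (simp add: cmonomial_def act_def power_mult_distrib prod.distrib)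

lemma inv_into_proj:
  assumes "V \<subseteq> E" "inj_on \<pi> V" "w \<in> pre (\<pi> ` V)"
  obtains k where "act k w \<in> V" "inv_into V \<pi> (\<pi> w) = act k w"
proof -
  obtain k where k: "act k w \<in> V" using assms by (auto simp: pre_proj)
  have "inv_into V \<pi> (\<pi> w) = inv_into V \<pi> (\<pi> (act k w))" by simp
  also have "\<dots> = act k w" using assms(2) k by (rule inv_into_f_f)
  finally show thesis using k that by blast
qed

text \<open>A monomial that is not invariant still defines a function on a small piece of the quotient, through the sheet \<open>V\<close> of the covering.
On the other sheets it is multiplied by a constant.\<close>

lemma local_monomial_holomorphic:
  assumes V: "open V" "V \<subseteq> E" "inj_on \<pi> V"
  shows "holomorphic_fun X A (\<pi> ` V) (\<lambda>x. cmonomial m (inv_into V \<pi> x))"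
  unfolding holomorphic_fun_iff
proof
  show "openin X (\<pi> ` V)" by (rule openin_proj[OF V(1,2)])
  show "holo_on ((\<lambda>x. cmonomial m (inv_into V \<pi> x)) \<circ> \<pi>) (pre (\<pi> ` V))"
  proof (rule holo_on_locally)
    fix w assume w: "w \<in> pre (\<pi> ` V)"
    then obtain k where k: "act k w \<in> V" using V by (auto simp: pre_proj)
    let ?T = "act k -` V"
    have "holo_on (\<lambda>z. cmonomial m (\<chi> i. lam $ i powi k) * cmonomial m z) ?T"
      by (intro holo_on_mult holo_on_const holo_on_cmonomial open_act_vimage V)
    then have "holo_on ((\<lambda>x. cmonomial m (inv_into V \<pi> x)) \<circ> \<pi>) ?T"
    proof (rule holo_on_cong[rotated])
      fix z assume "z \<in> ?T"
      then have "inv_into V \<pi> (\<pi> (act k z)) = act k z" using V(3) by (intro inv_into_f_f) auto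
      then show "cmonomial m (\<chi> i. lam $ i powi k) * cmonomial m z = ((\<lambda>x. cmonomial m (inv_into V \<pi> x)) \<circ> \<pi>) z"
        by (simp add: cmonomial_act)
    qed
    moreover have "?T \<subseteq> pre (\<pi> ` V)" using V by (auto simp: pre_proj)
    ultimately show "\<exists>T. w \<in> T \<and> T \<subseteq> pre (\<pi> ` V) \<and> holo_on ((\<lambda>x. cmonomial m (inv_into V \<pi> x)) \<circ> \<pi>) T"
      using k by (intro exI[of _ ?T]) auto
  qed
qed

lemma psi_quotient:
  assumes "z \<in> torus"
  shows "psi z v * cmonomial (\<lambda>i. nat (- (v $ i))) z = cmonomial (\<lambda>i. nat (v $ i)) z"
  unfolding psi_def cmonomial_def prod.distrib[symmetric]
  using assms by (intro prod.cong) (auto simp: torus_def power_int_def power_inverse)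

text \<open>The numerator and the denominator of a Laurent monomial need not be invariant separately, so they are used on one sheet at a time.\<close>

lemma orbit_monomial_rep:
  assumes v: "psi lam v = 1"
  shows "(\<pi> ` torus, orbit_monomial v) \<in> Rep"
  unfolding mero_rep_iff
proof (intro conjI ballI)
  let ?N = "cmonomial (\<lambda>i. nat (v $ i))" and ?D = "cmonomial (\<lambda>i. nat (- (v $ i)))"
  have D0: "?D z \<noteq> 0" if "z \<in> torus" for z using that by (simp add: torus_def cmonomial_nonzero)
  show "dense_open (\<pi> ` torus)" by (rule dense_open_torus)
  have "holo_on (\<lambda>z. ?N z * inverse (?D z)) torus"
    by (intro holo_on_mult holo_on_inverse holo_on_cmonomial open_torus D0)
  then show "holo_on (orbit_monomial v \<circ> \<pi>) (pre (\<pi> ` torus))"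
    unfolding pre_torus
  proof (rule holo_on_cong[rotated])
    fix z assume "z \<in> torus"
    then show "?N z * inverse (?D z) = (orbit_monomial v \<circ> \<pi>) z"
      using psi_quotient[of z v] D0[of z] orbit_monomial_proj[OF v, of z] by (simp add: field_simps)
  qed
  fix p assume "p \<in> topspace X"
  then obtain z where z: "z \<noteq> 0" "p = \<pi> z" by (auto simp: topspace_eq)
  obtain V where V: "open V" "z \<in> V" "V \<subseteq> E" "inj_on \<pi> V" using injective_neighbourhood[OF z(1)] by blast
  let ?W = "\<pi> ` V" and ?g = "\<lambda>x. ?N (inv_into V \<pi> x)" and ?h = "\<lambda>x. ?D (inv_into V \<pi> x)"
  have oW: "open (pre ?W)" using openin_proj[OF V(1,3)] by (simp add: openin_iff)
  have "pre ?W \<subseteq> closure (pre ?W \<inter> torus)"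
    by (rule dense_Int_open[OF oW oW closure_subset]) (simp add: dense_torus)
  also have "\<dots> \<subseteq> closure {w \<in> pre ?W. ?h (\<pi> w) \<noteq> 0}"
  proof (rule closure_mono, rule subsetI)
    fix w assume w: "w \<in> pre ?W \<inter> torus"
    then have "w \<in> pre ?W" by blast
    then obtain k where "inv_into V \<pi> (\<pi> w) = act k w" by (rule inv_into_proj[OF V(3,4)])
    then have "inv_into V \<pi> (\<pi> w) \<in> torus" using w act_torus by simp
    then show "w \<in> {w \<in> pre ?W. ?h (\<pi> w) \<noteq> 0}" using w D0 by simp
  qed
  finally have dense: "pre ?W \<subseteq> closure {w \<in> pre ?W. ?h (\<pi> w) \<noteq> 0}" .
  have "\<forall>x\<in>\<pi> ` torus \<inter> ?W. orbit_monomial v x * ?h x = ?g x"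
  proof
    fix x assume x: "x \<in> \<pi> ` torus \<inter> ?W"
    then obtain w where w: "w \<in> V" "x = \<pi> w" by blast
    then have "w \<in> pre (\<pi> ` torus)" using x V(3) by (auto simp: pre_def)
    then have "w \<in> torus" by (simp add: pre_torus)
    moreover have "inv_into V \<pi> x = w" using w V(4) by simp
    ultimately show "orbit_monomial v x * ?h x = ?g x" using orbit_monomial_proj[OF v] psi_quotient w by simp
  qed
  then show "\<exists>W g h. p \<in> W \<and> holomorphic_fun X A W g \<and> holomorphic_fun X A W h \<and>
      pre W \<subseteq> closure {z \<in> pre W. h (\<pi> z) \<noteq> 0} \<and> (\<forall>x\<in>\<pi> ` torus \<inter> W. orbit_monomial v x * h x = g x)"
    using local_monomial_holomorphic[OF V(1,3,4)] dense V(2) z(2)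
    by (intro exI[of _ ?W] exI[of _ ?g] exI[of _ ?h] conjI) auto
qed

lemma psi_injective:
  assumes "\<And>z. z \<in> torus \<Longrightarrow> psi z v = psi z w"
  shows "v = w"
proof (rule ccontr)
  assume ne: "v \<noteq> w"
  have "(\<Sum>m\<in>{v, w}. (if m = v then 1 else - 1) * psi z m) = 0" if "\<And>i. z $ i \<noteq> 0" for z
    using assms[of z] that ne by (simp add: torus_def)
  from laurent_monomials_independent[where E = "{v, w}" and c = "\<lambda>m. if m = v then 1 else - 1", OF _ this, of v]
  show False by simp
qed

text \<open>A multiset over the basis monomials is sent to the exponent vector of its product; this is injective because the
\<open>v i\<close> are linearly independent.  A polynomial relation is thus a relation between distinct Laurent monomials.\<close>

lemma independent_monomials:
  assumes v: "\<And>i. i < r \<Longrightarrow> psi lam (v i) = 1" and bd: "bounded_coefficients r v C"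
  shows "\<exists>S. finite S \<and> alg_indep M (range (mero_const X A)) S \<and> card S = r"
proof -
  define x where "x = (\<lambda>i. cls (\<pi> ` torus) (orbit_monomial (v i)))"
  have coeff: "a i = b i" if "int_span r v a = int_span r v b" "i < r" for a b i
    using int_span_zero_coefficients[OF bd that] .
  have unit: "int_span r v (\<lambda>k. if k = i then 1 else 0) = v i" if "i < r" for i
  proof -
    have "int_span r v (\<lambda>k. if k = i then 1 else 0) = (\<Sum>k<r. if k = i then v i else 0)"
      unfolding int_span_def by (intro sum.cong) auto
    then show ?thesis using that by simp
  qed
  have inj: "inj_on x {..<r}"
  proof (rule inj_onI)
    fix i j assume ij: "i \<in> {..<r}" "j \<in> {..<r}" "x i = x j"
    then have "\<forall>y\<in>\<pi> ` torus. orbit_monomial (v i) y = orbit_monomial (v j) y"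
      unfolding x_def using cls_eq_iff[OF orbit_monomial_rep orbit_monomial_rep, of "v i" "v j"] v by auto
    then have "psi z (v i) = psi z (v j)" if "z \<in> torus" for z
      using that orbit_monomial_proj v ij by fastforce
    then have "v i = v j" by (rule psi_injective)
    then have "int_span r v (\<lambda>k. if k = i then 1 else 0) = int_span r v (\<lambda>k. if k = j then 1 else 0)"
      using unit[of i] unit[of j] ij by simp
    from coeff[OF this, of i] ij show "i = j" by (auto split: if_splits)
  qed
  define S where "S = x ` {..<r}"
  define idx where "idx = inv_into {..<r} x"
  have idx: "idx (x i) = i" if "i < r" for i using inj that by (simp add: idx_def)
  have S: "finite S" "card S = r" using inj by (simp_all add: S_def card_image)
  have rep: "\<forall>s\<in>S. (\<pi> ` torus, orbit_monomial (v (idx s))) \<in> Rep \<and> s = cls (\<pi> ` torus) (orbit_monomial (v (idx s)))"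
  proof (intro ballI conjI)
    fix s assume "s \<in> S"
    then obtain i where i: "i < r" "s = x i" by (auto simp: S_def)
    show "(\<pi> ` torus, orbit_monomial (v (idx s))) \<in> Rep" using i idx orbit_monomial_rep v by simp
    show "s = cls (\<pi> ` torus) (orbit_monomial (v (idx s)))" unfolding i(2) idx[OF i(1)] by (rule x_def[THEN fun_cong])
  qed
  have "alg_indep M (range (mero_const X A)) S"
    unfolding alg_indep_iff[OF dense_open_torus rep] pre_torus
  proof (intro allI impI)
    fix N k assume N: "finite N" "\<forall>m\<in>N. set_mset m \<subseteq> S"
      and zero: "\<forall>z\<in>torus. (\<Sum>m\<in>N. k m * (\<Prod>s\<in>set_mset m. orbit_monomial (v (idx s)) (\<pi> z) ^ count m s)) = 0"
    define e where "e = (\<lambda>m. int_span r v (\<lambda>i. int (count m (x i))))"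
    have prod_eq: "(\<Prod>s\<in>set_mset m. orbit_monomial (v (idx s)) (\<pi> z) ^ count m s) = psi z (e m)"
      if m: "m \<in> N" and z: "z \<in> torus" for m z
    proof -
      have "(\<Prod>s\<in>set_mset m. orbit_monomial (v (idx s)) (\<pi> z) ^ count m s) = (\<Prod>s\<in>S. orbit_monomial (v (idx s)) (\<pi> z) ^ count m s)"
        using N m S(1) by (intro prod.mono_neutral_left) (auto simp: not_in_iff)
      also have "\<dots> = (\<Prod>i<r. orbit_monomial (v (idx (x i))) (\<pi> z) ^ count m (x i))"
        unfolding S_def by (subst prod.reindex[OF inj]) simp
      also have "\<dots> = (\<Prod>i<r. psi z (v i) ^ count m (x i))"
        by (intro prod.cong) (auto simp: idx orbit_monomial_proj v)
      also have "\<dots> = psi z (e m)" unfolding e_def by (rule psi_int_span[OF z, symmetric])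
      finally show ?thesis .
    qed
    have e_inj: "inj_on e N"
    proof (rule inj_onI)
      fix m m' assume m: "m \<in> N" "m' \<in> N" "e m = e m'"
      show "m = m'"
      proof (rule multiset_eqI)
        fix s
        show "count m s = count m' s"
        proof (cases "s \<in> S")
          case True
          then obtain i where i: "i < r" "s = x i" by (auto simp: S_def)
          from coeff[OF m(3)[unfolded e_def] i(1)] show ?thesis using i by simp
        next
          case False
          then have "s \<notin># m" "s \<notin># m'" using N m by auto
          then show ?thesis by (simp add: not_in_iff)
        qed
      qed
    qed
    have rel: "(\<Sum>w\<in>e ` N. k (inv_into N e w) * psi z w) = 0" if "\<And>i. z $ i \<noteq> 0" for z
    proof -
      have z: "z \<in> torus" using that by (simp add: torus_def)
      have "(\<Sum>w\<in>e ` N. k (inv_into N e w) * psi z w) = (\<Sum>m\<in>N. k m * psi z (e m))"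
        by (subst sum.reindex[OF e_inj]) (auto intro!: sum.cong simp: inv_into_f_f[OF e_inj])
      also have "\<dots> = (\<Sum>m\<in>N. k m * (\<Prod>s\<in>set_mset m. orbit_monomial (v (idx s)) (\<pi> z) ^ count m s))"
        by (intro sum.cong) (auto simp: prod_eq z)
      finally show ?thesis using zero z by simp
    qed
    show "\<forall>m\<in>N. k m = 0"
    proof
      fix m assume m: "m \<in> N"
      have "k (inv_into N e (e m)) = 0"
        by (rule laurent_monomials_independent[where E = "e ` N" and c = "\<lambda>w. k (inv_into N e w)",
              OF finite_imageI[OF N(1)] rel imageI[OF m]])
      then show "k m = 0" by (simp add: inv_into_f_f[OF e_inj m])
    qed
  qed
  then show ?thesis using S by blast
qed

end

theorem proposition4p4:
  fixes lam :: "complex^'n::finite"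
  assumes "CARD('n) \<ge> 2"
    and "\<And>i. 0 < cmod (lam $ i) \<and> cmod (lam $ i) < 1"
  shows "algebraic_dimension (hopf_topology lam) (hopf_atlas lam) =
    enat (free_rank (int_vec_group\<lparr>carrier := kernel int_vec_group complex_units (psi lam)\<rparr>))"
proof -
  interpret diagonal_hopf lam by unfold_locales (use assms(2) in auto)
  define L where "L = {x. psi lam x = 1}"
  have ker: "kernel int_vec_group complex_units (psi lam) = L"
    by (auto simp: kernel_def int_vec_group_def complex_units_def L_def)
  have L: "0 \<in> L" "\<And>x y. x \<in> L \<Longrightarrow> y \<in> L \<Longrightarrow> x - y \<in> L"
    by (auto simp: L_def psi_def power_int_diff lam_nonzero prod_dividef)
  have "\<exists>r v C. 0 \<le> C \<and> (\<forall>i<r. v i \<in> L) \<and> (\<forall>x\<in>L. \<exists>a. x = int_span r v a) \<and>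
      bounded_coefficients r v C"
    by (rule lattice_basis[OF finite_class.finite_UNIV L]) auto
  then obtain r v C where C: "0 \<le> C" and basis: "\<forall>i<r. v i \<in> L" "\<forall>x\<in>L. \<exists>a. x = int_span r v a"
    and bd: "bounded_coefficients r v C" by (elim exE conjE)
  have v: "v i \<in> L" if "i < r" for i using basis(1) that by blast
  have gen: "\<exists>a. x = int_span r v a" if "x \<in> L" for x using basis(2) that by blast
  have rank: "free_rank (int_vec_group\<lparr>carrier := L\<rparr>) = r"
  proof (rule free_rank_lattice[of L r v])
    show "a i = b i" if "int_span r v a = int_span r v b" "i < r" for a b i
      by (rule int_span_zero_coefficients[OF bd that])
  qed (fact L v gen)+
  have "trdeg M (range (mero_const X A)) = enat r"
    unfolding trdeg_def
  proof (rule antisym)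
    show "(SUP S\<in>{S. finite S \<and> alg_indep M (range (mero_const X A)) S}. enat (card S)) \<le> enat r"
    proof (rule SUP_least)
      fix S assume "S \<in> {S. finite S \<and> alg_indep M (range (mero_const X A)) S}"
      then have "card S \<le> r"
        by (intro alg_indep_card_le[OF assms(1) _ _ C gen bd]) (auto simp: L_def)
      then show "enat (card S) \<le> enat r" by simp
    qed
    obtain S where S: "finite S" "alg_indep M (range (mero_const X A)) S" "card S = r"
      using independent_monomials[OF _ bd] v by (auto simp: L_def)
    show "enat r \<le> (SUP S\<in>{S. finite S \<and> alg_indep M (range (mero_const X A)) S}. enat (card S))"
      by (rule SUP_upper2[of S]) (use S in auto)
  qed
  then show ?thesis by (simp add: algebraic_dimension_def ker rank)
qed

end
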